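(* In the row-constrained, possibly rank-deficient errors-in-variables model described in the context, assume: (i) the rows of the noise matrix $E=[E_{A_2}\ \ E_{B_2}]$ are i.i.d. random vectors with mean $0\in\mathbb{R}^{n+\ell}$ and covariance matrix $\sigma^2 I_{n+\ell}$ (with $\sigma^2<\infty$); (ii) the limit $\bar T:=\lim_{m\to\infty}m^{-1}P^{\top}\bar C_2^{\top}\bar C_2P$ exists and $\operatorname{rank}(\bar T)=r-k$. Then $\mathcal{R}\left(\lim_{m\to\infty}Z\right)=\mathcal{R}(\bar Y)$ with probability one, in the following sense: letting $\bar{\mathcal Z}$ be the set of all $\bar Z\in\mathbb{R}^{(n+\ell)\times(n+\ell-r)}$ with $\bar Z^{\top}\bar Z=I_{n+\ell-r}$ and $\mathcal{R}(\bar Z)=\mathcal{R}(\bar Y)$, one has $$\lim_{m\to\infty}\ \min_{\bar Z\in\bar{\mathcal Z}}\|Z-\bar Z\|=0\quad\text{with probability one,}$$ whatever choice of orthonormal eigenvectors is made in the definition of $Z$.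
   Context: Notation: $\mathcal{R}(\cdot)$ and $\mathcal{N}(\cdot)$ are the range and null space of a matrix; $I_p$ is the $p\times p$ identity matrix; $\|\cdot\|$ is the spectral norm. Model: $n,\ell\ge 1$ and $0\le k<r\le n$ are fixed integers; the sample size $m$ tends to infinity. $A_1\in\mathbb{R}^{k\times n}$ with $\operatorname{rank}(A_1)=k$ and $B_1\in\mathbb{R}^{k\times\ell}$ are fixed, deterministic and known exactly. Deterministic sequences $\bar a_i\in\mathbb{R}^n$, $\bar b_i\in\mathbb{R}^{\ell}$ ($i=k+1,k+2,\dots$) are given, and for each $m>k$, $\bar A_2=[\bar a_{k+1},\dots,\bar a_m]^{\top}\in\mathbb{R}^{(m-k)\times n}$, $\bar B_2=[\bar b_{k+1},\dots,\bar b_m]^{\top}\in\mathbb{R}^{(m-k)\times\ell}$. There is an $X\in\mathbb{R}^{n\times\ell}$ independent of $m$ (not necessarily unique) with $A_1X=B_1$ and $\bar A_2X=\bar B_2$ for all $m$. With $\bar A:=\begin{bmatrix}A_1\\ \bar A_2\end{bmatrix}$, one assumes $\operatorname{rank}(\bar A)=r$ (for all sufficiently large $m$). One observes $A_1,B_1$ and $A_2=\bar A_2+E_{A_2}$, $B_2=\bar B_2+E_{B_2}$, where $E:=[E_{A_2}\ \ E_{B_2}]\in\mathbb{R}^{(m-k)\times(n+\ell)}$ is random; the rows of $E$ are the first $m-k$ terms of one fixed sequence of random vectors on a common probability space. Set $\bar C_2:=[\bar A_2\ \ \bar B_2]$ and $C_2:=[A_2\ \ B_2]=\bar C_2+E$.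 Fix $P\in\mathbb{R}^{(n+\ell)\times(n+\ell-k)}$ with $P^{\top}P=I_{n+\ell-k}$ and $[A_1\ \ B_1]P=0$ ($P=I_{n+\ell}$ if $k=0$). Estimator: $G:=P^{\top}C_2^{\top}C_2P\in\mathbb{R}^{(n+\ell-k)\times(n+\ell-k)}$; $V\in\mathbb{R}^{(n+\ell-k)\times(n+\ell-r)}$ is a matrix whose columns are orthonormal eigenvectors of $G$ corresponding to its $n+\ell-r$ smallest eigenvalues (counted with multiplicity); $Z:=PV\in\mathbb{R}^{(n+\ell)\times(n+\ell-r)}$. All of these depend on $m$ and on the random sample. Target: for sufficiently large $m$ the solution set of $\begin{bmatrix}A_1\\ \bar A_2\end{bmatrix}X=\begin{bmatrix}B_1\\ \bar B_2\end{bmatrix}$ does not depend on $m$. Let $X_{\min}$ be its solution of minimal Frobenius norm, let $W\in\mathbb{R}^{n\times(n-r)}$ satisfy $\mathcal{R}(W)=\mathcal{N}(\bar A)$, and put $$\bar Y:=\begin{bmatrix}-X_{\min}&W\\ I_{\ell}&0_{\ell\times(n-r)}\end{bmatrix}\in\mathbb{R}^{(n+\ell)\times(n+\ell-r)},\qquad \mathcal{R}(\bar Y)=\mathcal{N}\left(\begin{bmatrix}A_1&B_1\\ \bar A_2&\bar B_2\end{bmatrix}\right).$$ (If $r=n$, $W$ is absent.) *)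

theory Defs
  imports "HOL-Probability.Probability" "Jordan_Normal_Form.DL_Rank" "Jordan_Normal_Form.Matrix_Kernel"
    "Jordan_Normal_Form.Char_Poly"
begin

unbundle no vec_syntax and no inner_syntax

text \<open>
  All sizes are term-level natural numbers (they are related by subtraction, \<open>m\<close> tends to
  infinity, and \<open>k\<close> and \<open>n - r\<close> may be \<open>0\<close>), so matrices are those of
  \<open>Jordan_Normal_Form.Matrix\<close>, with explicit carriers.
\<close>

abbreviation mat_rank :: "real mat \<Rightarrow> nat" where
  "mat_rank A \<equiv> vec_space.rank (dim_row A) A"

abbreviation mat_range :: "real mat \<Rightarrow> real Matrix.vec set" where
  "mat_range A \<equiv> vec_space.col_space (dim_row A) A"

definition append_cols :: "'a :: zero mat \<Rightarrow> 'a mat \<Rightarrow> 'a mat" (infixr \<open>@\<^sub>c\<close> 66) where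
  "A @\<^sub>c B = four_block_mat A B (0\<^sub>m 0 (dim_col A)) (0\<^sub>m 0 (dim_col B))"

definition vec_norm2 :: "real Matrix.vec \<Rightarrow> real" where
  "vec_norm2 v = sqrt (v \<bullet> v)"

definition spectral_norm :: "real mat \<Rightarrow> real" where
  "spectral_norm A = (SUP v \<in> {v \<in> carrier_vec (dim_col A). vec_norm2 v \<le> 1}. vec_norm2 (A *\<^sub>v v))"

definition frobenius_norm :: "real mat \<Rightarrow> real" where
  "frobenius_norm A = sqrt (\<Sum>i<dim_row A. \<Sum>j<dim_col A. (A $$ (i, j))\<^sup>2)"

definition mat_tendsto :: "(nat \<Rightarrow> real mat) \<Rightarrow> real mat \<Rightarrow> bool" where
  "mat_tendsto S L \<longleftrightarrow>
     (\<forall>\<^sub>F m in sequentially. S m \<in> carrier_mat (dim_row L) (dim_col L)) \<and>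
     (\<forall>i<dim_row L. \<forall>j<dim_col L. (\<lambda>m. S m $$ (i, j)) \<longlonglongrightarrow> L $$ (i, j))"

definition min_frobenius_solution :: "real mat \<Rightarrow> real mat \<Rightarrow> real mat \<Rightarrow> bool" where
  "min_frobenius_solution A B X \<longleftrightarrow>
     X \<in> carrier_mat (dim_col A) (dim_col B) \<and> A * X = B \<and>
     (\<forall>X' \<in> carrier_mat (dim_col A) (dim_col B). A * X' = B \<longrightarrow> frobenius_norm X \<le> frobenius_norm X')"

text \<open>
  The columns of \<open>V\<close> are orthonormal eigenvectors of \<open>G\<close> for its \<open>p\<close> smallest eigenvalues. Here
  \<open>es\<close> lists all eigenvalues of \<open>G\<close> with multiplicity in nondecreasing order, and \<open>ds ! j\<close> is the
  eigenvalue belonging to column \<open>j\<close>; the order of the columns is not prescribed.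
\<close>
definition smallest_eigenvectors :: "real mat \<Rightarrow> nat \<Rightarrow> real mat \<Rightarrow> bool" where
  "smallest_eigenvectors G p V \<longleftrightarrow>
     V \<in> carrier_mat (dim_row G) p \<and> V\<^sup>T * V = 1\<^sub>m p \<and>
     (\<exists>es ds. char_poly G = (\<Prod>e\<leftarrow>es. [:- e, 1:]) \<and> sorted es \<and>
        mset ds = mset (take p es) \<and> (\<forall>j<p. eigenvector G (col V j) (ds ! j)))"

text \<open>The Borel space of real vectors of dimension \<open>d\<close>.\<close>
definition vec_borel :: "nat \<Rightarrow> real Matrix.vec measure" where
  "vec_borel d = vimage_algebra (carrier_vec d) (\<lambda>v. \<lambda>i\<in>{..<d}. v $ i) (\<Pi>\<^sub>M i\<in>{..<d}. borel)"

definition iid_vars :: "'w measure \<Rightarrow> 'b measure \<Rightarrow> ('i \<Rightarrow> 'w \<Rightarrow> 'b) \<Rightarrow> 'i set \<Rightarrow> bool" where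
  "iid_vars M N X I \<longleftrightarrow> prob_space.indep_vars M (\<lambda>_. N) X I \<and>
     (\<forall>i\<in>I. \<forall>j\<in>I. distr M N (X i) = distr M N (X j))"

definition square_integrable_vec :: "'w measure \<Rightarrow> nat \<Rightarrow> ('w \<Rightarrow> real Matrix.vec) \<Rightarrow> bool" where
  "square_integrable_vec M d X \<longleftrightarrow> (\<forall>i<d. integrable M (\<lambda>\<omega>. (X \<omega> $ i)\<^sup>2))"

definition mean_vec :: "'w measure \<Rightarrow> nat \<Rightarrow> ('w \<Rightarrow> real Matrix.vec) \<Rightarrow> real Matrix.vec" where
  "mean_vec M d X = Matrix.vec d (\<lambda>i. \<integral>\<omega>. X \<omega> $ i \<partial>M)"

definition cov_mat :: "'w measure \<Rightarrow> nat \<Rightarrow> ('w \<Rightarrow> real Matrix.vec) \<Rightarrow> real mat" where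
  "cov_mat M d X = Matrix.mat d d (\<lambda>(i, j).
     \<integral>\<omega>. (X \<omega> $ i - mean_vec M d X $ i) * (X \<omega> $ j - mean_vec M d X $ j) \<partial>M)"

text \<open>The matrix with \<open>d\<close> columns and rows \<open>x (k + 1), \<dots>, x m\<close>.\<close>
definition rows_upto :: "nat \<Rightarrow> nat \<Rightarrow> (nat \<Rightarrow> real Matrix.vec) \<Rightarrow> nat \<Rightarrow> real mat" where
  "rows_upto d k x m = mat_of_rows d (map x [Suc k..<Suc m])"

text \<open>The exact and the observed unconstrained data; \<open>e i\<close> is the noise in row \<open>i\<close>.\<close>
definition C2_bar :: "nat \<Rightarrow> nat \<Rightarrow> nat \<Rightarrow> (nat \<Rightarrow> real Matrix.vec) \<Rightarrow> (nat \<Rightarrow> real Matrix.vec) \<Rightarrow> nat \<Rightarrow> real mat"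
  where "C2_bar n l k a b m = rows_upto n k a m @\<^sub>c rows_upto l k b m"

definition C2 :: "nat \<Rightarrow> nat \<Rightarrow> nat \<Rightarrow> (nat \<Rightarrow> real Matrix.vec) \<Rightarrow> (nat \<Rightarrow> real Matrix.vec) \<Rightarrow>
    (nat \<Rightarrow> 'w \<Rightarrow> real Matrix.vec) \<Rightarrow> nat \<Rightarrow> 'w \<Rightarrow> real mat" where
  "C2 n l k a b e m \<omega> = C2_bar n l k a b m + rows_upto (n + l) k (\<lambda>i. e i \<omega>) m"

definition projected_gram :: "real mat \<Rightarrow> real mat \<Rightarrow> real mat" where
  "projected_gram P C = P\<^sup>T * C\<^sup>T * C * P"

definition Y_bar :: "nat \<Rightarrow> nat \<Rightarrow> nat \<Rightarrow> real mat \<Rightarrow> real mat \<Rightarrow> real mat" where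
  "Y_bar n l r X W = four_block_mat (- X) W (1\<^sub>m l) (0\<^sub>m l (n - r))"

definition Z_bar_set :: "nat \<Rightarrow> nat \<Rightarrow> nat \<Rightarrow> real mat \<Rightarrow> real mat \<Rightarrow> real mat set" where
  "Z_bar_set n l r X W = {Zb \<in> carrier_mat (n + l) (n + l - r).
     Zb\<^sup>T * Zb = 1\<^sub>m (n + l - r) \<and> mat_range Zb = mat_range (Y_bar n l r X W)}"

definition is_minimum :: "real set \<Rightarrow> real \<Rightarrow> bool" where
  "is_minimum S d \<longleftrightarrow> d \<in> S \<and> (\<forall>x\<in>S. d \<le> x)"

end

theory Submission
  imports Defs "HOL-Library.Discrete_Functions" "HOL-Real_Asymp.Real_Asymp"
begin

text \<open>
The noise has covariance \<open>\<sigma>\<^sup>2 I\<close>, so after division by \<open>m\<close> the observed Gram matrix differs from the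
exact one, in the limit, only by a multiple of the identity: almost surely
\<open>m\<^sup>-\<^sup>1 G \<longlonglongrightarrow> T + \<sigma>\<^sup>2 I\<close> (\<open>noisy_projected_gram_limit\<close>). A multiple of the identity moves all
eigenvalues by the same amount and leaves the eigenvectors alone. The eigenvectors of the smallest
eigenvalues of \<open>G\<close> therefore approach the eigenvectors of the smallest eigenvalues of the positive
semidefinite matrix \<open>T\<close>, that is, its null space, and \<open>P\<close> maps this null space onto the range of
\<open>Y_bar\<close> (\<open>Y_bar_range_limit_kernel\<close>).

\<^emph>\<open>Probability.\<close> An entry of \<open>m\<^sup>-\<^sup>1 G\<close> is an average of products of an exact row form plus a noise
form. The products of two noise forms are i.i.d. and merely integrable, so their averages need the
strong law under first moments only. It is proved here by the random-walk argument: if the steps have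
negative mean, the running maximum of the walk is almost surely finite. For the mixed products,
square integrability gives convergence along the subsequence of squares by a second-moment
computation, and the strong law for the squared noise controls the gaps (\<open>iid_weighted_average\<close>).

\<^emph>\<open>Linear algebra.\<close> By a minimum principle of Ky Fan
(\<open>smallest_eigenvectors_minimize_trace\<close>), the columns \<open>v\<^sub>j\<close> of \<open>V\<close> minimise
\<open>\<Sum>j. v\<^sub>j \<bullet> (G v\<^sub>j)\<close> among all orthonormal families of the same size; compare them with an
orthonormal basis of the null space of \<open>T\<close>. Along any subsequence on which \<open>V\<close> converges, the limit is
an orthonormal family with \<open>\<Sum>j. v\<^sub>j \<bullet> (T v\<^sub>j) \<le> 0\<close>, so it lies in the null space of \<open>T\<close> and, by
dimension, is a basis of it (\<open>smallest_eigenvectors_limit\<close>). Sets of matrices with orthonormal columns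
are sequentially compact; this gives the existence of the minimum distance, and the convergence of the
whole sequence of distances to \<open>0\<close> (\<open>distance_to_kernel_bases_tendsto_0\<close>).

The dimension of the null space of \<open>T\<close> comes from the rank hypothesis on \<open>T\<close> through rank-nullity, and
the dimension of the range of \<open>Y_bar\<close> from the rank hypothesis on the exact data matrix.
\<close>

section \<open>The strong law of large numbers\<close>

text \<open>
The largest of the partial sums of \<open>x j, x (j + 1), \<dots>\<close> with at most \<open>n\<close> terms, the empty sum included.
The recursion peels off the first step instead of the last one: it makes the maximum started at \<open>j\<close> a
function of \<open>x j\<close> and of the maximum started at \<open>j + 1\<close>, which are independent.
\<close>

primrec max_partial_sum :: "nat \<Rightarrow> nat \<Rightarrow> (nat \<Rightarrow> real) \<Rightarrow> real" where
  "max_partial_sum 0 j x = 0"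
| "max_partial_sum (Suc n) j x = max 0 (x j + max_partial_sum n (Suc j) x)"

lemma max_partial_sum_nonneg: "0 \<le> max_partial_sum n j x"
  by (cases n) auto

lemma max_partial_sum_mono_Suc: "max_partial_sum n j x \<le> max_partial_sum (Suc n) j x"
proof (induction n arbitrary: j)
  case (Suc n)
  have "max 0 (x j + max_partial_sum n (Suc j) x) \<le> max 0 (x j + max_partial_sum (Suc n) (Suc j) x)"
    by (intro max.mono add_left_mono Suc.IH order_refl)
  then show ?case by (simp only: max_partial_sum.simps)
qed simp

lemma max_partial_sum_mono: "m \<le> n \<Longrightarrow> max_partial_sum m j x \<le> max_partial_sum n j x"
  by (rule lift_Suc_mono_le[of "\<lambda>n. max_partial_sum n j x"]) (rule max_partial_sum_mono_Suc)

lemma sum_le_max_partial_sum: "(\<Sum>i<n. x (j + i)) \<le> max_partial_sum n j x"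
proof (induction n arbitrary: j)
  case (Suc n)
  have "(\<Sum>i<Suc n. x (j + i)) = x j + (\<Sum>i<n. x (Suc j + i))"
    by (subst sum.lessThan_Suc_shift) simp
  with Suc[of "Suc j"] show ?case by simp
qed simp

text \<open>
The maximum started at \<open>j\<close> depends only on the terms from \<open>j\<close> on. This is what makes it independent of
earlier terms.
\<close>

lemma max_partial_sum_restrict:
  "{j..} \<subseteq> K \<Longrightarrow> max_partial_sum n j (restrict x K) = max_partial_sum n j x"
proof (induction n arbitrary: j)
  case (Suc n)
  have "{Suc j..} \<subseteq> K" "j \<in> K" using Suc.prems by (auto simp: subset_iff)
  with Suc.IH[of "Suc j"] show ?case by simp
qed simp

lemma max_partial_sum_measurable [measurable]:
  assumes "\<And>i. j \<le> i \<Longrightarrow> (\<lambda>\<omega>. X i \<omega>) \<in> borel_measurable N"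
  shows "(\<lambda>\<omega>. max_partial_sum n j (\<lambda>i. X i \<omega>)) \<in> borel_measurable N"
  using assms
proof (induction n arbitrary: j)
  case (Suc n)
  have [measurable]: "(\<lambda>\<omega>. X j \<omega>) \<in> borel_measurable N"
    "(\<lambda>\<omega>. max_partial_sum n (Suc j) (\<lambda>i. X i \<omega>)) \<in> borel_measurable N"
    using Suc.prems Suc.IH[of "Suc j"] by auto
  show ?case by simp
qed simp

text \<open>
A single step cannot decide whether the walk has a finite supremum, so finiteness is a tail event.
\<close>

lemma bdd_above_max_partial_sum_Suc:
  "bdd_above (range (\<lambda>n. max_partial_sum n j x)) \<longleftrightarrow>
   bdd_above (range (\<lambda>n. max_partial_sum n (Suc j) x))"
proof
  assume "bdd_above (range (\<lambda>n. max_partial_sum n j x))"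
  then obtain B where B: "\<And>n. max_partial_sum n j x \<le> B" by (auto simp: bdd_above_def)
  have "max_partial_sum n (Suc j) x \<le> B - x j" for n using B[of "Suc n"] by simp
  then show "bdd_above (range (\<lambda>n. max_partial_sum n (Suc j) x))" by (auto simp: bdd_above_def)
next
  assume "bdd_above (range (\<lambda>n. max_partial_sum n (Suc j) x))"
  then obtain B where B: "\<And>n. max_partial_sum n (Suc j) x \<le> B" by (auto simp: bdd_above_def)
  have "max_partial_sum n j x \<le> max 0 (x j + B)" for n
  proof (cases n)
    case (Suc k) then show ?thesis using B[of k] by simp
  qed simp
  then show "bdd_above (range (\<lambda>n. max_partial_sum n j x))" by (auto simp: bdd_above_def)
qed

lemma bdd_above_max_partial_sum_shift:
  "bdd_above (range (\<lambda>n. max_partial_sum n j x)) \<longleftrightarrow>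
   bdd_above (range (\<lambda>n. max_partial_sum n 0 x))"
  by (induction j) (use bdd_above_max_partial_sum_Suc in auto)

context prob_space
begin

lemma iid_random_variable:
  "iid_vars M N X I \<Longrightarrow> i \<in> I \<Longrightarrow> X i \<in> measurable M N"
  by (auto simp: iid_vars_def indep_vars_def)

lemma iid_max_partial_sum_indep:
  fixes X :: "nat \<Rightarrow> 'a \<Rightarrow> real"
  assumes iid: "iid_vars M borel X UNIV"
  shows "indep_var borel (X j) borel (\<lambda>\<omega>. max_partial_sum n (Suc j) (\<lambda>i. X i \<omega>))"
proof -
  have ind: "indep_vars (\<lambda>_. borel) X UNIV" using iid by (simp add: iid_vars_def)
  have "indep_var (PiM {j} (\<lambda>_. borel)) (\<lambda>\<omega>. restrict (\<lambda>i. X i \<omega>) {j})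
      (PiM {Suc j..} (\<lambda>_. borel)) (\<lambda>\<omega>. restrict (\<lambda>i. X i \<omega>) {Suc j..})"
    by (rule indep_var_restrict[OF ind]) auto
  then have "indep_var borel ((\<lambda>x. x j) \<circ> (\<lambda>\<omega>. restrict (\<lambda>i. X i \<omega>) {j}))
     borel ((\<lambda>x. max_partial_sum n (Suc j) (\<lambda>i. x i)) \<circ> (\<lambda>\<omega>. restrict (\<lambda>i. X i \<omega>) {Suc j..}))"
    by (rule indep_var_compose) (auto intro!: max_partial_sum_measurable)
  also have "(\<lambda>x. x j) \<circ> (\<lambda>\<omega>. restrict (\<lambda>i. X i \<omega>) {j}) = X j" by auto
  also have "(\<lambda>x. max_partial_sum n (Suc j) (\<lambda>i. x i)) \<circ> (\<lambda>\<omega>. restrict (\<lambda>i. X i \<omega>) {Suc j..})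
     = (\<lambda>\<omega>. max_partial_sum n (Suc j) (\<lambda>i. X i \<omega>))"
    using max_partial_sum_restrict[of "Suc j" "{Suc j..}" n] by (simp add: fun_eq_iff)
  finally show ?thesis .
qed

text \<open>
Stationarity: both factors of the product distribution of the first step and the remaining maximum are
independent of \<open>j\<close>.
\<close>

lemma iid_max_partial_sum_distr:
  fixes X :: "nat \<Rightarrow> 'a \<Rightarrow> real"
  assumes iid: "iid_vars M borel X UNIV"
  shows "distr M borel (\<lambda>\<omega>. max_partial_sum n j (\<lambda>i. X i \<omega>)) =
         distr M borel (\<lambda>\<omega>. max_partial_sum n 0 (\<lambda>i. X i \<omega>))"
proof (induction n arbitrary: j)
  case (Suc n)
  note [measurable] = iid_random_variable[OF iid UNIV_I]
  let ?g = "\<lambda>(u, v :: real). max 0 (u + v) :: real"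
  have *: "distr M borel (\<lambda>\<omega>. max_partial_sum (Suc n) j (\<lambda>i. X i \<omega>)) =
     distr (distr M borel (X j) \<Otimes>\<^sub>M distr M borel (\<lambda>\<omega>. max_partial_sum n (Suc j) (\<lambda>i. X i \<omega>))) borel ?g" for j
  proof -
    have "distr M borel (X j) \<Otimes>\<^sub>M distr M borel (\<lambda>\<omega>. max_partial_sum n (Suc j) (\<lambda>i. X i \<omega>)) =
      distr M (borel \<Otimes>\<^sub>M borel) (\<lambda>\<omega>. (X j \<omega>, max_partial_sum n (Suc j) (\<lambda>i. X i \<omega>)))"
      using iid_max_partial_sum_indep[OF iid, of j n] unfolding indep_var_distribution_eq by simp
    then show ?thesis by (simp add: distr_distr comp_def)
  qed
  have "distr M borel (X j) = distr M borel (X 0)" using iid by (simp add: iid_vars_def)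
  then show ?case unfolding *[of j] *[of 0] Suc.IH[of "Suc j"] Suc.IH[of "Suc 0"] by simp
qed simp

lemma max_partial_sum_integrable:
  fixes X :: "nat \<Rightarrow> 'a \<Rightarrow> real"
  assumes "\<And>i. integrable M (X i)"
  shows "integrable M (\<lambda>\<omega>. max_partial_sum n j (\<lambda>i. X i \<omega>))"
  by (induction n arbitrary: j) (use assms in auto)

lemma iid_integrable:
  fixes X :: "nat \<Rightarrow> 'a \<Rightarrow> real"
  assumes iid: "iid_vars M borel X UNIV" and int: "integrable M (X 0)"
  shows "integrable M (X i)" and "expectation (X i) = expectation (X 0)"
proof -
  note [measurable] = iid_random_variable[OF iid UNIV_I]
  have eq: "distr M borel (X i) = distr M borel (X 0)" using iid by (simp add: iid_vars_def)
  have "integrable (distr M borel (X 0)) (\<lambda>x. x)" by (subst integrable_distr_eq) (use int in auto)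
  then have "integrable (distr M borel (X i)) (\<lambda>x. x)" by (simp add: eq)
  then show "integrable M (X i)" by (subst (asm) integrable_distr_eq) auto
  have "integral\<^sup>L (distr M borel (X i)) (\<lambda>x. x) = integral\<^sup>L (distr M borel (X 0)) (\<lambda>x. x)"
    by (simp add: eq)
  then show "expectation (X i) = expectation (X 0)" by (simp add: integral_distr)
qed

text \<open>
Let \<open>F n j\<close> be the maximum started at \<open>j\<close>. As \<open>F n 0\<close> and \<open>F n 1\<close> have the same expectation and \<open>F\<close>
increases in \<open>n\<close>, the expectation of \<open>F (n + 1) 0 - F n 1 = max (- F n 1) (X 0)\<close> is nonnegative. If the
maxima were almost surely unbounded, this difference would tend to \<open>X 0\<close>, dominated by \<open>\<bar>X 0\<bar>\<close>, and the
mean of \<open>X 0\<close> would be nonnegative. So unboundedness does not have probability \<open>1\<close>, and being a tail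
event it has probability \<open>0\<close>.
\<close>

lemma iid_max_partial_sum_bounded:
  fixes X :: "nat \<Rightarrow> 'a \<Rightarrow> real"
  assumes iid: "iid_vars M borel X UNIV" and int: "integrable M (X 0)" and neg: "expectation (X 0) < 0"
  shows "AE \<omega> in M. bdd_above (range (\<lambda>n. max_partial_sum n 0 (\<lambda>i. X i \<omega>)))"
proof -
  note rv [measurable] = iid_random_variable[OF iid UNIV_I]
  define F where "F n j \<omega> = max_partial_sum n j (\<lambda>i. X i \<omega>)" for n j \<omega>
  have F [measurable]: "F n j \<in> borel_measurable M" for n j
    unfolding F_def by measurable
  have F_int: "integrable M (F n j)" for n j
    unfolding F_def by (rule max_partial_sum_integrable) (rule iid_integrable[OF iid int])
  \<comment> \<open>the walk that starts one step later has the same law\<close>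
  have F_exp: "expectation (F n 1) = expectation (F n 0)" for n
  proof -
    have "integral\<^sup>L (distr M borel (F n 1)) (\<lambda>x. x) = integral\<^sup>L (distr M borel (F n 0)) (\<lambda>x. x)"
      unfolding F_def using iid_max_partial_sum_distr[OF iid, of n 1] by simp
    then show ?thesis by (simp add: integral_distr)
  qed
  define A where "A = {\<omega> \<in> space M. \<not> bdd_above (range (\<lambda>n. F n 0 \<omega>))}"
  define S where "S i = {X i -` B \<inter> space M | B. B \<in> sets borel}" for i
  have S_alg: "sigma_algebra (space M) (S i)" for i
    using sets.sigma_algebra_axioms[of "vimage_algebra (space M) (X i) borel"]
    by (simp add: S_def sets_vimage_algebra2)
  have indS: "indep_sets S UNIV"
    using iid unfolding iid_vars_def indep_vars_def2 S_def by simp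
  have "A \<in> sigma_sets (space M) (\<Union> (S ` {j..}))" for j
  proof -
    let ?N = "sigma (space M) (\<Union> (S ` {j..}))"
    have sub: "\<Union> (S ` {j..}) \<subseteq> Pow (space M)" by (auto simp: S_def)
    have [measurable]: "X i \<in> borel_measurable ?N" if "j \<le> i" for i
    proof (rule measurableI)
      fix B :: "real set" assume "B \<in> sets borel"
      then have "X i -` B \<inter> space M \<in> \<Union> (S ` {j..})" using that by (auto simp: S_def)
      then show "X i -` B \<inter> space ?N \<in> sets ?N" using sub by (simp add: space_measure_of sets_measure_of sigma_sets.Basic)
    qed simp
    have [measurable]: "F n j \<in> borel_measurable ?N" for n
      unfolding F_def by (rule max_partial_sum_measurable) auto
    have "A = {\<omega> \<in> space M. \<not> bdd_above (range (\<lambda>n. F n j \<omega>))}"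
      unfolding A_def F_def using bdd_above_max_partial_sum_shift[of j] by auto
    also have "\<dots> = {\<omega> \<in> space ?N. \<not> (\<exists>B::nat. \<forall>n. F n j \<omega> \<le> of_nat B)}"
    proof -
      have "bdd_above (range (\<lambda>n. F n j \<omega>)) \<longleftrightarrow> (\<exists>B::nat. \<forall>n. F n j \<omega> \<le> of_nat B)" for \<omega>
      proof
        assume "bdd_above (range (\<lambda>n. F n j \<omega>))"
        then obtain r where r: "\<And>n. F n j \<omega> \<le> r" by (auto simp: bdd_above_def)
        obtain B :: nat where "r \<le> of_nat B" using real_arch_simple by blast
        with r have "\<forall>n. F n j \<omega> \<le> of_nat B" by (blast intro: order_trans)
        then show "\<exists>B::nat. \<forall>n. F n j \<omega> \<le> of_nat B" by blast
      qed (auto simp: bdd_above_def)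
      then show ?thesis using sub by (simp add: space_measure_of)
    qed
    also have "\<dots> \<in> sets ?N" by measurable
    finally show ?thesis using sub by (simp add: sets_measure_of)
  qed
  then have "A \<in> tail_events S" by (simp add: tail_events_def)
  from kolmogorov_0_1_law[OF S_alg indS this] have zo: "prob A = 0 \<or> prob A = 1" .
  have A_sets: "A \<in> events"
    using tail_events_sets[of S] indS \<open>A \<in> tail_events S\<close> by (auto simp: indep_sets_def)
  have "prob A \<noteq> 1"
  proof
    assume "prob A = 1"
    then have AE: "AE \<omega> in M. \<omega> \<in> A" using A_sets by (simp add: prob_eq_1)
    define D where "D n \<omega> = max (- F n 1 \<omega>) (X 0 \<omega>)" for n \<omega>
    have D_eq: "D n \<omega> = F (Suc n) 0 \<omega> - F n 1 \<omega>" for n \<omega> unfolding D_def F_def by auto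
    have "0 \<le> expectation (D n)" for n
    proof -
      have "expectation (F n 0) \<le> expectation (F (Suc n) 0)"
        by (rule integral_mono[OF F_int F_int]) (unfold F_def, rule max_partial_sum_mono_Suc)
      then show ?thesis unfolding D_eq using F_int F_exp by simp
    qed
    moreover have "(\<lambda>n. expectation (D n)) \<longlonglongrightarrow> expectation (X 0)"
    proof (rule integral_dominated_convergence)
      show "integrable M (\<lambda>\<omega>. \<bar>X 0 \<omega>\<bar>)" using int by simp
      show "AE \<omega> in M. (\<lambda>n. D n \<omega>) \<longlonglongrightarrow> X 0 \<omega>"
        using AE
      proof eventually_elim
        case (elim \<omega>)
        then have "\<not> bdd_above (range (\<lambda>n. F n 1 \<omega>))"
          unfolding A_def F_def using bdd_above_max_partial_sum_shift[of 1] by auto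
        then obtain n where n: "F n 1 \<omega> > - X 0 \<omega>"
          by (auto simp: bdd_above_def not_le)
        have "eventually (\<lambda>m. D m \<omega> = X 0 \<omega>) sequentially"
          using eventually_ge_at_top[of n]
        proof eventually_elim
          case (elim m)
          have "F n 1 \<omega> \<le> F m 1 \<omega>" unfolding F_def by (rule max_partial_sum_mono[OF elim])
          then show ?case using n by (simp add: D_def)
        qed
        then show ?case by (rule tendsto_eventually)
      qed
      show "AE \<omega> in M. norm (D n \<omega>) \<le> \<bar>X 0 \<omega>\<bar>" for n
      proof (rule AE_I2)
        fix \<omega>
        have "0 \<le> F n 1 \<omega>" unfolding F_def by (rule max_partial_sum_nonneg)
        then show "norm (D n \<omega>) \<le> \<bar>X 0 \<omega>\<bar>" by (simp add: D_def)
      qed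
    qed (use rv F in \<open>unfold D_def, measurable\<close>)
    ultimately have "0 \<le> expectation (X 0)" by (meson LIMSEQ_le_const)
    with neg show False by simp
  qed
  with zo have "prob A = 0" by simp
  then have "AE \<omega> in M. \<omega> \<notin> A" using A_sets by (simp add: prob_eq_0)
  then show ?thesis by (rule AE_mp) (auto intro!: AE_I2 simp: A_def F_def)
qed

lemma iid_vars_compose:
  assumes "iid_vars M N X I" "f \<in> measurable N K"
  shows "iid_vars M K (\<lambda>i \<omega>. f (X i \<omega>)) I"
proof -
  have ind: "indep_vars (\<lambda>_. N) X I" and eq: "\<And>i j. i \<in> I \<Longrightarrow> j \<in> I \<Longrightarrow> distr M N (X i) = distr M N (X j)"
    using assms(1) unfolding iid_vars_def by blast+
  have "distr M K (\<lambda>\<omega>. f (X i \<omega>)) = distr (distr M N (X i)) K f" if "i \<in> I" for i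
    using assms(2) iid_random_variable[OF assms(1) that] by (simp add: distr_distr comp_def)
  then have "distr M K (\<lambda>\<omega>. f (X i \<omega>)) = distr M K (\<lambda>\<omega>. f (X j \<omega>))" if "i \<in> I" "j \<in> I" for i j
    using that eq[OF that] by (simp only:)
  moreover have "indep_vars (\<lambda>_. K) (\<lambda>i \<omega>. f (X i \<omega>)) I"
    by (rule indep_vars_compose2[OF ind]) (rule assms(2))
  ultimately show ?thesis unfolding iid_vars_def by blast
qed

text \<open>
Apply the boundedness of the walk to \<open>X i - c'\<close> with \<open>c'\<close> strictly between the mean and \<open>c\<close>: the sums
exceed \<open>n c'\<close> by a bounded amount only.
\<close>

lemma iid_average_upper:
  fixes X :: "nat \<Rightarrow> 'a \<Rightarrow> real"
  assumes iid: "iid_vars M borel X UNIV" and int: "integrable M (X 0)" and c: "expectation (X 0) < c"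
  shows "AE \<omega> in M. \<forall>\<^sub>F n in sequentially. (\<Sum>i<n. X i \<omega>) / real n < c"
proof -
  obtain c' where c': "expectation (X 0) < c'" "c' < c" using c dense by blast
  have iid': "iid_vars M borel (\<lambda>i \<omega>. X i \<omega> - c') UNIV"
    by (rule iid_vars_compose[OF iid]) measurable
  have "expectation (\<lambda>\<omega>. X 0 \<omega> - c') < 0" using int c' by (simp add: prob_space)
  moreover have "integrable M (\<lambda>\<omega>. X 0 \<omega> - c')" using int by simp
  ultimately have "AE \<omega> in M. bdd_above (range (\<lambda>n. max_partial_sum n 0 (\<lambda>i. X i \<omega> - c')))"
    using iid_max_partial_sum_bounded[OF iid'] by blast
  then show ?thesis
  proof eventually_elim
    case (elim \<omega>)
    then obtain B where B: "\<And>n. max_partial_sum n 0 (\<lambda>i. X i \<omega> - c') \<le> B" by (auto simp: bdd_above_def)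
    have S: "(\<Sum>i<n. X i \<omega>) \<le> B + real n * c'" for n
    proof -
      have "(\<Sum>i<n. X (0 + i) \<omega> - c') \<le> B"
        using sum_le_max_partial_sum[of "\<lambda>i. X i \<omega> - c'" 0 n] B[of n] by (rule order_trans)
      then show ?thesis by (simp add: sum_subtractf)
    qed
    have "(\<lambda>n. B / real n + c') \<longlonglongrightarrow> 0 + c'" by (intro tendsto_intros lim_const_over_n)
    then have "\<forall>\<^sub>F n in sequentially. B / real n + c' < c" using c' by (intro order_tendstoD) auto
    then have ev: "\<forall>\<^sub>F n in sequentially. 0 < n \<and> B / real n + c' < c"
      using eventually_gt_at_top[of "0::nat"] by (rule eventually_conj[rotated])
    show ?case
    proof (rule eventually_mono[OF ev])
      fix n :: nat assume n: "0 < n \<and> B / real n + c' < c"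
      have "(\<Sum>i<n. X i \<omega>) / real n \<le> (B + real n * c') / real n" using S by (rule divide_right_mono) simp
      also have "\<dots> = B / real n + c'" using n by (simp add: field_simps)
      also have "\<dots> < c" using n by simp
      finally show "(\<Sum>i<n. X i \<omega>) / real n < c" .
    qed
  qed
qed

theorem strong_law_of_large_numbers:
  fixes X :: "nat \<Rightarrow> 'a \<Rightarrow> real"
  assumes iid: "iid_vars M borel X UNIV" and int: "integrable M (X 0)"
  shows "AE \<omega> in M. (\<lambda>n. (\<Sum>i<n. X i \<omega>) / real n) \<longlonglongrightarrow> expectation (X 0)"
proof -
  let ?\<mu> = "expectation (X 0)"
  \<comment> \<open>the lower bound is the upper bound for the negated variables\<close>
  have iid': "iid_vars M borel (\<lambda>i \<omega>. - X i \<omega>) UNIV" by (rule iid_vars_compose[OF iid]) measurable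
  have "AE \<omega> in M. \<forall>k. \<forall>\<^sub>F n in sequentially. (\<Sum>i<n. X i \<omega>) / real n < ?\<mu> + 1 / Suc k"
    unfolding AE_all_countable by (rule allI, rule iid_average_upper[OF iid int]) simp
  moreover have "AE \<omega> in M. \<forall>k. \<forall>\<^sub>F n in sequentially. (\<Sum>i<n. - X i \<omega>) / real n < - ?\<mu> + 1 / Suc k"
    unfolding AE_all_countable by (rule allI, rule iid_average_upper[OF iid']) (use int in simp_all)
  ultimately show ?thesis
  proof eventually_elim
    case (elim \<omega>)
    show ?case
    proof (rule tendstoI)
      fix r :: real assume "0 < r"
      then obtain k where k: "1 / real (Suc k) < r" by (rule nat_approx_posE)
      have ev: "\<forall>\<^sub>F n in sequentially. (\<Sum>i<n. X i \<omega>) / real n < ?\<mu> + 1 / Suc k \<and>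
          (\<Sum>i<n. - X i \<omega>) / real n < - ?\<mu> + 1 / Suc k"
        using spec[OF elim(1), of k] spec[OF elim(2), of k] by (rule eventually_conj)
      show "\<forall>\<^sub>F n in sequentially. dist ((\<Sum>i<n. X i \<omega>) / real n) ?\<mu> < r"
      proof (rule eventually_mono[OF ev])
        fix n assume n: "(\<Sum>i<n. X i \<omega>) / real n < ?\<mu> + 1 / Suc k \<and>
          (\<Sum>i<n. - X i \<omega>) / real n < - ?\<mu> + 1 / Suc k"
        have "(\<Sum>i<n. - X i \<omega>) / real n = - ((\<Sum>i<n. X i \<omega>) / real n)"
          by (simp add: sum_negf)
        with n k show "dist ((\<Sum>i<n. X i \<omega>) / real n) ?\<mu> < r" unfolding dist_real_def by linarith
      qed
    qed
  qed
qed

end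

section \<open>Averages of noisy products\<close>

lemma filterlim_floor_sqrt: "filterlim floor_sqrt at_top sequentially"
  unfolding filterlim_at_top
proof
  fix Z show "\<forall>\<^sub>F n in sequentially. Z \<le> floor_sqrt n"
    using eventually_ge_at_top[of "Z\<^sup>2"] by eventually_elim (simp add: le_floor_sqrt_iff)
qed

text \<open>
The largest square up to \<open>n\<close> misses \<open>n\<close> by at most \<open>2 floor_sqrt n\<close>.
\<close>

lemma floor_sqrt_square_ratio: "(\<lambda>n. real ((floor_sqrt n)\<^sup>2) / real n) \<longlonglongrightarrow> 1"
proof (rule real_tendsto_sandwich)
  have "(\<lambda>n. 2 / real (floor_sqrt n)) \<longlonglongrightarrow> 0"
    by (rule tendsto_divide_0[OF tendsto_const])
       (rule filterlim_at_top_imp_at_infinity, rule filterlim_compose[OF filterlim_real_sequentially filterlim_floor_sqrt])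
  from tendsto_diff[OF tendsto_const[of 1] this]
  show "(\<lambda>n. 1 - 2 / real (floor_sqrt n)) \<longlonglongrightarrow> 1" by simp
  show "\<forall>\<^sub>F n in sequentially. 1 - 2 / real (floor_sqrt n) \<le> real ((floor_sqrt n)\<^sup>2) / real n"
    using eventually_gt_at_top[of 0]
  proof eventually_elim
    case (elim n)
    define s where "s = floor_sqrt n"
    have s: "0 < s" using elim by (simp add: s_def)
    have up: "n \<le> s\<^sup>2 + 2 * s" using Suc_floor_sqrt_power2_gt[of n] unfolding s_def
      by (simp add: power2_eq_square algebra_simps)
    have lo: "s\<^sup>2 \<le> n" unfolding s_def by simp
    have "real n - 2 * s \<le> real (s\<^sup>2)" using up by linarith
    then have "(real n - 2 * s) / n \<le> real (s\<^sup>2) / n" by (rule divide_right_mono) simp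
    moreover have "2 * real s / n \<le> 2 / s"
    proof -
      have "2 * real s / n \<le> 2 * real s / real (s\<^sup>2)"
        by (rule divide_left_mono) (use lo s elim in \<open>auto intro!: mult_pos_pos simp flip: of_nat_power\<close>)
      also have "\<dots> = 2 / s" using s by (simp add: power2_eq_square)
      finally show ?thesis .
    qed
    ultimately show ?case using elim unfolding s_def by (simp add: diff_divide_distrib)
  qed
  show "\<forall>\<^sub>F n in sequentially. real ((floor_sqrt n)\<^sup>2) / real n \<le> 1"
    using eventually_gt_at_top[of 0]
    by eventually_elim (simp add: divide_le_eq flip: of_nat_power)
qed auto

text \<open>
Between the largest square \<open>q n \<le> n\<close> and \<open>n\<close> itself, the sum of products is at most the product of
the root sums of squares (Cauchy-Schwarz). Since the averages of the squares converge and \<open>q n / n\<close> tends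
to \<open>1\<close>, each of these block sums is \<open>o(n)\<close>.
\<close>

lemma product_average_from_squares:
  fixes c y :: "nat \<Rightarrow> real"
  assumes C: "(\<lambda>n. (\<Sum>i<n. (c i)\<^sup>2) / real n) \<longlonglongrightarrow> S"
    and Y: "(\<lambda>n. (\<Sum>i<n. (y i)\<^sup>2) / real n) \<longlonglongrightarrow> T"
    and squares: "(\<lambda>j. (\<Sum>i<j\<^sup>2. c i * y i) / real (j\<^sup>2)) \<longlonglongrightarrow> 0"
  shows "(\<lambda>n. (\<Sum>i<n. c i * y i) / real n) \<longlonglongrightarrow> 0"
proof -
  define q where "q n = (floor_sqrt n)\<^sup>2" for n
  have q_le: "q n \<le> n" for n by (simp add: q_def)
  have ratio: "(\<lambda>n. real (q n) / real n) \<longlonglongrightarrow> 1" unfolding q_def by (rule floor_sqrt_square_ratio)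
  have q_top: "filterlim q at_top sequentially"
    unfolding q_def by (rule filterlim_compose[OF _ filterlim_floor_sqrt])
      (rule filterlim_at_top_mono[OF filterlim_ident], auto simp: power2_nat_le_imp_le power2_eq_square)
  \<comment> \<open>two averages with the same limit, weighted by a ratio tending to \<open>1\<close>, cancel\<close>
  have block: "(\<lambda>n. (\<Sum>i\<in>{q n..<n}. (f i)\<^sup>2) / real n) \<longlonglongrightarrow> 0"
    if f: "(\<lambda>n. (\<Sum>i<n. (f i)\<^sup>2) / real n) \<longlonglongrightarrow> R" for f :: "nat \<Rightarrow> real" and R
  proof -
    have "(\<lambda>n. (\<Sum>i<n. (f i)\<^sup>2) / real n - (\<Sum>i<q n. (f i)\<^sup>2) / real (q n) * (real (q n) / real n)) \<longlonglongrightarrow> R - R * 1"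
      by (intro tendsto_intros f ratio filterlim_compose[OF f q_top])
    moreover have "(\<Sum>i<n. (f i)\<^sup>2) / real n - (\<Sum>i<q n. (f i)\<^sup>2) / real (q n) * (real (q n) / real n)
        = (\<Sum>i\<in>{q n..<n}. (f i)\<^sup>2) / real n" for n
    proof -
      have "(\<Sum>i<n. (f i)\<^sup>2) = (\<Sum>i<q n. (f i)\<^sup>2) + (\<Sum>i\<in>{q n..<n}. (f i)\<^sup>2)"
        using q_le[of n] by (metis lessThan_atLeast0 sum.atLeastLessThan_concat zero_le)
      then show ?thesis by (cases "q n = 0") (auto simp: add_divide_distrib q_def)
    qed
    ultimately show ?thesis by simp
  qed
  have "(\<lambda>n. \<bar>(\<Sum>i<q n. c i * y i) / real (q n)\<bar> * (real (q n) / real n) +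
      sqrt ((\<Sum>i\<in>{q n..<n}. (c i)\<^sup>2) / real n) * sqrt ((\<Sum>i\<in>{q n..<n}. (y i)\<^sup>2) / real n)) \<longlonglongrightarrow> \<bar>0\<bar> * 1 + sqrt 0 * sqrt 0"
  proof (intro tendsto_intros ratio block[OF C] block[OF Y])
    show "(\<lambda>n. (\<Sum>i<q n. c i * y i) / real (q n)) \<longlonglongrightarrow> 0"
      unfolding q_def by (rule filterlim_compose[OF squares filterlim_floor_sqrt])
  qed
  then show ?thesis
  proof (rule Lim_null_comparison[rotated, OF tendsto_eq_rhs])
    show "\<forall>\<^sub>F n in sequentially. norm ((\<Sum>i<n. c i * y i) / real n)
      \<le> \<bar>(\<Sum>i<q n. c i * y i) / real (q n)\<bar> * (real (q n) / real n) +
      sqrt ((\<Sum>i\<in>{q n..<n}. (c i)\<^sup>2) / real n) * sqrt ((\<Sum>i\<in>{q n..<n}. (y i)\<^sup>2) / real n)"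
    proof (rule always_eventually, rule allI)
      fix n
      have split: "(\<Sum>i<n. c i * y i) = (\<Sum>i<q n. c i * y i) + (\<Sum>i\<in>{q n..<n}. c i * y i)"
        using q_le[of n] by (metis lessThan_atLeast0 sum.atLeastLessThan_concat zero_le)
      have "\<bar>\<Sum>i\<in>{q n..<n}. c i * y i\<bar> \<le> (\<Sum>i\<in>{q n..<n}. \<bar>c i\<bar> * \<bar>y i\<bar>)"
        by (rule order_trans[OF sum_abs]) (simp add: abs_mult)
      also have "\<dots> \<le> L2_set c {q n..<n} * L2_set y {q n..<n}" by (rule L2_set_mult_ineq)
      finally have "\<bar>\<Sum>i\<in>{q n..<n}. c i * y i\<bar> / real n \<le>
          sqrt (\<Sum>i\<in>{q n..<n}. (c i)\<^sup>2) * sqrt (\<Sum>i\<in>{q n..<n}. (y i)\<^sup>2) / real n"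
        unfolding L2_set_def by (rule divide_right_mono) simp
      also have "\<dots> = sqrt ((\<Sum>i\<in>{q n..<n}. (c i)\<^sup>2) / real n) * sqrt ((\<Sum>i\<in>{q n..<n}. (y i)\<^sup>2) / real n)"
        by (simp add: real_sqrt_divide)
      finally have 1: "\<bar>(\<Sum>i\<in>{q n..<n}. c i * y i) / real n\<bar> \<le> \<dots>" by simp
      have 2: "\<bar>(\<Sum>i<q n. c i * y i) / real n\<bar> = \<bar>(\<Sum>i<q n. c i * y i) / real (q n)\<bar> * (real (q n) / real n)"
        by (cases "q n = 0") (auto simp: abs_mult q_def)
      show "norm ((\<Sum>i<n. c i * y i) / real n) \<le> \<bar>(\<Sum>i<q n. c i * y i) / real (q n)\<bar> * (real (q n) / real n) +
        sqrt ((\<Sum>i\<in>{q n..<n}. (c i)\<^sup>2) / real n) * sqrt ((\<Sum>i\<in>{q n..<n}. (y i)\<^sup>2) / real n)"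
        unfolding split add_divide_distrib real_norm_def
        by (rule order_trans[OF abs_triangle_ineq add_mono[OF eq_refl[OF 2] 1]])
    qed
  qed simp
qed

context prob_space
begin

lemma integrable_mult_of_squares:
  fixes f g :: "'a \<Rightarrow> real"
  assumes [measurable]: "f \<in> borel_measurable M" "g \<in> borel_measurable M"
    and f: "integrable M (\<lambda>x. (f x)\<^sup>2)" and g: "integrable M (\<lambda>x. (g x)\<^sup>2)"
  shows "integrable M (\<lambda>x. f x * g x)"
proof (rule Bochner_Integration.integrable_bound)
  show "integrable M (\<lambda>x. (f x)\<^sup>2 + (g x)\<^sup>2)" using f g by simp
  show "AE x in M. norm (f x * g x) \<le> norm ((f x)\<^sup>2 + (g x)\<^sup>2)"
  proof (rule AE_I2)
    fix x
    have "2 * (\<bar>f x\<bar> * \<bar>g x\<bar>) \<le> (f x)\<^sup>2 + (g x)\<^sup>2"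
      using sum_squares_bound[of "\<bar>f x\<bar>" "\<bar>g x\<bar>"] by simp
    moreover have "0 \<le> \<bar>f x\<bar> * \<bar>g x\<bar>" by simp
    ultimately have "\<bar>f x\<bar> * \<bar>g x\<bar> \<le> (f x)\<^sup>2 + (g x)\<^sup>2" by linarith
    then show "norm (f x * g x) \<le> norm ((f x)\<^sup>2 + (g x)\<^sup>2)" by (simp add: abs_mult)
  qed
qed measurable

lemma AE_tendsto_0_of_summable_expectation:
  fixes Z :: "nat \<Rightarrow> 'a \<Rightarrow> real"
  assumes int: "\<And>j. integrable M (Z j)" and nn: "\<And>j \<omega>. 0 \<le> Z j \<omega>"
    and sum: "summable (\<lambda>j. expectation (Z j))"
  shows "AE \<omega> in M. (\<lambda>j. Z j \<omega>) \<longlonglongrightarrow> 0"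
proof -
  have [measurable]: "Z j \<in> borel_measurable M" for j using int by auto
  have "(\<integral>\<^sup>+ \<omega>. (\<Sum>j. ennreal (Z j \<omega>)) \<partial>M) = (\<Sum>j. \<integral>\<^sup>+ \<omega>. ennreal (Z j \<omega>) \<partial>M)"
    by (rule nn_integral_suminf) measurable
  also have "\<dots> = (\<Sum>j. ennreal (expectation (Z j)))"
    using int nn by (simp add: nn_integral_eq_integral)
  also have "\<dots> = ennreal (\<Sum>j. expectation (Z j))"
    by (rule suminf_ennreal2) (use nn sum in auto)
  also have "\<dots> \<noteq> \<infinity>" by simp
  finally have "AE \<omega> in M. (\<Sum>j. ennreal (Z j \<omega>)) \<noteq> \<infinity>"
    by (intro nn_integral_PInf_AE) auto
  then show ?thesis
  proof eventually_elim
    case (elim \<omega>)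
    have "summable (\<lambda>j. Z j \<omega>)" by (rule summable_suminf_not_top) (use nn elim in auto)
    then show ?case by (rule summable_LIMSEQ_zero)
  qed
qed

text \<open>
The weighted sums have second moment \<open>v \<Sum>i<n. c\<^sub>i\<^sup>2 = O(n)\<close>, so the squared averages have expectation
\<open>O(1/n)\<close>, which is summable along the squares. Between consecutive squares the deterministic interpolation above
applies, to almost every realisation of the noise.
\<close>

lemma iid_weighted_average:
  fixes Y :: "nat \<Rightarrow> 'a \<Rightarrow> real" and c :: "nat \<Rightarrow> real"
  assumes iid: "iid_vars M borel Y UNIV" and sq: "integrable M (\<lambda>\<omega>. (Y 0 \<omega>)\<^sup>2)"
    and mean: "expectation (Y 0) = 0"
    and c: "(\<lambda>n. (\<Sum>i<n. (c i)\<^sup>2) / real n) \<longlonglongrightarrow> C"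
  shows "AE \<omega> in M. (\<lambda>n. (\<Sum>i<n. c i * Y i \<omega>) / real n) \<longlonglongrightarrow> 0"
proof -
  note [measurable] = iid_random_variable[OF iid UNIV_I]
  define v where "v = expectation (\<lambda>\<omega>. (Y 0 \<omega>)\<^sup>2)"
  have iid2: "iid_vars M borel (\<lambda>i \<omega>. (Y i \<omega>)\<^sup>2) UNIV"
    by (rule iid_vars_compose[OF iid]) measurable
  note sq_i = iid_integrable[OF iid2 sq, folded v_def]
  have int0: "integrable M (Y 0)" using square_integrable_imp_integrable[OF _ sq] by simp
  note int_i = iid_integrable[OF iid int0]
  have prod: "integrable M (\<lambda>\<omega>. Y i \<omega> * Y j \<omega>)" for i j
    by (rule integrable_mult_of_squares) (use sq_i in auto)
  \<comment> \<open>centred independent variables are uncorrelated\<close>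
  have orth: "expectation (\<lambda>\<omega>. Y i \<omega> * Y j \<omega>) = 0" if "i \<noteq> j" for i j
  proof -
    have ind: "indep_vars (\<lambda>_. borel) Y UNIV" using iid by (simp add: iid_vars_def)
    have "indep_var (PiM {i} (\<lambda>_. borel)) (\<lambda>\<omega>. restrict (\<lambda>i. Y i \<omega>) {i})
        (PiM {j} (\<lambda>_. borel)) (\<lambda>\<omega>. restrict (\<lambda>i. Y i \<omega>) {j})"
      by (rule indep_var_restrict[OF ind]) (use that in auto)
    then have "indep_var borel ((\<lambda>x. x i) \<circ> (\<lambda>\<omega>. restrict (\<lambda>i. Y i \<omega>) {i}))
       borel ((\<lambda>x. x j) \<circ> (\<lambda>\<omega>. restrict (\<lambda>i. Y i \<omega>) {j}))"
      by (rule indep_var_compose) auto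
    then have "indep_var borel (Y i) borel (Y j)" by (simp add: comp_def)
    from indep_var_lebesgue_integral[OF this] int_i mean show ?thesis by simp
  qed
  define Z where "Z j \<omega> = ((\<Sum>i<j\<^sup>2. c i * Y i \<omega>) / real (j\<^sup>2))\<^sup>2" for j \<omega>
  have sum_sq: "(\<Sum>i<n. c i * Y i \<omega>)\<^sup>2 = (\<Sum>i<n. \<Sum>j<n. c i * c j * (Y i \<omega> * Y j \<omega>))" for n \<omega>
    by (simp add: power2_eq_square sum_product mult_ac)
  have int_sum: "integrable M (\<lambda>\<omega>. (\<Sum>i<n. c i * Y i \<omega>)\<^sup>2)" for n
    unfolding sum_sq using prod by (intro Bochner_Integration.integrable_sum integrable_mult_right) auto
  have exp_sum: "expectation (\<lambda>\<omega>. (\<Sum>i<n. c i * Y i \<omega>)\<^sup>2) = v * (\<Sum>i<n. (c i)\<^sup>2)" for n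
  proof -
    have "expectation (\<lambda>\<omega>. (\<Sum>i<n. c i * Y i \<omega>)\<^sup>2) = (\<Sum>i<n. \<Sum>j<n. c i * c j * expectation (\<lambda>\<omega>. Y i \<omega> * Y j \<omega>))"
      unfolding sum_sq using prod by (simp add: Bochner_Integration.integral_sum)
    also have "\<dots> = (\<Sum>i<n. \<Sum>j<n. if i = j then v * (c i)\<^sup>2 else 0)"
      using orth sq_i(2) by (intro sum.cong refl) (auto simp: power2_eq_square)
    also have "\<dots> = v * (\<Sum>i<n. (c i)\<^sup>2)" by (simp add: sum_distrib_left)
    finally show ?thesis .
  qed
  have Z_int: "integrable M (Z j)" for j
    unfolding Z_def power_divide using int_sum by (intro integrable_divide_zero) auto
  have Z_exp: "expectation (Z j) = v * (\<Sum>i<j\<^sup>2. (c i)\<^sup>2) / (real (j\<^sup>2))\<^sup>2" for j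
    unfolding Z_def power_divide by (simp add: exp_sum)
  obtain K where K: "\<And>n. (\<Sum>i<n. (c i)\<^sup>2) / real n \<le> K"
    using convergent_imp_Bseq[OF convergentI[OF c]] unfolding Bseq_def real_norm_def
    by (metis abs_le_iff)
  have v0: "0 \<le> v" unfolding v_def by simp
  have "summable (\<lambda>j. expectation (Z j))"
  proof (rule summable_comparison_test)
    show "summable (\<lambda>j. v * K * (1 / real j ^ 2))"
      by (intro summable_mult) (use inverse_power_summable[of 2, where 'a=real] in \<open>simp add: field_simps\<close>)
    have "norm (expectation (Z j)) \<le> v * K * (1 / real j ^ 2)" for j
    proof -
      have "expectation (Z j) = v * ((\<Sum>i<j\<^sup>2. (c i)\<^sup>2) / real (j\<^sup>2)) * (1 / real j ^ 2)"
        unfolding Z_exp by (simp add: power2_eq_square)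
      also have "\<dots> \<le> v * K * (1 / real j ^ 2)"
        by (intro mult_right_mono mult_left_mono K v0) simp
      finally show ?thesis using v0 by (simp add: Z_exp sum_nonneg)
    qed
    then show "\<exists>N. \<forall>n\<ge>N. norm (expectation (Z n)) \<le> v * K * (1 / real n ^ 2)" by blast
  qed
  from AE_tendsto_0_of_summable_expectation[OF Z_int _ this]
  have "AE \<omega> in M. (\<lambda>j. Z j \<omega>) \<longlonglongrightarrow> 0" by (simp add: Z_def)
  moreover have "AE \<omega> in M. (\<lambda>n. (\<Sum>i<n. (Y i \<omega>)\<^sup>2) / real n) \<longlonglongrightarrow> v"
    using strong_law_of_large_numbers[OF iid2 sq] by (simp add: v_def)
  ultimately show ?thesis
  proof eventually_elim
    case (elim \<omega>)
    show ?case
    proof (rule product_average_from_squares[OF c elim(2)])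
      have "(\<lambda>j. sqrt (Z j \<omega>)) \<longlonglongrightarrow> sqrt 0" by (intro tendsto_intros elim(1))
      then have "(\<lambda>j. \<bar>(\<Sum>i<j\<^sup>2. c i * Y i \<omega>) / real (j\<^sup>2)\<bar>) \<longlonglongrightarrow> 0"
        by (simp only: Z_def real_sqrt_abs real_sqrt_zero)
      then show "(\<lambda>j. (\<Sum>i<j\<^sup>2. c i * Y i \<omega>) / real (j\<^sup>2)) \<longlonglongrightarrow> 0"
        by (rule tendsto_rabs_zero_cancel)
    qed
  qed
qed

theorem iid_noisy_product_average:
  fixes X :: "nat \<Rightarrow> 'a \<Rightarrow> 'b" and f g :: "'b \<Rightarrow> real" and c d :: "nat \<Rightarrow> real"
  assumes iid: "iid_vars M N X UNIV"
    and [measurable]: "f \<in> borel_measurable N" "g \<in> borel_measurable N"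
    and sq: "integrable M (\<lambda>\<omega>. (f (X 0 \<omega>))\<^sup>2)" "integrable M (\<lambda>\<omega>. (g (X 0 \<omega>))\<^sup>2)"
    and mean: "expectation (\<lambda>\<omega>. f (X 0 \<omega>)) = 0" "expectation (\<lambda>\<omega>. g (X 0 \<omega>)) = 0"
    and c: "(\<lambda>n. (\<Sum>i<n. (c i)\<^sup>2) / real n) \<longlonglongrightarrow> C"
    and d: "(\<lambda>n. (\<Sum>i<n. (d i)\<^sup>2) / real n) \<longlonglongrightarrow> D"
    and cd: "(\<lambda>n. (\<Sum>i<n. c i * d i) / real n) \<longlonglongrightarrow> L"
  shows "AE \<omega> in M. (\<lambda>n. (\<Sum>i<n. (c i + f (X i \<omega>)) * (d i + g (X i \<omega>))) / real n)
           \<longlonglongrightarrow> L + expectation (\<lambda>\<omega>. f (X 0 \<omega>) * g (X 0 \<omega>))"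
proof -
  note [measurable] = iid_random_variable[OF iid UNIV_I]
  have iid_f: "iid_vars M borel (\<lambda>i \<omega>. f (X i \<omega>)) UNIV" and iid_g: "iid_vars M borel (\<lambda>i \<omega>. g (X i \<omega>)) UNIV"
    and iid_fg: "iid_vars M borel (\<lambda>i \<omega>. f (X i \<omega>) * g (X i \<omega>)) UNIV"
    by (rule iid_vars_compose[OF iid], measurable)+
  have "integrable M (\<lambda>\<omega>. f (X 0 \<omega>) * g (X 0 \<omega>))"
    by (rule integrable_mult_of_squares) (use sq in auto)
  from strong_law_of_large_numbers[OF iid_fg this]
    iid_weighted_average[OF iid_g sq(2) mean(2) c] iid_weighted_average[OF iid_f sq(1) mean(1) d]
  show ?thesis
  proof eventually_elim
    case (elim \<omega>)
    from tendsto_add[OF tendsto_add[OF cd elim(1)] tendsto_add[OF elim(2) elim(3)]]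
    show ?case
      by (rule tendsto_eq_rhs[OF Lim_transform_eventually])
         (auto simp: distrib_left distrib_right sum.distrib add_divide_distrib mult_ac intro!: always_eventually)
  qed
qed

end

section \<open>Orthonormal columns, kernels and ranks\<close>

definition orthonormal_cols :: "nat \<Rightarrow> nat \<Rightarrow> real mat \<Rightarrow> bool" where
  "orthonormal_cols q p V \<longleftrightarrow> V \<in> carrier_mat q p \<and> V\<^sup>T * V = 1\<^sub>m p"

lemma orthonormal_cols_carrier: "orthonormal_cols q p V \<Longrightarrow> V \<in> carrier_mat q p"
  by (simp add: orthonormal_cols_def)

lemma orthonormal_cols_iff:
  assumes V: "V \<in> carrier_mat q p"
  shows "orthonormal_cols q p V \<longleftrightarrow> (\<forall>i<p. \<forall>j<p. col V i \<bullet> col V j = (if i = j then 1 else 0))"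
proof -
  have "(V\<^sup>T * V) $$ (i, j) = col V i \<bullet> col V j" if "i < p" "j < p" for i j using V that by simp
  moreover have "V\<^sup>T * V = 1\<^sub>m p \<longleftrightarrow> (\<forall>i<p. \<forall>j<p. (V\<^sup>T * V) $$ (i, j) = 1\<^sub>m p $$ (i, j))"
    using V by (auto simp: mat_eq_iff)
  ultimately show ?thesis using V by (auto simp: orthonormal_cols_def)
qed

lemma real_scalar_prod_eq_0_iff:
  fixes v :: "real vec"
  assumes "v \<in> carrier_vec q"
  shows "v \<bullet> v = 0 \<longleftrightarrow> v = 0\<^sub>v q"
  using assms by (auto simp: scalar_prod_def sum_nonneg_eq_0_iff)

lemma real_scalar_prod_nonneg: "0 \<le> v \<bullet> (v :: real vec)"
  by (simp add: scalar_prod_def sum_nonneg)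

lemma orthonormal_cols_transpose_mult_vec:
  assumes V: "orthonormal_cols q p V" and x: "x \<in> carrier_vec p"
  shows "V\<^sup>T *\<^sub>v (V *\<^sub>v x) = x"
proof -
  have c: "V \<in> carrier_mat q p" "V\<^sup>T * V = 1\<^sub>m p" using V by (auto simp: orthonormal_cols_def)
  have "V\<^sup>T *\<^sub>v (V *\<^sub>v x) = (V\<^sup>T * V) *\<^sub>v x" using c(1) x by simp
  then show ?thesis using c x by simp
qed

lemma orthonormal_cols_inj:
  assumes V: "orthonormal_cols q p V" and x: "x \<in> carrier_vec p" and "V *\<^sub>v x = 0\<^sub>v q"
  shows "x = 0\<^sub>v p"
proof -
  have "V \<in> carrier_mat q p" using V by (simp add: orthonormal_cols_def)
  then have "V\<^sup>T *\<^sub>v 0\<^sub>v q = 0\<^sub>v p" by auto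
  with orthonormal_cols_transpose_mult_vec[OF V x] assms(3) show ?thesis by simp
qed

lemma scalar_prod_sum:
  fixes x y :: "real vec"
  shows "x \<in> carrier_vec q \<Longrightarrow> y \<in> carrier_vec q \<Longrightarrow> x \<bullet> y = (\<Sum>i<q. x $ i * y $ i)"
  by (simp add: scalar_prod_def atLeast0LessThan)

lemma mult_mat_vec_nth_sum:
  fixes A :: "real mat"
  assumes "A \<in> carrier_mat m n" "x \<in> carrier_vec n" "i < m"
  shows "(A *\<^sub>v x) $ i = (\<Sum>j<n. A $$ (i, j) * x $ j)"
  using assms by (simp, subst scalar_prod_sum[of _ n]) auto

lemma mult_mat_nth_sum:
  fixes A B :: "real mat"
  assumes "A \<in> carrier_mat m n" "B \<in> carrier_mat n p" "i < m" "j < p"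
  shows "(A * B) $$ (i, j) = (\<Sum>s<n. A $$ (i, s) * B $$ (s, j))"
  using assms by (simp, subst scalar_prod_sum[of _ n]) auto

lemma mat_range_eq:

  assumes "A \<in> carrier_mat m n"
  shows "mat_range A = {A *\<^sub>v x | x. x \<in> carrier_vec n}"
  using assms by (auto simp: vec_space.col_space_eq[of A m n])

lemma mult_unit_vec_eq_col:
  fixes A :: "real mat"
  shows "A \<in> carrier_mat m n \<Longrightarrow> j < n \<Longrightarrow> A *\<^sub>v unit_vec n j = col A j"
  by (intro eq_vecI) auto

lemma mult_eq_0_if_cols:
  fixes A U :: "real mat"
  assumes A: "A \<in> carrier_mat m q" and U: "U \<in> carrier_mat q s"
    and 0: "\<And>j. j < s \<Longrightarrow> A *\<^sub>v col U j = 0\<^sub>v m"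
  shows "A * U = 0\<^sub>m m s"
proof (rule mat_col_eqI)
  fix j assume "j < dim_col (0\<^sub>m m s :: real mat)"
  then have j: "j < s" by simp
  show "col (A * U) j = col (0\<^sub>m m s) j" unfolding col_mult2[OF A U j] using 0[OF j] j by simp
qed (use A U in auto)

lemma mult_mat_zero_vec:
  fixes A :: "real mat"
  shows "A \<in> carrier_mat m n \<Longrightarrow> A *\<^sub>v 0\<^sub>v n = 0\<^sub>v m"
  by (intro eq_vecI) auto

text \<open>
Padding with zero rows makes the matrix square and singular.
\<close>

lemma wide_mat_kernel:
  fixes A :: "real mat"
  assumes A: "A \<in> carrier_mat m n" and mn: "m < n"
  obtains v where "v \<in> carrier_vec n" "v \<noteq> 0\<^sub>v n" "A *\<^sub>v v = 0\<^sub>v m"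
proof -
  \<comment> \<open>row \<open>m\<close> of the padded matrix vanishes, so its transpose annihilates a unit vector\<close>
  define B where "B = mat n n (\<lambda>(i, j). if i < m then A $$ (i, j) else 0)"
  have B: "B \<in> carrier_mat n n" by (simp add: B_def)
  have "B\<^sup>T *\<^sub>v unit_vec n m = 0\<^sub>v n"
  proof (rule eq_vecI)
    fix i assume "i < dim_vec (0\<^sub>v n :: real vec)"
    then have i: "i < n" by simp
    then have "(B\<^sup>T *\<^sub>v unit_vec n m) $ i = B $$ (m, i)" using B mn by simp
    then show "(B\<^sup>T *\<^sub>v unit_vec n m) $ i = 0\<^sub>v n $ i" using i mn by (simp add: B_def)
  qed (simp add: B_def)
  moreover have "unit_vec n m \<noteq> (0\<^sub>v n :: real vec)" using mn by simp
  ultimately have "det (B\<^sup>T) = 0" using det_0_iff_vec_prod_zero[of "B\<^sup>T" n] B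
    by (metis transpose_carrier_mat unit_vec_carrier)
  then have "det B = 0" using det_transpose[OF B] by simp
  then obtain v where v: "v \<in> carrier_vec n" "v \<noteq> 0\<^sub>v n" "B *\<^sub>v v = 0\<^sub>v n"
    using det_0_iff_vec_prod_zero[OF B] by auto
  have "A *\<^sub>v v = 0\<^sub>v m"
  proof (rule eq_vecI)
    fix i assume "i < dim_vec (0\<^sub>v m :: real vec)"
    then have i: "i < m" by simp
    have "row A i = row B i" using i mn A by (intro eq_vecI) (auto simp: B_def)
    then have "(A *\<^sub>v v) $ i = (B *\<^sub>v v) $ i" using i mn A B by simp
    then show "(A *\<^sub>v v) $ i = 0\<^sub>v m $ i" using i mn v by simp
  qed (use A in simp)
  with v that show ?thesis by blast
qed

lemma injective_dim_le:
  fixes A :: "real mat"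
  assumes A: "A \<in> carrier_mat m n" and inj: "\<And>x. x \<in> carrier_vec n \<Longrightarrow> A *\<^sub>v x = 0\<^sub>v m \<Longrightarrow> x = 0\<^sub>v n"
  shows "n \<le> m"
  using wide_mat_kernel[OF A] inj by (metis not_le)

lemma square_injective_inverse:
  fixes Q :: "real mat"
  assumes Q: "Q \<in> carrier_mat p p" and inj: "\<And>x. x \<in> carrier_vec p \<Longrightarrow> Q *\<^sub>v x = 0\<^sub>v p \<Longrightarrow> x = 0\<^sub>v p"
  obtains R where "R \<in> carrier_mat p p" "Q * R = 1\<^sub>m p"
proof -
  have "det Q \<noteq> 0" using det_0_iff_vec_prod_zero[OF Q] inj by blast
  from det_non_zero_imp_unit[OF Q this, of "()"] obtain R where "R \<in> carrier_mat p p" "Q * R = 1\<^sub>m p"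
    by (auto simp: Units_def ring_mat_simps)
  then show ?thesis by (rule that)
qed

lemma append_cols_carrier:
  "A \<in> carrier_mat m n1 \<Longrightarrow> B \<in> carrier_mat m n2 \<Longrightarrow> A @\<^sub>c B \<in> carrier_mat m (n1 + n2)"
  by (auto simp: append_cols_def)

lemma col_append_cols:
  assumes "A \<in> carrier_mat m n1" "B \<in> carrier_mat m n2" "j < n1 + n2"
  shows "col (A @\<^sub>c B) j = (if j < n1 then col A j else col B (j - n1))"
  using assms by (intro eq_vecI) (auto simp: append_cols_def)

lemma append_cols_mult_vec:
  fixes A B :: "real mat"
  assumes A: "A \<in> carrier_mat m n1" and B: "B \<in> carrier_mat m n2"
    and x: "x \<in> carrier_vec n1" and y: "y \<in> carrier_vec n2"
  shows "(A @\<^sub>c B) *\<^sub>v (x @\<^sub>v y) = A *\<^sub>v x + B *\<^sub>v y"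
proof -
  have "(A @\<^sub>c B) *\<^sub>v (x @\<^sub>v y) = (A *\<^sub>v x + B *\<^sub>v y) @\<^sub>v (0\<^sub>m 0 n1 *\<^sub>v x + 0\<^sub>m 0 n2 *\<^sub>v y)"
    using four_block_mat_mult_vec[OF A B _ _ x y, of "0\<^sub>m 0 n1" 0 "0\<^sub>m 0 n2"] A B
    by (simp add: append_cols_def)
  also have "\<dots> = A *\<^sub>v x + B *\<^sub>v y" using A B by (intro eq_vecI) auto
  finally show ?thesis .
qed

lemma orthonormal_append_cols:
  assumes V: "orthonormal_cols q p V" and U: "orthonormal_cols q t U"
    and orth: "\<And>i j. i < p \<Longrightarrow> j < t \<Longrightarrow> col V i \<bullet> col U j = 0"
  shows "orthonormal_cols q (p + t) (V @\<^sub>c U)"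
proof -
  have c: "V \<in> carrier_mat q p" "U \<in> carrier_mat q t" using V U by (auto simp: orthonormal_cols_def)
  have orth': "col U j \<bullet> col V i = 0" if "i < p" "j < t" for i j
  proof -
    have "col U j \<in> carrier_vec q" "col V i \<in> carrier_vec q" using c that by auto
    then show ?thesis using orth[OF that] by (simp add: comm_scalar_prod)
  qed
  show ?thesis
    unfolding orthonormal_cols_iff[OF append_cols_carrier[OF c]]
    using orthonormal_cols_iff[OF c(1)] orthonormal_cols_iff[OF c(2)] V U orth orth'
    by (auto simp: col_append_cols[OF c])
qed

lemma orthonormal_single:
  assumes w: "w \<in> carrier_vec q" and "w \<bullet> w = 1"
  shows "orthonormal_cols q 1 (mat_of_cols q [w])"
  using assms by (subst orthonormal_cols_iff) auto

lemma orthonormal_append_unit: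
  assumes V: "orthonormal_cols q p V" and w: "w \<in> carrier_vec q" "w \<bullet> w = 1" "V\<^sup>T *\<^sub>v w = 0\<^sub>v p"
  shows "orthonormal_cols q (p + 1) (V @\<^sub>c mat_of_cols q [w])"
proof (rule orthonormal_append_cols[OF V orthonormal_single[OF w(1,2)]])
  fix i j :: nat assume ij: "i < p" "j < 1"
  have "col V i \<bullet> w = (V\<^sup>T *\<^sub>v w) $ i" using orthonormal_cols_carrier[OF V] ij by simp
  then show "col V i \<bullet> col (mat_of_cols q [w]) j = 0" using w ij by simp
qed

lemma unit_multiple:
  fixes w :: "real vec"
  assumes w: "w \<in> carrier_vec q" "w \<noteq> 0\<^sub>v q"
  obtains c where "c \<noteq> 0" "(c \<cdot>\<^sub>v w) \<bullet> (c \<cdot>\<^sub>v w) = 1"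
proof
  have pos: "w \<bullet> w > 0" using w real_scalar_prod_eq_0_iff[OF w(1)] real_scalar_prod_nonneg[of w] by linarith
  show "1 / sqrt (w \<bullet> w) \<noteq> 0" using pos by simp
  show "((1 / sqrt (w \<bullet> w)) \<cdot>\<^sub>v w) \<bullet> ((1 / sqrt (w \<bullet> w)) \<cdot>\<^sub>v w) = 1"
    using pos w by simp
qed

lemma orthonormal_cols_le: "orthonormal_cols q p V \<Longrightarrow> p \<le> q"
  using injective_dim_le[of V q p] orthonormal_cols_inj[of q p V] by (auto simp: orthonormal_cols_def)

text \<open>
Orthogonal projection onto the columns of \<open>V\<close>: \<open>a\<close> holds the coordinates and \<open>y\<close> is the residual.
\<close>

lemma orthonormal_pythagoras:
  assumes V: "orthonormal_cols q p V" and u: "u \<in> carrier_vec q"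
  defines "a \<equiv> V\<^sup>T *\<^sub>v u"
  obtains y where "y \<in> carrier_vec q" "u = V *\<^sub>v a + y" "V\<^sup>T *\<^sub>v y = 0\<^sub>v p" "u \<bullet> u = a \<bullet> a + y \<bullet> y"
proof -
  note Vc = orthonormal_cols_carrier[OF V]
  define y where "y = u - V *\<^sub>v a"
  have a: "a \<in> carrier_vec p" using Vc u by (auto simp: a_def)
  have Va: "V *\<^sub>v a \<in> carrier_vec q" using Vc a by auto
  have y: "y \<in> carrier_vec q" using u Va by (auto simp: y_def)
  have uy: "u = V *\<^sub>v a + y" unfolding y_def using u Vc by (intro eq_vecI) auto
  have "V\<^sup>T *\<^sub>v y = V\<^sup>T *\<^sub>v u - V\<^sup>T *\<^sub>v (V *\<^sub>v a)"
    unfolding y_def by (rule mult_minus_distrib_mat_vec[of _ p q]) (use Vc u Va in auto)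
  also have "\<dots> = 0\<^sub>v p" unfolding orthonormal_cols_transpose_mult_vec[OF V a] using a by (auto simp: a_def)
  finally have Vy: "V\<^sup>T *\<^sub>v y = 0\<^sub>v p" .
  have "(V *\<^sub>v a) \<bullet> (V *\<^sub>v a) = a \<bullet> a"
    using transpose_vec_mult_scalar[OF Vc a Va] orthonormal_cols_transpose_mult_vec[OF V a] by simp
  moreover have yVa: "y \<bullet> (V *\<^sub>v a) = 0" using transpose_vec_mult_scalar[OF Vc a y] Vy a by simp
  moreover have "(V *\<^sub>v a) \<bullet> y = 0" using yVa comm_scalar_prod[OF Va y] by simp
  ultimately have "u \<bullet> u = a \<bullet> a + y \<bullet> y"
    unfolding uy using Va y by (simp add: add_scalar_prod_distrib[of _ q] scalar_prod_add_distrib[of _ q])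
  with y uy Vy that show ?thesis by blast
qed

text \<open>
Take a largest orthonormal family inside the kernel. A kernel vector outside its span would leave a
nonzero residual in the kernel, and the normalised residual would extend the family.
\<close>

lemma kernel_orthonormal_basis:
  fixes A :: "real mat"
  assumes A: "A \<in> carrier_mat m q"
  obtains s U where "orthonormal_cols q s U" "mat_range U = mat_kernel A"
proof -
  let ?P = "\<lambda>s. \<exists>U. orthonormal_cols q s U \<and> (\<forall>j<s. A *\<^sub>v col U j = 0\<^sub>v m)"
  have P0: "?P 0"
    by (rule exI[of _ "0\<^sub>m q 0"]) (auto simp: orthonormal_cols_def)
  have "\<forall>s. ?P s \<longrightarrow> s \<le> q" using orthonormal_cols_le by blast
  then obtain s where s: "?P s" and max: "\<And>t. ?P t \<Longrightarrow> t \<le> s"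
    using Nat.ex_has_greatest_nat[of ?P 0 q] P0 by blast
  then obtain U where U: "orthonormal_cols q s U" and AUj: "\<And>j. j < s \<Longrightarrow> A *\<^sub>v col U j = 0\<^sub>v m" by blast
  have Uc: "U \<in> carrier_mat q s" using U by (simp add: orthonormal_cols_def)
  have AU: "A * U = 0\<^sub>m m s" by (rule mult_eq_0_if_cols[OF A Uc AUj])
  have "mat_range U = mat_kernel A"
  proof (intro equalityI subsetI)
    fix z assume "z \<in> mat_range U"
    then obtain x where x: "x \<in> carrier_vec s" "z = U *\<^sub>v x" using mat_range_eq[OF Uc] by auto
    have "A *\<^sub>v z = (A * U) *\<^sub>v x" using A Uc x by simp
    also have "\<dots> = 0\<^sub>v m" using x by (auto simp: AU)
    finally show "z \<in> mat_kernel A" using mat_kernelI[OF A] x Uc by auto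
  next
    fix z assume "z \<in> mat_kernel A"
    then have z: "z \<in> carrier_vec q" "A *\<^sub>v z = 0\<^sub>v m" using mat_kernelD[OF A] by auto
    have Utz: "U\<^sup>T *\<^sub>v z \<in> carrier_vec s" using Uc z by auto
    obtain y where y: "y \<in> carrier_vec q" and zy: "z = U *\<^sub>v (U\<^sup>T *\<^sub>v z) + y" and Uy: "U\<^sup>T *\<^sub>v y = 0\<^sub>v s"
      using orthonormal_pythagoras[OF U z(1)] by blast
    have Uz: "U *\<^sub>v (U\<^sup>T *\<^sub>v z) \<in> carrier_vec q" by (rule mult_mat_vec_carrier[OF Uc Utz])
    have "A *\<^sub>v (U *\<^sub>v (U\<^sup>T *\<^sub>v z)) = (A * U) *\<^sub>v (U\<^sup>T *\<^sub>v z)" by (rule assoc_mult_mat_vec[OF A Uc Utz, symmetric])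
    then have AUz: "A *\<^sub>v (U *\<^sub>v (U\<^sup>T *\<^sub>v z)) = 0\<^sub>v m" unfolding AU using Utz by auto
    have "A *\<^sub>v z = A *\<^sub>v (U *\<^sub>v (U\<^sup>T *\<^sub>v z)) + A *\<^sub>v y" by (subst zy, rule mult_add_distrib_mat_vec[OF A Uz y])
    then have Ay: "A *\<^sub>v y = 0\<^sub>v m" unfolding AUz z(2) using mult_mat_vec_carrier[OF A y] by simp
    have "y = 0\<^sub>v q"
    proof (rule ccontr)
      assume "y \<noteq> 0\<^sub>v q"
      then obtain c where c: "c \<noteq> 0" "(c \<cdot>\<^sub>v y) \<bullet> (c \<cdot>\<^sub>v y) = 1" using unit_multiple[OF y] by blast
      let ?w = "c \<cdot>\<^sub>v y"
      have w: "?w \<in> carrier_vec q" using y by simp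
      have "U\<^sup>T *\<^sub>v ?w = c \<cdot>\<^sub>v (U\<^sup>T *\<^sub>v y)" using Uc y by (intro mult_mat_vec[of _ s q]) auto
      also have "\<dots> = 0\<^sub>v s" unfolding Uy by auto
      finally have on: "orthonormal_cols q (s + 1) (U @\<^sub>c mat_of_cols q [?w])"
        by (rule orthonormal_append_unit[OF U w c(2)])
      have Aw: "A *\<^sub>v ?w = 0\<^sub>v m"
      proof -
        have "A *\<^sub>v ?w = c \<cdot>\<^sub>v (A *\<^sub>v y)" by (rule mult_mat_vec[OF A y])
        also have "\<dots> = 0\<^sub>v m" unfolding Ay by auto
        finally show ?thesis .
      qed
      have wc: "mat_of_cols q [?w] \<in> carrier_mat q 1" by auto
      have "A *\<^sub>v col (U @\<^sub>c mat_of_cols q [?w]) j = 0\<^sub>v m" if "j < s + 1" for j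
        unfolding col_append_cols[OF Uc wc that] using AUj Aw w that by (auto simp: less_Suc_eq)
      with on max[of "s + 1"] show False by auto
    qed
    then have "U *\<^sub>v (U\<^sup>T *\<^sub>v z) + y = U *\<^sub>v (U\<^sup>T *\<^sub>v z)" using Uz by simp
    with zy have "z = U *\<^sub>v (U\<^sup>T *\<^sub>v z)" by (rule trans)
    then show "z \<in> mat_range U" using mat_range_eq[OF Uc] Utz by auto
  qed
  with U that show ?thesis by blast
qed

text \<open>
The complement is an orthonormal basis of the kernel of \<open>V\<^sup>T\<close>. It has exactly \<open>q - p\<close> elements because a
vector orthogonal to both families vanishes, by the decomposition in the last conclusion.
\<close>

lemma orthonormal_complement:
  assumes V: "orthonormal_cols q p V"
  obtains U where "orthonormal_cols q (q - p) U" "mat_range U = mat_kernel (V\<^sup>T)"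
    "orthonormal_cols q q (V @\<^sub>c U)"
    "\<And>z. z \<in> carrier_vec q \<Longrightarrow> z = V *\<^sub>v (V\<^sup>T *\<^sub>v z) + U *\<^sub>v (U\<^sup>T *\<^sub>v z)"
proof -
  have Vc: "V \<in> carrier_mat q p" using V by (simp add: orthonormal_cols_def)
  then have Vt: "V\<^sup>T \<in> carrier_mat p q" by simp
  obtain t U where U: "orthonormal_cols q t U" and ran: "mat_range U = mat_kernel (V\<^sup>T)"
    using kernel_orthonormal_basis[OF Vt] by blast
  have Uc: "U \<in> carrier_mat q t" using U by (simp add: orthonormal_cols_def)
  have VtU: "V\<^sup>T *\<^sub>v (U *\<^sub>v x) = 0\<^sub>v p" if "x \<in> carrier_vec t" for x
  proof -
    have "U *\<^sub>v x \<in> mat_kernel (V\<^sup>T)" using mat_range_eq[OF Uc] that by (auto simp flip: ran)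
    then show ?thesis using mat_kernelD[OF Vt] by blast
  qed
  have "col V i \<bullet> col U j = 0" if "i < p" "j < t" for i j
  proof -
    have "col U j = U *\<^sub>v unit_vec t j" using mult_unit_vec_eq_col[OF Uc that(2)] by simp
    then have "V\<^sup>T *\<^sub>v col U j = 0\<^sub>v p" using VtU[of "unit_vec t j"] by simp
    moreover have "col V i \<bullet> col U j = (V\<^sup>T *\<^sub>v col U j) $ i" using Vc that by simp
    ultimately show ?thesis using that by simp
  qed
  from orthonormal_append_cols[OF V U this] have on: "orthonormal_cols q (p + t) (V @\<^sub>c U)" .
  have decomp: "z = V *\<^sub>v (V\<^sup>T *\<^sub>v z) + U *\<^sub>v (U\<^sup>T *\<^sub>v z)" if z: "z \<in> carrier_vec q" for z
  proof -
    have Vtz: "V\<^sup>T *\<^sub>v z \<in> carrier_vec p" using Vc z by auto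
    obtain y where y: "y \<in> carrier_vec q" and zy: "z = V *\<^sub>v (V\<^sup>T *\<^sub>v z) + y" and Vy: "V\<^sup>T *\<^sub>v y = 0\<^sub>v p"
      using orthonormal_pythagoras[OF V z] by blast
    have "y \<in> mat_range U" unfolding ran using mat_kernelI[OF Vt y Vy] .
    then obtain x where x: "x \<in> carrier_vec t" "y = U *\<^sub>v x" using mat_range_eq[OF Uc] by auto
    have Uy: "U\<^sup>T *\<^sub>v y = x" using orthonormal_cols_transpose_mult_vec[OF U x(1)] x by simp
    have UtV: "U\<^sup>T *\<^sub>v (V *\<^sub>v a) = 0\<^sub>v t" if a: "a \<in> carrier_vec p" for a
    proof -
      define b where "b = U\<^sup>T *\<^sub>v (V *\<^sub>v a)"
      have c: "V *\<^sub>v a \<in> carrier_vec q" "b \<in> carrier_vec t" using Vc Uc a by (auto simp: b_def)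
      have Ub: "U *\<^sub>v b \<in> carrier_vec q" using Uc c by auto
      have "b \<bullet> b = (V *\<^sub>v a) \<bullet> (U *\<^sub>v b)" using transpose_vec_mult_scalar[OF Uc c(2,1)] by (simp add: b_def)
      also have "\<dots> = (V\<^sup>T *\<^sub>v (U *\<^sub>v b)) \<bullet> a"
        using transpose_vec_mult_scalar[OF Vc a Ub] comm_scalar_prod[OF c(1) Ub] by simp
      also have "\<dots> = 0" unfolding VtU[OF c(2)] using a by simp
      finally show ?thesis using real_scalar_prod_eq_0_iff[OF c(2)] by (simp add: b_def)
    qed
    have "U\<^sup>T *\<^sub>v z = U\<^sup>T *\<^sub>v (V *\<^sub>v (V\<^sup>T *\<^sub>v z)) + U\<^sup>T *\<^sub>v y"
      by (subst zy, rule mult_add_distrib_mat_vec[of _ t q]) (use Uc Vc Vtz y in auto)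
    also have "\<dots> = x" unfolding UtV[OF Vtz] Uy using x by simp
    finally have "U\<^sup>T *\<^sub>v z = x" .
    with zy x(2) show ?thesis by (simp only:)
  qed
  have "p + t = q"
  proof (rule antisym)
    show "p + t \<le> q" using orthonormal_cols_le[OF on] .
    have c: "V @\<^sub>c U \<in> carrier_mat q (p + t)" using on by (simp add: orthonormal_cols_def)
    show "q \<le> p + t"
    proof (rule injective_dim_le[of "(V @\<^sub>c U)\<^sup>T"])
      show "(V @\<^sub>c U)\<^sup>T \<in> carrier_mat (p + t) q" using c by simp
      fix z :: "real vec" assume z: "z \<in> carrier_vec q" and 0: "(V @\<^sub>c U)\<^sup>T *\<^sub>v z = 0\<^sub>v (p + t)"
      have e: "col (V @\<^sub>c U) i \<bullet> z = 0" if "i < p + t" for i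
      proof -
        have "col (V @\<^sub>c U) i \<bullet> z = ((V @\<^sub>c U)\<^sup>T *\<^sub>v z) $ i" using c that by simp
        then show ?thesis using that by (simp add: 0)
      qed
      have "V\<^sup>T *\<^sub>v z = 0\<^sub>v p" using Vc e col_append_cols[OF Vc Uc] by (intro eq_vecI) (auto, metis trans_less_add1)
      moreover have "U\<^sup>T *\<^sub>v z = 0\<^sub>v t"
      proof (rule eq_vecI)
        fix j assume "j < dim_vec (0\<^sub>v t :: real vec)"
        then have j: "j < t" by simp
        show "(U\<^sup>T *\<^sub>v z) $ j = 0\<^sub>v t $ j" using e[of "p + j"] col_append_cols[OF Vc Uc, of "p + j"] Uc j by simp
      qed (use Uc in simp)
      ultimately have "z = V *\<^sub>v 0\<^sub>v p + U *\<^sub>v 0\<^sub>v t" using decomp[OF z] by simp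
      also have "\<dots> = 0\<^sub>v q" using Vc Uc by (intro eq_vecI) auto
      finally show "z = 0\<^sub>v q" .
    qed
  qed
  then have "t = q - p" "p + t = q" by auto
  with U ran on decomp that show ?thesis by metis
qed

lemma rank_of_injective:
  fixes A :: "real mat"
  assumes A: "A \<in> carrier_mat m t" and inj: "\<And>x. x \<in> carrier_vec t \<Longrightarrow> A *\<^sub>v x = 0\<^sub>v m \<Longrightarrow> x = 0\<^sub>v t"
  shows "mat_rank A = t"
proof -
  interpret vec_space "TYPE(real)" m .
  have dist: "distinct (cols A)"
    unfolding distinct_conv_nth
  proof (intro allI impI)
    fix i j assume ij: "i < length (cols A)" "j < length (cols A)" "i \<noteq> j"
    then have ij': "i < t" "j < t" using A by auto
    show "cols A ! i \<noteq> cols A ! j"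
    proof
      assume "cols A ! i = cols A ! j"
      then have "A *\<^sub>v unit_vec t i = A *\<^sub>v unit_vec t j"
        using ij A ij' by (simp add: mult_unit_vec_eq_col[OF A])
      then have "A *\<^sub>v (unit_vec t i - unit_vec t j) = 0\<^sub>v m"
        by (subst mult_minus_distrib_mat_vec[OF A]) (use A ij' in \<open>auto simp: mult_unit_vec_eq_col[OF A]\<close>)
      from inj[OF _ this] have "(unit_vec t i - unit_vec t j) $ i = (0\<^sub>v t :: real vec) $ i" by simp
      then show False using ij ij' by simp
    qed
  qed
  have "\<not> lin_dep (set (cols A))"
    using lin_depE[OF A _ dist] inj by metis
  from lin_indpt_full_rank[OF A dist this] A show ?thesis by simp
qed

text \<open>
Restricted to the orthogonal complement of its kernel, \<open>A\<close> becomes an injective matrix \<open>B\<close> with the same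
range. The number of columns of \<open>B\<close> is the rank, and the rest of the dimension is the kernel.
\<close>

lemma rank_nullity_factorization:
  fixes A :: "real mat"
  assumes A: "A \<in> carrier_mat m q"
  obtains U B where "orthonormal_cols q (q - mat_rank A) U" "mat_range U = mat_kernel A"
    "mat_rank A \<le> q" "B \<in> carrier_mat m (mat_rank A)" "mat_range B = mat_range A"
    "\<And>x. x \<in> carrier_vec (mat_rank A) \<Longrightarrow> B *\<^sub>v x = 0\<^sub>v m \<Longrightarrow> x = 0\<^sub>v (mat_rank A)"
proof -
  obtain s V where V: "orthonormal_cols q s V" and ker: "mat_range V = mat_kernel A"
    using kernel_orthonormal_basis[OF A] by blast
  obtain U where U: "orthonormal_cols q (q - s) U" and ranU: "mat_range U = mat_kernel (V\<^sup>T)"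
    and dec: "\<And>z. z \<in> carrier_vec q \<Longrightarrow> z = V *\<^sub>v (V\<^sup>T *\<^sub>v z) + U *\<^sub>v (U\<^sup>T *\<^sub>v z)"
    using orthonormal_complement[OF V] by metis
  note Vc = orthonormal_cols_carrier[OF V] and Uc = orthonormal_cols_carrier[OF U]
  define B where "B = A * U"
  have B: "B \<in> carrier_mat m (q - s)" using A Uc by (simp add: B_def)
  have Bx: "B *\<^sub>v x = A *\<^sub>v (U *\<^sub>v x)" if "x \<in> carrier_vec (q - s)" for x
    using A Uc that by (simp add: B_def)
  have inj: "x = 0\<^sub>v (q - s)" if x: "x \<in> carrier_vec (q - s)" and 0: "B *\<^sub>v x = 0\<^sub>v m" for x
  proof -
    have Ux: "U *\<^sub>v x \<in> carrier_vec q" using Uc x by auto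
    have "U *\<^sub>v x \<in> mat_range V" unfolding ker using mat_kernelI[OF A Ux] Bx[OF x] 0 by simp
    then obtain a where a: "a \<in> carrier_vec s" "U *\<^sub>v x = V *\<^sub>v a" using mat_range_eq[OF Vc] by auto
    have "U *\<^sub>v x \<in> mat_kernel (V\<^sup>T)" using mat_range_eq[OF Uc] x by (auto simp flip: ranU)
    then have "V\<^sup>T *\<^sub>v (U *\<^sub>v x) = 0\<^sub>v s" using mat_kernelD[of "V\<^sup>T" s q] Vc by auto
    then have "a = 0\<^sub>v s" using orthonormal_cols_transpose_mult_vec[OF V a(1)] a by simp
    then have "U *\<^sub>v x = 0\<^sub>v q" using a Vc by auto
    then show ?thesis using orthonormal_cols_inj[OF U x] by simp
  qed
  have ran: "mat_range B = mat_range A"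
  proof (intro equalityI subsetI)
    fix y assume "y \<in> mat_range B"
    then obtain x where "x \<in> carrier_vec (q - s)" "y = A *\<^sub>v (U *\<^sub>v x)" using mat_range_eq[OF B] Bx by auto
    moreover from this Uc have "U *\<^sub>v x \<in> carrier_vec q" by auto
    ultimately show "y \<in> mat_range A" using mat_range_eq[OF A] by blast
  next
    fix y assume "y \<in> mat_range A"
    then obtain z where z: "z \<in> carrier_vec q" "y = A *\<^sub>v z" using mat_range_eq[OF A] by auto
    have c: "V\<^sup>T *\<^sub>v z \<in> carrier_vec s" "U\<^sup>T *\<^sub>v z \<in> carrier_vec (q - s)" using Vc Uc z by auto
    have "V *\<^sub>v (V\<^sup>T *\<^sub>v z) \<in> mat_kernel A" using mat_range_eq[OF Vc] c by (auto simp flip: ker)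
    then have AV: "A *\<^sub>v (V *\<^sub>v (V\<^sup>T *\<^sub>v z)) = 0\<^sub>v m" using mat_kernelD[OF A] by blast
    have "A *\<^sub>v z = A *\<^sub>v (V *\<^sub>v (V\<^sup>T *\<^sub>v z)) + A *\<^sub>v (U *\<^sub>v (U\<^sup>T *\<^sub>v z))"
      by (subst dec[OF z(1)], rule mult_add_distrib_mat_vec[OF A]) (use Vc Uc c in auto)
    also have "\<dots> = B *\<^sub>v (U\<^sup>T *\<^sub>v z)" unfolding AV Bx[OF c(2)] using A Uc c by auto
    finally show "y \<in> mat_range B" using mat_range_eq[OF B] c z by auto
  qed
  have "mat_rank A = mat_rank B"
    using ran A B unfolding vec_space.rank_def vec_space.col_space_def by auto
  then have rk: "mat_rank A = q - s" using rank_of_injective[OF B inj] by simp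
  have "s \<le> q" by (rule orthonormal_cols_le[OF V])
  then have qs: "q - (q - s) = s" "q - s \<le> q" by simp_all
  show ?thesis
  proof (rule that[of V B], unfold rk qs(1))
    show "orthonormal_cols q s V" "mat_range V = mat_kernel A" "q - s \<le> q" "B \<in> carrier_mat m (q - s)"
      "mat_range B = mat_range A" by (fact V ker qs(2) B ran)+
  qed (rule inj)
qed

lemma kernel_basis_of_rank:
  fixes A :: "real mat"
  assumes A: "A \<in> carrier_mat m q"
  obtains U where "orthonormal_cols q (q - mat_rank A) U" "mat_range U = mat_kernel A"
  by (rule rank_nullity_factorization[OF A], rule that)

text \<open>
Here the injective factor of \<open>A\<close> is square, hence invertible.
\<close>

lemma full_row_rank_surjective:
  fixes A :: "real mat"
  assumes A: "A \<in> carrier_mat k n" and rk: "mat_rank A = k" and y: "y \<in> carrier_vec k"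
  obtains x where "x \<in> carrier_vec n" "A *\<^sub>v x = y"
proof -
  obtain B where B: "B \<in> carrier_mat k k" and ran: "mat_range B = mat_range A"
    and inj: "\<And>x. x \<in> carrier_vec k \<Longrightarrow> B *\<^sub>v x = 0\<^sub>v k \<Longrightarrow> x = 0\<^sub>v k"
    using rank_nullity_factorization[OF A] rk by metis
  obtain R where R: "R \<in> carrier_mat k k" "B * R = 1\<^sub>m k" using square_injective_inverse[OF B inj] by blast
  have "B *\<^sub>v (R *\<^sub>v y) = (B * R) *\<^sub>v y" using B R(1) y by simp
  also have "\<dots> = y" unfolding R(2) using y by simp
  finally have "y \<in> mat_range A" unfolding ran[symmetric] mat_range_eq[OF B] using R(1) y
    by (metis (mono_tags, lifting) mem_Collect_eq mult_mat_vec_carrier)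
  then show ?thesis using mat_range_eq[OF A] that by auto
qed

text \<open>
The dimension argument in matrix form: the coordinates of the columns of \<open>Y\<close> in the basis \<open>U\<close> form a
square injective matrix, which is invertible.
\<close>

lemma range_eq_if_injective_subset:
  assumes Y: "Y \<in> carrier_mat q p" and U: "orthonormal_cols q p U"
    and inj: "\<And>x. x \<in> carrier_vec p \<Longrightarrow> Y *\<^sub>v x = 0\<^sub>v q \<Longrightarrow> x = 0\<^sub>v p"
    and sub: "mat_range Y \<subseteq> mat_range U"
  shows "mat_range Y = mat_range U"
proof
  note Uc = orthonormal_cols_carrier[OF U]
  define Q where "Q = U\<^sup>T * Y"
  have Q: "Q \<in> carrier_mat p p" using Y Uc by (auto simp: Q_def)
  have UQ: "U *\<^sub>v (Q *\<^sub>v x) = Y *\<^sub>v x" if x: "x \<in> carrier_vec p" for x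
  proof -
    have "Y *\<^sub>v x \<in> mat_range U" using sub x mat_range_eq[OF Y] by auto
    then obtain a where a: "a \<in> carrier_vec p" "Y *\<^sub>v x = U *\<^sub>v a" using mat_range_eq[OF Uc] by auto
    have "Q *\<^sub>v x = U\<^sup>T *\<^sub>v (Y *\<^sub>v x)" using Uc Y x by (simp add: Q_def)
    also have "\<dots> = a" unfolding a(2) by (rule orthonormal_cols_transpose_mult_vec[OF U a(1)])
    finally show ?thesis using a by simp
  qed
  have "x = 0\<^sub>v p" if "x \<in> carrier_vec p" "Q *\<^sub>v x = 0\<^sub>v p" for x
  proof -
    have "U *\<^sub>v 0\<^sub>v p = 0\<^sub>v q" using Uc by auto
    then show ?thesis using inj[OF that(1)] UQ[OF that(1)] that(2) by simp
  qed
  then obtain R where R: "R \<in> carrier_mat p p" "Q * R = 1\<^sub>m p" using square_injective_inverse[OF Q] by blast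
  show "mat_range U \<subseteq> mat_range Y"
  proof
    fix z assume "z \<in> mat_range U"
    then obtain a where a: "a \<in> carrier_vec p" "z = U *\<^sub>v a" using mat_range_eq[OF Uc] by auto
    have Ra: "R *\<^sub>v a \<in> carrier_vec p" using R a by auto
    have "Q *\<^sub>v (R *\<^sub>v a) = (Q * R) *\<^sub>v a" using Q R(1) a by simp
    also have "\<dots> = a" unfolding R(2) using a by simp
    finally have "z = Y *\<^sub>v (R *\<^sub>v a)" using UQ[OF Ra] a by simp
    then show "z \<in> mat_range Y" using mat_range_eq[OF Y] Ra by auto
  qed
qed (rule sub)

lemma square_surjective_injective:
  fixes Q :: "real mat"
  assumes Q: "Q \<in> carrier_mat p p" and surj: "\<And>y. y \<in> carrier_vec p \<Longrightarrow> \<exists>x\<in>carrier_vec p. Q *\<^sub>v x = y"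
    and x: "x \<in> carrier_vec p" "Q *\<^sub>v x = 0\<^sub>v p"
  shows "x = 0\<^sub>v p"
proof -
  have "det (Q\<^sup>T) \<noteq> 0"
  proof
    assume "det (Q\<^sup>T) = 0"
    then obtain y where y: "y \<in> carrier_vec p" "y \<noteq> 0\<^sub>v p" "Q\<^sup>T *\<^sub>v y = 0\<^sub>v p"
      using det_0_iff_vec_prod_zero[of "Q\<^sup>T" p] Q by auto
    obtain z where z: "z \<in> carrier_vec p" "Q *\<^sub>v z = y" using surj[OF y(1)] by blast
    have "y \<bullet> y = (Q\<^sup>T *\<^sub>v y) \<bullet> z" using transpose_vec_mult_scalar[OF Q z(1) y(1)] z(2) by simp
    then show False using y z real_scalar_prod_eq_0_iff[OF y(1)] by simp
  qed
  then have "det Q \<noteq> 0" using det_transpose[OF Q] by simp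
  then show ?thesis using det_0_iff_vec_prod_zero[OF Q] x by blast
qed

text \<open>
A spanning family with as many elements as a basis is independent.
\<close>

lemma injective_if_range_eq_basis:
  fixes W :: "real mat"
  assumes W: "W \<in> carrier_mat n p" and U: "orthonormal_cols n p U" and ran: "mat_range W = mat_range U"
    and x: "x \<in> carrier_vec p" "W *\<^sub>v x = 0\<^sub>v n"
  shows "x = 0\<^sub>v p"
proof -
  note Uc = orthonormal_cols_carrier[OF U]
  define Q where "Q = U\<^sup>T * W"
  have Q: "Q \<in> carrier_mat p p" using Uc W by (simp add: Q_def)
  have Qx: "Q *\<^sub>v y = U\<^sup>T *\<^sub>v (W *\<^sub>v y)" if "y \<in> carrier_vec p" for y using Uc W that by (simp add: Q_def)
  have surj: "\<exists>y\<in>carrier_vec p. Q *\<^sub>v y = a" if a: "a \<in> carrier_vec p" for a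
  proof -
    have "U *\<^sub>v a \<in> mat_range W" unfolding ran mat_range_eq[OF Uc] using a by blast
    then obtain y where y: "y \<in> carrier_vec p" "U *\<^sub>v a = W *\<^sub>v y" unfolding mat_range_eq[OF W] by blast
    then have "Q *\<^sub>v y = a" using Qx[OF y(1)] orthonormal_cols_transpose_mult_vec[OF U a] by simp
    with y(1) show ?thesis by blast
  qed
  have "Q *\<^sub>v x = 0\<^sub>v p" unfolding Qx[OF x(1)] x(2) by (rule mult_mat_zero_vec) (use Uc in simp)
  from square_surjective_injective[OF Q surj x(1) this] show ?thesis .
qed

text \<open>
A surjective \<open>C\<close> with \<open>k\<close> rows has a kernel of dimension \<open>n - k\<close>, so \<open>n - k\<close> orthonormal kernel vectors
span it: on the \<open>k\<close>-dimensional complement of their span, \<open>C\<close> is square and surjective, hence injective.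
\<close>

lemma kernel_of_surjective:
  fixes C P :: "real mat"
  assumes C: "C \<in> carrier_mat k n" and surj: "\<And>y. y \<in> carrier_vec k \<Longrightarrow> \<exists>x\<in>carrier_vec n. C *\<^sub>v x = y"
    and P: "orthonormal_cols n (n - k) P" and CP: "C * P = 0\<^sub>m k (n - k)" and kn: "k \<le> n"
    and z: "z \<in> carrier_vec n" "C *\<^sub>v z = 0\<^sub>v k"
  shows "P *\<^sub>v (P\<^sup>T *\<^sub>v z) = z"
proof -
  obtain W where W: "orthonormal_cols n (n - (n - k)) W"
    and dec: "\<And>z. z \<in> carrier_vec n \<Longrightarrow> z = P *\<^sub>v (P\<^sup>T *\<^sub>v z) + W *\<^sub>v (W\<^sup>T *\<^sub>v z)"
    using orthonormal_complement[OF P] by metis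
  have "n - (n - k) = k" using kn by simp
  note W = W[unfolded this]
  note Pc = orthonormal_cols_carrier[OF P] and Wc = orthonormal_cols_carrier[OF W]
  define Q where "Q = C * W"
  have Q: "Q \<in> carrier_mat k k" using C Wc by (simp add: Q_def)
  have Cx: "C *\<^sub>v x = Q *\<^sub>v (W\<^sup>T *\<^sub>v x)" if x: "x \<in> carrier_vec n" for x
  proof -
    have c: "P\<^sup>T *\<^sub>v x \<in> carrier_vec (n - k)" "W\<^sup>T *\<^sub>v x \<in> carrier_vec k" using Pc Wc x by auto
    have "C *\<^sub>v x = C *\<^sub>v (P *\<^sub>v (P\<^sup>T *\<^sub>v x)) + C *\<^sub>v (W *\<^sub>v (W\<^sup>T *\<^sub>v x))"
      by (subst dec[OF x], rule mult_add_distrib_mat_vec[OF C]) (use Pc Wc c in auto)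
    also have "C *\<^sub>v (P *\<^sub>v (P\<^sup>T *\<^sub>v x)) = (C * P) *\<^sub>v (P\<^sup>T *\<^sub>v x)" by (rule assoc_mult_mat_vec[OF C Pc c(1), symmetric])
    also have "\<dots> = 0\<^sub>v k" unfolding CP using c by auto
    also have "C *\<^sub>v (W *\<^sub>v (W\<^sup>T *\<^sub>v x)) = Q *\<^sub>v (W\<^sup>T *\<^sub>v x)"
      unfolding Q_def by (rule assoc_mult_mat_vec[OF C Wc c(2), symmetric])
    finally show ?thesis using Q c by auto
  qed
  have surjQ: "\<exists>x\<in>carrier_vec k. Q *\<^sub>v x = y" if y: "y \<in> carrier_vec k" for y
  proof -
    obtain x where x: "x \<in> carrier_vec n" "C *\<^sub>v x = y" using surj[OF y] by blast
    then have "Q *\<^sub>v (W\<^sup>T *\<^sub>v x) = y" "W\<^sup>T *\<^sub>v x \<in> carrier_vec k" using Cx Wc by auto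
    then show ?thesis by blast
  qed
  have Wz: "W\<^sup>T *\<^sub>v z \<in> carrier_vec k" using Wc z by auto
  have "W\<^sup>T *\<^sub>v z = 0\<^sub>v k"
    by (rule square_surjective_injective[OF Q surjQ Wz]) (use Cx[OF z(1)] z(2) in simp_all)
  then have W0: "W *\<^sub>v (W\<^sup>T *\<^sub>v z) = 0\<^sub>v n" using mult_mat_zero_vec[OF Wc] by simp
  have c: "P *\<^sub>v (P\<^sup>T *\<^sub>v z) \<in> carrier_vec n"
    by (rule mult_mat_vec_carrier[OF Pc mult_mat_vec_carrier[OF transpose_carrier_mat[THEN iffD2, OF Pc] z(1)]])
  have "z = P *\<^sub>v (P\<^sup>T *\<^sub>v z) + W *\<^sub>v (W\<^sup>T *\<^sub>v z)" by (rule dec[OF z(1)])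
  also have "\<dots> = P *\<^sub>v (P\<^sup>T *\<^sub>v z)" unfolding W0 by (rule right_zero_vec[OF c])
  finally show ?thesis by (rule sym)
qed

section \<open>Entrywise limits of matrices\<close>

lemma finite_family_convergent_subseq:
  fixes f :: "'i \<Rightarrow> nat \<Rightarrow> real"
  assumes "finite I" "\<And>i. i \<in> I \<Longrightarrow> bounded (range (f i))"
  shows "\<exists>r. strict_mono (r :: nat \<Rightarrow> nat) \<and> (\<forall>i\<in>I. convergent (f i \<circ> r))"
  using assms
proof (induction I rule: finite_induct)
  case empty
  show ?case using strict_mono_id by auto
next
  case (insert i I)
  then obtain r where r: "strict_mono r" "\<And>j. j \<in> I \<Longrightarrow> convergent (f j \<circ> r)" by blast
  have "bounded (range (f i \<circ> r))"
    by (rule bounded_subset[of "range (f i)"]) (use insert.prems in auto)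
  then obtain l r' where r': "strict_mono r'" "(f i \<circ> r \<circ> r') \<longlonglongrightarrow> l"
    using bounded_imp_convergent_subsequence by blast
  have "convergent (f j \<circ> (r \<circ> r'))" if "j \<in> insert i I" for j
  proof (cases "j = i")
    case True
    then show ?thesis using r'(2) by (auto simp: convergent_def comp_assoc)
  next
    case False
    with that have "convergent (f j \<circ> r \<circ> r')" using r(2) r'(1) convergent_subseq_convergent by blast
    then show ?thesis by (simp add: comp_assoc)
  qed
  with strict_mono_o[OF r(1) r'(1)] show ?case by blast
qed

text \<open>
Bolzano-Weierstrass for matrices, by thinning out the sequence once for each of the finitely many entries.
\<close>

lemma mat_bounded_convergent_subseq:
  assumes X: "\<And>k. X k \<in> carrier_mat m n"
    and bound: "\<And>k i j. i < m \<Longrightarrow> j < n \<Longrightarrow> \<bar>X k $$ (i, j)\<bar> \<le> B"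
  obtains r L where "strict_mono (r :: nat \<Rightarrow> nat)" "L \<in> carrier_mat m n" "mat_tendsto (X \<circ> r) L"
proof -
  let ?f = "\<lambda>(i, j) k. X k $$ (i, j)"
  have "bounded (range (?f ij))" if "ij \<in> {..<m} \<times> {..<n}" for ij
    using that bound by (auto simp: bounded_iff)
  with finite_family_convergent_subseq[of "{..<m} \<times> {..<n}" ?f] obtain r
    where r: "strict_mono r" "\<And>ij. ij \<in> {..<m} \<times> {..<n} \<Longrightarrow> convergent (?f ij \<circ> r)" by auto
  define L where "L = mat m n (\<lambda>ij. lim (?f ij \<circ> r))"
  have "mat_tendsto (X \<circ> r) L"
    unfolding mat_tendsto_def
  proof (intro conjI allI impI)
    fix i j assume "i < dim_row L" "j < dim_col L"
    then have ij: "i < m" "j < n" by (auto simp: L_def)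
    then have "(?f (i, j) \<circ> r) \<longlonglongrightarrow> lim (?f (i, j) \<circ> r)"
      using r(2)[of "(i, j)"] by (simp add: convergent_LIMSEQ_iff)
    then show "(\<lambda>k. (X \<circ> r) k $$ (i, j)) \<longlonglongrightarrow> L $$ (i, j)" using ij by (simp add: L_def comp_def)
  qed (use X in \<open>auto simp: L_def\<close>)
  with r(1) that[of r L] show ?thesis by (simp add: L_def)
qed

lemma mat_tendstoD:
  "mat_tendsto X L \<Longrightarrow> L \<in> carrier_mat m n \<Longrightarrow> i < m \<Longrightarrow> j < n \<Longrightarrow> (\<lambda>k. X k $$ (i, j)) \<longlonglongrightarrow> L $$ (i, j)"
  by (auto simp: mat_tendsto_def)

lemma mat_tendsto_subseq:
  assumes "mat_tendsto X L" "strict_mono r"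
  shows "mat_tendsto (X \<circ> r) L"
  unfolding mat_tendsto_def
proof (intro conjI allI impI)
  have "filterlim r sequentially sequentially" by (rule filterlim_subseq[OF assms(2)])
  then show "\<forall>\<^sub>F m in sequentially. (X \<circ> r) m \<in> carrier_mat (dim_row L) (dim_col L)"
    using eventually_compose_filterlim[of _ sequentially r sequentially] assms(1)
    unfolding mat_tendsto_def comp_def by blast
  fix i j assume "i < dim_row L" "j < dim_col L"
  then have "(\<lambda>m. X m $$ (i, j)) \<longlonglongrightarrow> L $$ (i, j)" using assms(1) by (simp add: mat_tendsto_def)
  from LIMSEQ_subseq_LIMSEQ[OF this assms(2)]
  show "(\<lambda>m. (X \<circ> r) m $$ (i, j)) \<longlonglongrightarrow> L $$ (i, j)" by (simp add: comp_def)
qed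

text \<open>
Bounded entries and closedness under entrywise limits make \<open>S\<close> sequentially compact, so the values of
\<open>\<phi>\<close> form a compact set of reals.
\<close>

lemma sequentially_compact_attains_min:
  fixes \<phi> :: "real mat \<Rightarrow> real"
  assumes ne: "S \<noteq> {}" and sub: "S \<subseteq> carrier_mat m n"
    and bound: "\<And>X i j. X \<in> S \<Longrightarrow> i < m \<Longrightarrow> j < n \<Longrightarrow> \<bar>X $$ (i, j)\<bar> \<le> B"
    and closed: "\<And>X L. (\<And>k. X k \<in> S) \<Longrightarrow> L \<in> carrier_mat m n \<Longrightarrow> mat_tendsto X L \<Longrightarrow> L \<in> S"
    and cont: "\<And>X L. (\<And>k. X k \<in> S) \<Longrightarrow> L \<in> S \<Longrightarrow> mat_tendsto X L \<Longrightarrow> (\<lambda>k. \<phi> (X k)) \<longlonglongrightarrow> \<phi> L"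
  obtains X where "X \<in> S" "\<And>Y. Y \<in> S \<Longrightarrow> \<phi> X \<le> \<phi> Y"
proof -
  have "seq_compact (\<phi> ` S)"
    unfolding seq_compact_def
  proof (intro allI impI)
    fix f :: "nat \<Rightarrow> real" assume "\<forall>k. f k \<in> \<phi> ` S"
    then have "\<forall>k. \<exists>X. X \<in> S \<and> f k = \<phi> X" by blast
    from choice[OF this] obtain X where X: "\<And>k. X k \<in> S" "\<And>k. f k = \<phi> (X k)" by blast
    have "X k \<in> carrier_mat m n" for k using X sub by blast
    from mat_bounded_convergent_subseq[of X, OF this, of B] X bound
    obtain r L where r: "strict_mono r" "L \<in> carrier_mat m n" "mat_tendsto (X \<circ> r) L" by metis
    have "L \<in> S" by (rule closed[of "X \<circ> r"]) (use X r in auto)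
    moreover have "(\<lambda>k. \<phi> ((X \<circ> r) k)) \<longlonglongrightarrow> \<phi> L"
      by (rule cont) (use X r \<open>L \<in> S\<close> in \<open>auto simp: comp_def\<close>)
    ultimately show "\<exists>l\<in>\<phi> ` S. \<exists>r. strict_mono r \<and> (f \<circ> r) \<longlonglongrightarrow> l"
      using r(1) X(2) by (auto simp: comp_def intro!: exI[of _ r])
  qed
  then have "compact (\<phi> ` S)" by (simp add: compact_eq_seq_compact_metric)
  from compact_attains_inf[OF this] ne that show ?thesis by auto
qed

lemma orthonormal_cols_entry_le:
  assumes V: "orthonormal_cols q p V" and ij: "i < q" "j < p"
  shows "\<bar>V $$ (i, j)\<bar> \<le> 1"
proof -
  note Vc = orthonormal_cols_carrier[OF V]
  have "col V j \<bullet> col V j = 1" using V orthonormal_cols_iff[OF Vc] ij by simp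
  then have "(\<Sum>k<q. (V $$ (k, j))\<^sup>2) = 1"
    using Vc ij by (subst (asm) scalar_prod_sum[of _ q]) (auto simp: power2_eq_square)
  moreover have "(V $$ (i, j))\<^sup>2 \<le> (\<Sum>k<q. (V $$ (k, j))\<^sup>2)"
    by (rule member_le_sum) (use ij in auto)
  ultimately show ?thesis by (simp add: abs_square_le_1)
qed

lemma orthonormal_cols_limit:
  assumes X: "\<And>k. orthonormal_cols q p (X k)" and L: "L \<in> carrier_mat q p" and lim: "mat_tendsto X L"
  shows "orthonormal_cols q p L"
  unfolding orthonormal_cols_iff[OF L]
proof (intro allI impI)
  fix i j assume ij: "i < p" "j < p"
  have exp: "col Y i \<bullet> col Y j = (\<Sum>k<q. Y $$ (k, i) * Y $$ (k, j))" if "Y \<in> carrier_mat q p" for Y :: "real mat"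
    using that ij by (subst scalar_prod_sum[of _ q]) auto
  have "(\<lambda>k. col (X k) i \<bullet> col (X k) j) \<longlonglongrightarrow> col L i \<bullet> col L j"
    unfolding exp[OF L] exp[OF orthonormal_cols_carrier[OF X]]
    by (intro tendsto_intros mat_tendstoD[OF lim L]) (use ij in auto)
  moreover have "col (X k) i \<bullet> col (X k) j = (if i = j then 1 else 0)" for k
    using X[of k] orthonormal_cols_iff[OF orthonormal_cols_carrier[OF X]] ij by simp
  ultimately show "col L i \<bullet> col L j = (if i = j then 1 else 0)"
    by (simp add: LIMSEQ_const_iff split: if_splits)
qed

lemma quadratic_form_sum:
  fixes G V :: "real mat"
  assumes "G \<in> carrier_mat q q" "V \<in> carrier_mat q p" "j < p"
  shows "col V j \<bullet> (G *\<^sub>v col V j) = (\<Sum>s<q. V $$ (s, j) * (\<Sum>t<q. G $$ (s, t) * V $$ (t, j)))"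
proof -
  have "(G *\<^sub>v col V j) $ s = (\<Sum>t<q. G $$ (s, t) * V $$ (t, j))" if "s < q" for s
    using assms that mult_mat_vec_nth_sum[of G q q "col V j" s] by simp
  then show ?thesis using assms by (subst scalar_prod_sum[of _ q]) auto
qed

lemma quadratic_form_tendsto:
  fixes G V :: "nat \<Rightarrow> real mat"
  assumes G: "\<And>k. G k \<in> carrier_mat q q" "G' \<in> carrier_mat q q" "mat_tendsto G G'"
    and V: "\<And>k. V k \<in> carrier_mat q p" "V' \<in> carrier_mat q p" "mat_tendsto V V'" and j: "j < p"
  shows "(\<lambda>k. col (V k) j \<bullet> (G k *\<^sub>v col (V k) j)) \<longlonglongrightarrow> col V' j \<bullet> (G' *\<^sub>v col V' j)"
  unfolding quadratic_form_sum[OF G(1) V(1) j] quadratic_form_sum[OF G(2) V(2) j]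
  by (intro tendsto_intros mat_tendstoD[OF G(3,2)] mat_tendstoD[OF V(3,2)]) (use j in auto)

section \<open>Smallest eigenvalues of symmetric matrices\<close>

text \<open>
The quadratic form has a minimum at \<open>x\<close>, so its derivative \<open>2 K x\<close> vanishes there. Concretely, the form
at \<open>x - s y\<close> with \<open>y = K x\<close> is \<open>- 2 s (y \<bullet> y) + O(s\<^sup>2)\<close>, which is negative for small \<open>s > 0\<close> unless
\<open>y = 0\<close>.
\<close>

lemma psd_null_vector:
  fixes K :: "real mat"
  assumes K: "K \<in> carrier_mat q q" and sym: "K\<^sup>T = K"
    and psd: "\<And>y. y \<in> carrier_vec q \<Longrightarrow> 0 \<le> y \<bullet> (K *\<^sub>v y)"
    and x: "x \<in> carrier_vec q" and 0: "x \<bullet> (K *\<^sub>v x) = 0"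
  shows "K *\<^sub>v x = 0\<^sub>v q"
proof -
  define y where "y = K *\<^sub>v x"
  have y: "y \<in> carrier_vec q" using K x by (auto simp: y_def)
  have Ky: "K *\<^sub>v y \<in> carrier_vec q" using K y by auto
  have xKy: "x \<bullet> (K *\<^sub>v y) = y \<bullet> y"
    using transpose_vec_mult_scalar[OF K y x] by (simp add: sym y_def)
  have ineq: "0 \<le> - 2 * s * (y \<bullet> y) + s\<^sup>2 * (y \<bullet> (K *\<^sub>v y))" for s
  proof -
    have sy: "s \<cdot>\<^sub>v y \<in> carrier_vec q" using y by simp
    have "K *\<^sub>v (x - s \<cdot>\<^sub>v y) = y - s \<cdot>\<^sub>v (K *\<^sub>v y)"
      unfolding mult_minus_distrib_mat_vec[OF K x sy] using mult_mat_vec[OF K y, of s] by (simp add: y_def)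
    moreover have "(x - s \<cdot>\<^sub>v y) \<bullet> (y - s \<cdot>\<^sub>v (K *\<^sub>v y)) =
        x \<bullet> y - s * (y \<bullet> y) - s * (x \<bullet> (K *\<^sub>v y)) + s * s * (y \<bullet> (K *\<^sub>v y))"
      using x y Ky by (simp add: minus_scalar_prod_distrib[of _ q] scalar_prod_minus_distrib[of _ q] algebra_simps)
    moreover have "0 \<le> (x - s \<cdot>\<^sub>v y) \<bullet> (K *\<^sub>v (x - s \<cdot>\<^sub>v y))" by (rule psd) (use x y in simp)
    ultimately show ?thesis using 0 by (simp add: xKy power2_eq_square flip: y_def)
  qed
  have "y \<bullet> y = 0"
  proof (rule ccontr)
    assume "y \<bullet> y \<noteq> 0"
    then have a: "0 < y \<bullet> y" using real_scalar_prod_nonneg[of y] by linarith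
    define b where "b = y \<bullet> (K *\<^sub>v y)"
    have b: "0 \<le> b" unfolding b_def by (rule psd[OF y])
    \<comment> \<open>small enough that the quadratic term is at most half of the linear one; \<open>+ 1\<close> avoids division by \<open>0\<close>\<close>
    define s where "s = (y \<bullet> y) / (b + 1)"
    have s: "0 < s" using a b by (simp add: s_def)
    have "s * (2 * (y \<bullet> y)) \<le> s * (s * b)" using ineq[of s] by (simp add: b_def power2_eq_square algebra_simps)
    then have "2 * (y \<bullet> y) \<le> s * b" using s by simp
    also have "\<dots> \<le> s * (b + 1)" using s by simp
    also have "\<dots> = y \<bullet> y" using b by (simp add: s_def)
    finally show False using a by simp
  qed
  then show ?thesis using real_scalar_prod_eq_0_iff[OF y] by (simp add: y_def)
qed

lemma char_poly_block_upper_triangular: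
  fixes A1 :: "real mat"
  assumes A1: "A1 \<in> carrier_mat n n" and A2: "A2 \<in> carrier_mat n m" and A3: "A3 \<in> carrier_mat m m"
  shows "char_poly (four_block_mat A1 A2 (0\<^sub>m m n) A3) = char_poly A1 * char_poly A3"
proof -
  let ?A = "four_block_mat A1 A2 (0\<^sub>m m n) A3"
  have "char_poly_matrix ?A =
      four_block_mat (char_poly_matrix A1) (map_mat (\<lambda>a. [:- a:]) A2) (0\<^sub>m m n) (char_poly_matrix A3)"
    using A1 A2 A3 by (intro eq_matI) (auto simp: char_poly_matrix_def)
  then show ?thesis
    unfolding char_poly_def
    using det_four_block_mat_lower_left_zero[of "char_poly_matrix A1" n "map_mat (\<lambda>a. [:- a:]) A2" m _ "char_poly_matrix A3"]
      A1 A2 A3 by simp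
qed

text \<open>
Complete \<open>V\<close> to an orthogonal matrix \<open>Q\<close>. Then \<open>Q\<^sup>T G Q\<close> is similar to \<open>G\<close> and block upper triangular,
with the given eigenvalues on the diagonal of its first block.
\<close>

lemma orthonormal_eigenvectors_dvd_char_poly:
  assumes G: "G \<in> carrier_mat q q" and V: "orthonormal_cols q p V" and len: "length ds = p"
    and ev: "\<And>j. j < p \<Longrightarrow> G *\<^sub>v col V j = ds ! j \<cdot>\<^sub>v col V j"
  shows "(\<Prod>d\<leftarrow>ds. [:- d, 1:]) dvd char_poly G"
proof -
  obtain U where U: "orthonormal_cols q (q - p) U" and on: "orthonormal_cols q q (V @\<^sub>c U)"
    using orthonormal_complement[OF V] by metis
  define Q where "Q = V @\<^sub>c U"
  note Vc = orthonormal_cols_carrier[OF V] and Uc = orthonormal_cols_carrier[OF U]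
  have pq: "p \<le> q" by (rule orthonormal_cols_le[OF V])
  have Q: "Q \<in> carrier_mat q q" and QtQ: "Q\<^sup>T * Q = 1\<^sub>m q" using on by (auto simp: Q_def orthonormal_cols_def)
  have QQt: "Q * Q\<^sup>T = 1\<^sub>m q" by (rule mat_mult_left_right_inverse[OF _ Q QtQ]) (use Q in simp)
  have colQ: "col Q j = col V j" if "j < p" for j
    using col_append_cols[OF Vc Uc, of j] that by (simp add: Q_def)
  have delta: "col Q i \<bullet> col Q j = (if i = j then 1 else 0)" if "i < q" "j < q" for i j
    using on that orthonormal_cols_iff[OF Q] unfolding Q_def by simp
  define B where "B = Q\<^sup>T * G * Q"
  have B: "B \<in> carrier_mat q q" using Q G by (simp add: B_def)
  have Bij: "B $$ (i, j) = (if i = j then ds ! j else 0)" if "i < q" "j < p" for i j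
  proof -
    have j: "j < q" using that pq by simp
    have "B = Q\<^sup>T * (G * Q)" unfolding B_def using Q G by (simp add: assoc_mult_mat[of _ q q _ q _ q])
    then have "B $$ (i, j) = col Q i \<bullet> col (G * Q) j" using Q G that j by simp
    also have "col (G * Q) j = ds ! j \<cdot>\<^sub>v col Q j"
      unfolding col_mult2[OF G Q j] using ev[OF that(2)] colQ[OF that(2)] by simp
    finally show ?thesis using delta[OF that(1) j] Q that j by simp
  qed
  have "similar_mat B G"
  proof (rule similar_matI)
    show "{B, G, Q\<^sup>T, Q} \<subseteq> carrier_mat q q" using B G Q by simp
  qed (rule QtQ QQt B_def)+
  then have cp: "char_poly G = char_poly B" using char_poly_similar by metis
  define D where "D = mat p p (\<lambda>(i, j). B $$ (i, j))"
  define B2 where "B2 = mat p (q - p) (\<lambda>(i, j). B $$ (i, j + p))"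
  define B4 where "B4 = mat (q - p) (q - p) (\<lambda>(i, j). B $$ (i + p, j + p))"
  have "B = four_block_mat D B2 (0\<^sub>m (q - p) p) B4"
    using pq B Bij by (intro eq_matI) (auto simp: D_def B2_def B4_def)
  then have "char_poly B = char_poly D * char_poly B4"
    using char_poly_block_upper_triangular[of D p B2 "q - p" B4] by (simp add: D_def B2_def B4_def)
  moreover have "char_poly D = (\<Prod>d\<leftarrow>diag_mat D. [:- d, 1:])"
    by (rule char_poly_upper_triangular[of _ p]) (use Bij pq in \<open>auto simp: D_def upper_triangular_def\<close>)
  moreover have "diag_mat D = ds"
    using Bij pq len by (intro nth_equalityI) (auto simp: D_def diag_mat_def)
  ultimately show ?thesis using cp by simp
qed

lemma linear_factors_dvd_imp_mset_subset:
  fixes ds es :: "real list"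
  assumes "(\<Prod>d\<leftarrow>ds. [:- d, 1:]) dvd (\<Prod>e\<leftarrow>es. [:- e, 1:])"
  shows "mset ds \<subseteq># mset es"
  using assms
proof (induction ds arbitrary: es)
  case (Cons d ds)
  have "poly (\<Prod>e\<leftarrow>es. [:- e, 1:]) d = 0"
  proof -
    have "[:- d, 1:] dvd (\<Prod>d\<leftarrow>d # ds. [:- d, 1:])" by (simp only: list.map prod_list.Cons dvd_triv_left)
    from dvd_trans[OF this Cons.prems] show ?thesis by (simp only: poly_eq_0_iff_dvd)
  qed
  then have "d \<in> set es" by (auto simp: poly_prod_list prod_list_zero_iff)
  then obtain es1 es2 where es: "es = es1 @ d # es2" by (meson split_list)
  have "(\<Prod>e\<leftarrow>es. [:- e, 1:]) = [:- d, 1:] * (\<Prod>e\<leftarrow>es1 @ es2. [:- e, 1:])"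
    unfolding es by (simp only: map_append list.map prod_list.append prod_list.Cons mult.left_commute)
  then have "[:- d, 1:] * (\<Prod>d\<leftarrow>ds. [:- d, 1:]) dvd [:- d, 1:] * (\<Prod>e\<leftarrow>es1 @ es2. [:- e, 1:])"
    using Cons.prems by (simp only: list.map prod_list.Cons)
  then have "(\<Prod>d\<leftarrow>ds. [:- d, 1:]) dvd (\<Prod>e\<leftarrow>es1 @ es2. [:- e, 1:])"
    unfolding dvd_mult_cancel_left by simp
  from Cons.IH[OF this] show ?case by (simp add: es)
qed simp

lemma smult_mat_mult_vec:
  fixes A :: "real mat"
  assumes "A \<in> carrier_mat m n" "x \<in> carrier_vec n"
  shows "(c \<cdot>\<^sub>m A) *\<^sub>v x = c \<cdot>\<^sub>v (A *\<^sub>v x)"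
  using assms by (intro eq_vecI) (auto simp: scalar_prod_def sum_distrib_left mult.assoc)

text \<open>
Minimise the quadratic form over the unit sphere, encoded as the matrices with one orthonormal column.
At a minimiser \<open>x\<close> with value \<open>\<mu>\<close>, the matrix \<open>H - \<mu> I\<close> is positive semidefinite and its form vanishes,
so \<open>x\<close> is an eigenvector.
\<close>

lemma rayleigh_minimum:
  fixes H :: "real mat"
  assumes H: "H \<in> carrier_mat t t" and sym: "H\<^sup>T = H" and t: "0 < t"
  obtains x \<mu> where "x \<in> carrier_vec t" "x \<bullet> x = 1" "H *\<^sub>v x = \<mu> \<cdot>\<^sub>v x"
    "\<And>y. y \<in> carrier_vec t \<Longrightarrow> \<mu> * (y \<bullet> y) \<le> y \<bullet> (H *\<^sub>v y)"
proof -
  let ?S = "{X. orthonormal_cols t 1 X}"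
  have unit_mem: "mat_of_cols t [w] \<in> ?S" if "w \<in> carrier_vec t" "w \<bullet> w = 1" for w
    using orthonormal_single[OF that] by simp
  obtain X where X: "X \<in> ?S" and min: "\<And>Y. Y \<in> ?S \<Longrightarrow> col X 0 \<bullet> (H *\<^sub>v col X 0) \<le> col Y 0 \<bullet> (H *\<^sub>v col Y 0)"
  proof (rule sequentially_compact_attains_min[of ?S t 1 1 "\<lambda>X. col X 0 \<bullet> (H *\<^sub>v col X 0)"])
    have "mat_of_cols t [unit_vec t 0] \<in> ?S" by (rule unit_mem) (use t in auto)
    then show "?S \<noteq> {}" by blast
    show "L \<in> ?S" if "\<And>k. Y k \<in> ?S" "L \<in> carrier_mat t 1" "mat_tendsto Y L" for Y L
      using orthonormal_cols_limit[of t 1 Y L] that by simp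
    show "(\<lambda>k. col (Y k) 0 \<bullet> (H *\<^sub>v col (Y k) 0)) \<longlonglongrightarrow> col L 0 \<bullet> (H *\<^sub>v col L 0)"
      if "\<And>k. Y k \<in> ?S" "L \<in> ?S" "mat_tendsto Y L" for Y L
    proof (rule quadratic_form_tendsto[of "\<lambda>_. H" t H Y 1 L 0])
      show "mat_tendsto (\<lambda>_. H) H" by (simp add: mat_tendsto_def)
    qed (use that H in \<open>auto simp: orthonormal_cols_def\<close>)
  qed (auto intro: orthonormal_cols_entry_le orthonormal_cols_carrier)
  define x where "x = col X 0"
  define \<mu> where "\<mu> = x \<bullet> (H *\<^sub>v x)"
  have Xc: "X \<in> carrier_mat t 1" using X by (simp add: orthonormal_cols_def)
  have x: "x \<in> carrier_vec t" using Xc by (auto simp: x_def)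
  have xx: "x \<bullet> x = 1" using X orthonormal_cols_iff[OF Xc] by (simp add: x_def)
  have bound: "\<mu> * (y \<bullet> y) \<le> y \<bullet> (H *\<^sub>v y)" if y: "y \<in> carrier_vec t" for y
  proof (cases "y = 0\<^sub>v t")
    case True
    then show ?thesis using H by simp
  next
    case False
    then obtain c where c: "c \<noteq> 0" "(c \<cdot>\<^sub>v y) \<bullet> (c \<cdot>\<^sub>v y) = 1" using unit_multiple[OF y] by blast
    have cy: "c \<cdot>\<^sub>v y \<in> carrier_vec t" using y by simp
    have Hy: "H *\<^sub>v y \<in> carrier_vec t" using H y by auto
    have "\<mu> \<le> (c \<cdot>\<^sub>v y) \<bullet> (H *\<^sub>v (c \<cdot>\<^sub>v y))"
      using min[OF unit_mem[OF cy c(2)]] cy by (simp add: \<mu>_def x_def)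
    also have "\<dots> = c\<^sup>2 * (y \<bullet> (H *\<^sub>v y))"
      unfolding mult_mat_vec[OF H y] using y Hy by (simp add: power2_eq_square)
    finally have "\<mu> \<le> c\<^sup>2 * (y \<bullet> (H *\<^sub>v y))" .
    moreover have "1 = c\<^sup>2 * (y \<bullet> y)" using c(2) y by (simp add: power2_eq_square)
    ultimately have "c\<^sup>2 * (\<mu> * (y \<bullet> y)) \<le> c\<^sup>2 * (y \<bullet> (H *\<^sub>v y))" by (simp add: mult.left_commute[of "c\<^sup>2"] flip: \<open>1 = _\<close>)
    then show ?thesis using c(1) by simp
  qed
  define K where "K = H + (- \<mu>) \<cdot>\<^sub>m 1\<^sub>m t"
  have K: "K \<in> carrier_mat t t" using H by (simp add: K_def)
  have Ky: "K *\<^sub>v y = H *\<^sub>v y - \<mu> \<cdot>\<^sub>v y" if "y \<in> carrier_vec t" for y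
  proof -
    have "((- \<mu>) \<cdot>\<^sub>m 1\<^sub>m t) *\<^sub>v y = (- \<mu>) \<cdot>\<^sub>v y" using that by (simp add: smult_mat_mult_vec[of _ t t])
    then show ?thesis unfolding K_def using H that
      by (subst add_mult_distrib_mat_vec[of _ t t]) (auto intro!: eq_vecI)
  qed
  have yKy: "y \<bullet> (K *\<^sub>v y) = y \<bullet> (H *\<^sub>v y) - \<mu> * (y \<bullet> y)" if y: "y \<in> carrier_vec t" for y
  proof -
    have Hy: "H *\<^sub>v y \<in> carrier_vec t" using H y by auto
    show ?thesis unfolding Ky[OF y] using y Hy by (simp add: scalar_prod_minus_distrib[of _ t])
  qed
  have "K *\<^sub>v x = 0\<^sub>v t"
  proof (rule psd_null_vector[OF K])
    show "K\<^sup>T = K"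
    proof -
      have "H $$ (j, i) = H $$ (i, j)" if "i < t" "j < t" for i j
        using arg_cong[OF sym, of "\<lambda>A. A $$ (i, j)"] H that by simp
      then show ?thesis unfolding K_def using H by (intro eq_matI) auto
    qed
    show "0 \<le> y \<bullet> (K *\<^sub>v y)" if "y \<in> carrier_vec t" for y using yKy[OF that] bound[OF that] by simp
    show "x \<bullet> (K *\<^sub>v x) = 0" using yKy[OF x] xx by (simp add: \<mu>_def)
  qed (rule x)
  have "H *\<^sub>v x = \<mu> \<cdot>\<^sub>v x"
  proof (rule eq_vecI)
    fix i assume "i < dim_vec (\<mu> \<cdot>\<^sub>v x)"
    then have i: "i < t" using x by simp
    have "(H *\<^sub>v x - \<mu> \<cdot>\<^sub>v x) $ i = 0" using \<open>K *\<^sub>v x = 0\<^sub>v t\<close> i by (simp flip: Ky[OF x])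
    then show "(H *\<^sub>v x) $ i = (\<mu> \<cdot>\<^sub>v x) $ i" using i x H by simp
  qed (use H x in auto)
  with x xx bound that show ?thesis by blast
qed

lemma symmetric_scalar_prod_swap:
  fixes G :: "real mat"
  assumes "G \<in> carrier_mat q q" "G\<^sup>T = G" "x \<in> carrier_vec q" "y \<in> carrier_vec q"
  shows "x \<bullet> (G *\<^sub>v y) = (G *\<^sub>v x) \<bullet> y"
  using transpose_vec_mult_scalar[OF assms(1,4,3)] assms(2) by simp

text \<open>
On the orthogonal complement of the columns of \<open>V\<close>, the form of \<open>G\<close> is bounded below by its least
Rayleigh quotient \<open>\<mu>\<close> there, which is an eigenvalue with an eigenvector orthogonal to \<open>V\<close>. Adding this
eigenvector to \<open>V\<close> shows that \<open>\<mu>\<close>, counted with multiplicity, is an eigenvalue beyond the \<open>p\<close> smallest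
ones, so it is at least as large as each of them.
\<close>

lemma eigenvalue_gap_on_complement:
  fixes G :: "real mat"
  assumes G: "G \<in> carrier_mat q q" and sym: "G\<^sup>T = G" and V: "orthonormal_cols q p V"
    and cp: "char_poly G = (\<Prod>e\<leftarrow>es. [:- e, 1:])" and sorted: "sorted es"
    and ds: "mset ds = mset (take p es)" "length ds = p"
    and ev: "\<And>j. j < p \<Longrightarrow> G *\<^sub>v col V j = ds ! j \<cdot>\<^sub>v col V j"
  obtains \<mu> where "\<And>j. j < p \<Longrightarrow> ds ! j \<le> \<mu>"
    "\<And>y. y \<in> carrier_vec q \<Longrightarrow> V\<^sup>T *\<^sub>v y = 0\<^sub>v p \<Longrightarrow> \<mu> * (y \<bullet> y) \<le> y \<bullet> (G *\<^sub>v y)"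
proof -
  obtain U where U: "orthonormal_cols q (q - p) U" and ran: "mat_range U = mat_kernel (V\<^sup>T)"
    and dec: "\<And>z. z \<in> carrier_vec q \<Longrightarrow> z = V *\<^sub>v (V\<^sup>T *\<^sub>v z) + U *\<^sub>v (U\<^sup>T *\<^sub>v z)"
    using orthonormal_complement[OF V] by metis
  note Vc = orthonormal_cols_carrier[OF V] and Uc = orthonormal_cols_carrier[OF U]
  have pq: "p \<le> q" by (rule orthonormal_cols_le[OF V])
  have in_U: "z = U *\<^sub>v (U\<^sup>T *\<^sub>v z)" if z: "z \<in> carrier_vec q" "V\<^sup>T *\<^sub>v z = 0\<^sub>v p" for z
  proof -
    have "V *\<^sub>v 0\<^sub>v p = 0\<^sub>v q" using Vc by auto
    then show ?thesis using dec[OF z(1)] z Uc by (metis left_zero_vec mult_mat_vec_carrier transpose_carrier_mat)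
  qed
  define t where "t = q - p"
  note U = U[folded t_def] and Uc = Uc[folded t_def]
  define H where "H = U\<^sup>T * G * U"
  have H: "H \<in> carrier_mat t t" using Uc G by (simp add: H_def)
  have UtG: "U\<^sup>T * G \<in> carrier_mat t q" using Uc G by simp
  have "H\<^sup>T = U\<^sup>T * (U\<^sup>T * G)\<^sup>T" unfolding H_def by (rule transpose_mult[OF UtG Uc])
  also have "(U\<^sup>T * G)\<^sup>T = G * U" using transpose_mult[of "U\<^sup>T" t q G q] Uc G sym by simp
  also have "U\<^sup>T * (G * U) = H" unfolding H_def using assoc_mult_mat[of "U\<^sup>T" t q G q U t] Uc G by simp
  finally have Hsym: "H\<^sup>T = H" .
  have Hx: "H *\<^sub>v x = U\<^sup>T *\<^sub>v (G *\<^sub>v (U *\<^sub>v x))" if x: "x \<in> carrier_vec t" for x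
  proof -
    have Ux: "U *\<^sub>v x \<in> carrier_vec q" using Uc x by auto
    have "H *\<^sub>v x = (U\<^sup>T * G) *\<^sub>v (U *\<^sub>v x)" unfolding H_def by (rule assoc_mult_mat_vec[OF UtG Uc x])
    also have "\<dots> = U\<^sup>T *\<^sub>v (G *\<^sub>v (U *\<^sub>v x))" by (rule assoc_mult_mat_vec[OF _ G Ux]) (use Uc in simp)
    finally show ?thesis .
  qed
  show ?thesis
  proof (cases "t = 0")
    case True
    \<comment> \<open>the complement is trivial, so any upper bound for the eigenvalues serves\<close>
    show ?thesis
    proof (rule that[of "\<Sum>j<p. \<bar>ds ! j\<bar>"])
      show "ds ! j \<le> (\<Sum>j<p. \<bar>ds ! j\<bar>)" if "j < p" for j
        using member_le_sum[of j "{..<p}" "\<lambda>j. \<bar>ds ! j\<bar>"] that by (auto intro: order_trans[OF abs_ge_self])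
      fix y assume y: "y \<in> carrier_vec q" "V\<^sup>T *\<^sub>v y = 0\<^sub>v p"
      have "U\<^sup>T *\<^sub>v y = 0\<^sub>v t" using True Uc by (intro eq_vecI) auto
      moreover have "U *\<^sub>v 0\<^sub>v t = 0\<^sub>v q" using Uc by auto
      ultimately have "y = 0\<^sub>v q" using in_U[OF y] by simp
      then show "(\<Sum>j<p. \<bar>ds ! j\<bar>) * (y \<bullet> y) \<le> y \<bullet> (G *\<^sub>v y)" using G by simp
    qed
  next
    case False
    then obtain x \<mu> where x: "x \<in> carrier_vec t" "x \<bullet> x = 1" "H *\<^sub>v x = \<mu> \<cdot>\<^sub>v x"
      and min: "\<And>y. y \<in> carrier_vec t \<Longrightarrow> \<mu> * (y \<bullet> y) \<le> y \<bullet> (H *\<^sub>v y)"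
      using rayleigh_minimum[OF H Hsym] by blast
    define z where "z = U *\<^sub>v x"
    have z: "z \<in> carrier_vec q" using Uc x by (auto simp: z_def)
    have zz: "z \<bullet> z = 1"
      using transpose_vec_mult_scalar[OF Uc x(1) z] orthonormal_cols_transpose_mult_vec[OF U x(1)] x(2)
      by (simp add: z_def)
    have "z \<in> mat_kernel (V\<^sup>T)" using mat_range_eq[OF Uc] x by (auto simp: z_def simp flip: ran)
    then have Vz: "V\<^sup>T *\<^sub>v z = 0\<^sub>v p" using mat_kernelD[of "V\<^sup>T" p q] Vc by auto
    have Gz: "G *\<^sub>v z \<in> carrier_vec q" using G z by auto
    have "V\<^sup>T *\<^sub>v (G *\<^sub>v z) = 0\<^sub>v p"
    proof (rule eq_vecI)
      fix i assume "i < dim_vec (0\<^sub>v p :: real vec)"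
      then have i: "i < p" by simp
      have vi: "col V i \<in> carrier_vec q" using Vc i by auto
      have "(V\<^sup>T *\<^sub>v (G *\<^sub>v z)) $ i = col V i \<bullet> (G *\<^sub>v z)" using Vc i by simp
      also have "\<dots> = (G *\<^sub>v col V i) \<bullet> z" by (rule symmetric_scalar_prod_swap[OF G sym vi z])
      also have "\<dots> = ds ! i * (V\<^sup>T *\<^sub>v z) $ i" using ev[OF i] vi z Vc i by simp
      finally show "(V\<^sup>T *\<^sub>v (G *\<^sub>v z)) $ i = 0\<^sub>v p $ i" using Vz i by simp
    qed (use Vc in simp)
    from in_U[OF Gz this] have "G *\<^sub>v z = U *\<^sub>v (H *\<^sub>v x)" by (simp add: Hx[OF x(1)] z_def)
    also have "\<dots> = \<mu> \<cdot>\<^sub>v z" unfolding x(3) z_def by (rule mult_mat_vec[OF Uc x(1)])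
    finally have Gz_eq: "G *\<^sub>v z = \<mu> \<cdot>\<^sub>v z" .
    have zc: "mat_of_cols q [z] \<in> carrier_mat q 1" by auto
    have "(\<Prod>d\<leftarrow>ds @ [\<mu>]. [:- d, 1:]) dvd char_poly G"
    proof (rule orthonormal_eigenvectors_dvd_char_poly[OF G orthonormal_append_unit[OF V z zz Vz]])
      show "G *\<^sub>v col (V @\<^sub>c mat_of_cols q [z]) j = (ds @ [\<mu>]) ! j \<cdot>\<^sub>v col (V @\<^sub>c mat_of_cols q [z]) j"
        if "j < p + 1" for j
        unfolding col_append_cols[OF Vc zc that] using that ev Gz_eq ds(2) z by (auto simp: nth_append less_Suc_eq)
    qed (use ds in simp)
    then have "mset (ds @ [\<mu>]) \<subseteq># mset es" unfolding cp by (rule linear_factors_dvd_imp_mset_subset)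
    moreover have "mset es = mset (take p es) + mset (drop p es)"
      by (metis append_take_drop_id mset_append)
    \<comment> \<open>\<open>ds\<close> already uses up the first \<open>p\<close> eigenvalues\<close>
    ultimately have "{#\<mu>#} \<subseteq># mset (drop p es)" by (simp add: ds(1))
    then have mu: "\<mu> \<in> set (drop p es)" by simp
    have le: "ds ! j \<le> \<mu>" if "j < p" for j
    proof -
      have "ds ! j \<in> set (take p es)" using that ds by (metis mset_eq_setD nth_mem)
      moreover have "sorted (take p es @ drop p es)" using sorted by simp
      ultimately show ?thesis using mu unfolding sorted_append by blast
    qed
    show ?thesis
    proof (rule that[OF le])
      fix y assume y: "y \<in> carrier_vec q" "V\<^sup>T *\<^sub>v y = 0\<^sub>v p"
      define b where "b = U\<^sup>T *\<^sub>v y"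
      have b: "b \<in> carrier_vec t" using Uc y by (auto simp: b_def)
      have yU: "y = U *\<^sub>v b" using in_U[OF y] by (simp add: b_def)
      have Gy: "G *\<^sub>v y \<in> carrier_vec q" using G y by auto
      have "y \<bullet> y = b \<bullet> b"
        using transpose_vec_mult_scalar[OF Uc b y(1)] orthonormal_cols_transpose_mult_vec[OF U b] by (simp add: yU)
      moreover have "y \<bullet> (G *\<^sub>v y) = b \<bullet> (H *\<^sub>v b)"
      proof -
        have "y \<bullet> (G *\<^sub>v y) = (G *\<^sub>v y) \<bullet> (U *\<^sub>v b)" using comm_scalar_prod[OF y(1) Gy] yU by simp
        also have "\<dots> = (U\<^sup>T *\<^sub>v (G *\<^sub>v y)) \<bullet> b" using transpose_vec_mult_scalar[OF Uc b Gy] by simp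
        also have "U\<^sup>T *\<^sub>v (G *\<^sub>v y) = H *\<^sub>v b" using Hx[OF b] yU by simp
        also have "(H *\<^sub>v b) \<bullet> b = b \<bullet> (H *\<^sub>v b)" using H b by (intro comm_scalar_prod) auto
        finally show ?thesis .
      qed
      ultimately show "\<mu> * (y \<bullet> y) \<le> y \<bullet> (G *\<^sub>v y)" using min[OF b] by simp
    qed
  qed
qed

text \<open>
Ky Fan's minimum principle. Let \<open>c j\<close> be the squared length of the projection of the \<open>j\<close>-th column of
\<open>V\<close> onto the span of \<open>U\<close>. The trace of \<open>G\<close> over \<open>U\<close> is at least
\<open>\<Sum>j. ds ! j * c j + \<mu> (p - \<Sum>j. c j)\<close>: the part of \<open>U\<close> in the span of \<open>V\<close> is weighted by the eigenvalues,
the rest by at least \<open>\<mu>\<close>. Since \<open>c j \<le> 1\<close> (Bessel) and \<open>ds ! j \<le> \<mu>\<close>, this is at least \<open>\<Sum>j. ds ! j\<close>.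
\<close>

lemma smallest_eigenvectors_minimize_trace:
  fixes G :: "real mat"
  assumes G: "G \<in> carrier_mat q q" and sym: "G\<^sup>T = G" and V: "smallest_eigenvectors G p V"
    and U: "orthonormal_cols q p U"
  shows "(\<Sum>j<p. col V j \<bullet> (G *\<^sub>v col V j)) \<le> (\<Sum>j<p. col U j \<bullet> (G *\<^sub>v col U j))"
proof -
  obtain es ds where cp: "char_poly G = (\<Prod>e\<leftarrow>es. [:- e, 1:])" and sorted: "sorted es"
    and ds: "mset ds = mset (take p es)" and evs: "\<And>j. j < p \<Longrightarrow> eigenvector G (col V j) (ds ! j)"
    and Von: "orthonormal_cols q p V"
    using V G by (auto simp: smallest_eigenvectors_def orthonormal_cols_def)
  note Vc = orthonormal_cols_carrier[OF Von] and Uc = orthonormal_cols_carrier[OF U]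
  have pq: "p \<le> q" by (rule orthonormal_cols_le[OF Von])
  have "degree (\<Prod>e\<leftarrow>es. [:- e, 1:]) = length es" by (rule degree_linear_factors)
  then have "length es = q" using degree_monic_char_poly[OF G] cp by simp
  then have len: "length ds = p" using mset_eq_length[OF ds] pq by simp
  have ev: "G *\<^sub>v col V j = ds ! j \<cdot>\<^sub>v col V j" if "j < p" for j
    using evs[OF that] by (simp add: eigenvector_def)
  obtain \<mu> where mu: "\<And>j. j < p \<Longrightarrow> ds ! j \<le> \<mu>"
    and gap: "\<And>y. y \<in> carrier_vec q \<Longrightarrow> V\<^sup>T *\<^sub>v y = 0\<^sub>v p \<Longrightarrow> \<mu> * (y \<bullet> y) \<le> y \<bullet> (G *\<^sub>v y)"
    using eigenvalue_gap_on_complement[OF G sym Von cp sorted ds len ev] by blast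
  have lower: "(\<Sum>j<p. ds ! j * (col V j \<bullet> u)\<^sup>2) + \<mu> * (u \<bullet> u - (\<Sum>j<p. (col V j \<bullet> u)\<^sup>2)) \<le> u \<bullet> (G *\<^sub>v u)"
    if u: "u \<in> carrier_vec q" for u
  proof -
    define a where "a = V\<^sup>T *\<^sub>v u"
    have a: "a \<in> carrier_vec p" using Vc u by (auto simp: a_def)
    have aj: "a $ j = col V j \<bullet> u" if "j < p" for j using Vc that by (simp add: a_def)
    obtain y where y: "y \<in> carrier_vec q" and uy: "u = V *\<^sub>v a + y" and Vy: "V\<^sup>T *\<^sub>v y = 0\<^sub>v p"
      and uu: "u \<bullet> u = a \<bullet> a + y \<bullet> y"
      using orthonormal_pythagoras[OF Von u] unfolding a_def by blast
    define w where "w = V *\<^sub>v a"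
    have w: "w \<in> carrier_vec q" using Vc a by (auto simp: w_def)
    have Gw: "G *\<^sub>v w \<in> carrier_vec q" and Gy: "G *\<^sub>v y \<in> carrier_vec q" using G w y by auto
    have zGw: "z \<bullet> (G *\<^sub>v w) = (\<Sum>j<p. ds ! j * ((V\<^sup>T *\<^sub>v z) $ j * a $ j))" if z: "z \<in> carrier_vec q" for z
    proof -
      have Gz: "G *\<^sub>v z \<in> carrier_vec q" using G z by auto
      have "z \<bullet> (G *\<^sub>v w) = (G *\<^sub>v z) \<bullet> (V *\<^sub>v a)"
        using symmetric_scalar_prod_swap[OF G sym z w] by (simp add: w_def)
      also have "\<dots> = (V\<^sup>T *\<^sub>v (G *\<^sub>v z)) \<bullet> a" using transpose_vec_mult_scalar[OF Vc a Gz] by simp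
      also have "\<dots> = (\<Sum>j<p. (V\<^sup>T *\<^sub>v (G *\<^sub>v z)) $ j * a $ j)"
        by (rule scalar_prod_sum[OF mult_mat_vec_carrier[OF transpose_carrier_mat[THEN iffD2, OF Vc] Gz] a])
      also have "\<dots> = (\<Sum>j<p. ds ! j * ((V\<^sup>T *\<^sub>v z) $ j * a $ j))"
      proof (intro sum.cong refl)
        fix j assume "j \<in> {..<p}"
        then have j: "j < p" by simp
        have vj: "col V j \<in> carrier_vec q" using Vc j by auto
        have "(V\<^sup>T *\<^sub>v (G *\<^sub>v z)) $ j = (G *\<^sub>v col V j) \<bullet> z"
          using Vc j symmetric_scalar_prod_swap[OF G sym vj z] by simp
        also have "\<dots> = ds ! j * (V\<^sup>T *\<^sub>v z) $ j" using ev[OF j] vj z Vc j by simp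
        finally show "(V\<^sup>T *\<^sub>v (G *\<^sub>v z)) $ j * a $ j = ds ! j * ((V\<^sup>T *\<^sub>v z) $ j * a $ j)" by simp
      qed
      finally show ?thesis .
    qed
    have 1: "w \<bullet> (G *\<^sub>v w) = (\<Sum>j<p. ds ! j * (a $ j)\<^sup>2)"
      unfolding zGw[OF w] unfolding w_def orthonormal_cols_transpose_mult_vec[OF Von a] by (simp add: power2_eq_square)
    have 2: "y \<bullet> (G *\<^sub>v w) = 0" unfolding zGw[OF y] Vy by simp
    have 3: "w \<bullet> (G *\<^sub>v y) = 0"
      using symmetric_scalar_prod_swap[OF G sym w y] comm_scalar_prod[OF Gw y] 2 by simp
    have "G *\<^sub>v u = G *\<^sub>v w + G *\<^sub>v y" unfolding uy w_def[symmetric] by (rule mult_add_distrib_mat_vec[OF G w y])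
    then have "u \<bullet> (G *\<^sub>v u) = (w + y) \<bullet> (G *\<^sub>v w + G *\<^sub>v y)" using uy w_def by simp
    also have "\<dots> = (\<Sum>j<p. ds ! j * (a $ j)\<^sup>2) + y \<bullet> (G *\<^sub>v y)"
      using w y Gw Gy 1 2 3 by (simp add: add_scalar_prod_distrib[of _ q] scalar_prod_add_distrib[of _ q])
    finally have "u \<bullet> (G *\<^sub>v u) = (\<Sum>j<p. ds ! j * (a $ j)\<^sup>2) + y \<bullet> (G *\<^sub>v y)" .
    moreover have "y \<bullet> y = u \<bullet> u - (\<Sum>j<p. (a $ j)\<^sup>2)"
      using uu scalar_prod_sum[OF a a] by (simp add: power2_eq_square)
    ultimately show ?thesis using gap[OF y Vy] aj by simp
  qed
  define c where "c j = (\<Sum>i<p. (col V j \<bullet> col U i)\<^sup>2)" for j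
  have c_le: "c j \<le> 1" if j: "j < p" for j
  proof -
    have vj: "col V j \<in> carrier_vec q" "col V j \<bullet> col V j = 1"
      using Vc j Von orthonormal_cols_iff[OF Vc] by auto
    obtain y where uu: "col V j \<bullet> col V j = (U\<^sup>T *\<^sub>v col V j) \<bullet> (U\<^sup>T *\<^sub>v col V j) + y \<bullet> y"
      using orthonormal_pythagoras[OF U vj(1)] by blast
    have "(U\<^sup>T *\<^sub>v col V j) \<bullet> (U\<^sup>T *\<^sub>v col V j) = c j"
    proof -
      have "(U\<^sup>T *\<^sub>v col V j) $ i = col V j \<bullet> col U i" if "i < p" for i
      proof -
        have "(U\<^sup>T *\<^sub>v col V j) $ i = col U i \<bullet> col V j" using Uc that by simp
        also have "\<dots> = col V j \<bullet> col U i" using Uc vj that by (intro comm_scalar_prod[of _ q]) auto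
        finally show ?thesis .
      qed
      then show ?thesis unfolding c_def
        by (subst scalar_prod_sum[of _ p]) (use Uc vj in \<open>auto simp: power2_eq_square\<close>)
    qed
    then show ?thesis using uu vj(2) real_scalar_prod_nonneg[of y] by simp
  qed
  have vGv: "col V j \<bullet> (G *\<^sub>v col V j) = ds ! j" if j: "j < p" for j
  proof -
    have "col V j \<in> carrier_vec q" "col V j \<bullet> col V j = 1"
      using Vc j Von orthonormal_cols_iff[OF Vc] by auto
    then show ?thesis using ev[OF j] by simp
  qed
  have "(\<Sum>j<p. col V j \<bullet> (G *\<^sub>v col V j)) = (\<Sum>j<p. ds ! j)" using vGv by simp
  also have "\<dots> \<le> (\<Sum>j<p. ds ! j + (\<mu> - ds ! j) * (1 - c j))"
    using mu c_le by (intro sum_mono) simp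
  also have "\<dots> = (\<Sum>j<p. ds ! j * c j) + \<mu> * (real p - (\<Sum>j<p. c j))"
    by (simp add: algebra_simps sum.distrib sum_subtractf sum_distrib_left)
  also have "\<dots> = (\<Sum>i<p. (\<Sum>j<p. ds ! j * (col V j \<bullet> col U i)\<^sup>2) + \<mu> * (col U i \<bullet> col U i - (\<Sum>j<p. (col V j \<bullet> col U i)\<^sup>2)))"
  proof -
    have "(\<Sum>i<p. col U i \<bullet> col U i) = real p" using U orthonormal_cols_iff[OF Uc] by simp
    moreover have "(\<Sum>j<p. ds ! j * c j) = (\<Sum>i<p. \<Sum>j<p. ds ! j * (col V j \<bullet> col U i)\<^sup>2)"
      unfolding c_def sum_distrib_left by (rule sum.swap)
    moreover have "(\<Sum>j<p. c j) = (\<Sum>i<p. \<Sum>j<p. (col V j \<bullet> col U i)\<^sup>2)"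
      unfolding c_def by (rule sum.swap)
    ultimately show ?thesis by (simp add: sum.distrib sum_subtractf flip: sum_distrib_left)
  qed
  also have "\<dots> \<le> (\<Sum>i<p. col U i \<bullet> (G *\<^sub>v col U i))"
    by (intro sum_mono lower) (use Uc in auto)
  finally show ?thesis .
qed

section \<open>The spectral norm and the set of orthonormal bases\<close>

lemma vec_norm2_eq_L2_set: "vec_norm2 v = L2_set (\<lambda>i. v $ i) {..<dim_vec v}"
  by (simp add: vec_norm2_def L2_set_def scalar_prod_def power2_eq_square atLeast0LessThan)

lemma vec_norm2_triangle:
  assumes "x \<in> carrier_vec m" "y \<in> carrier_vec m"
  shows "vec_norm2 (x + y) \<le> vec_norm2 x + vec_norm2 y"
proof -
  have "vec_norm2 (x + y) = L2_set (\<lambda>i. x $ i + y $ i) {..<m}"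
    unfolding vec_norm2_eq_L2_set using assms by (auto intro!: L2_set_cong)
  then show ?thesis using L2_set_triangle_ineq[of "($) x" "($) y" "{..<m}"] assms
    by (simp add: vec_norm2_eq_L2_set)
qed

lemma vec_norm2_mult_le_frobenius:
  assumes A: "A \<in> carrier_mat m n" and v: "v \<in> carrier_vec n"
  shows "vec_norm2 (A *\<^sub>v v) \<le> frobenius_norm A * vec_norm2 v"
proof -
  have vv: "v \<bullet> v = (\<Sum>j<n. (v $ j)\<^sup>2)" using scalar_prod_sum[OF v v] by (simp add: power2_eq_square)
  have Av: "A *\<^sub>v v \<in> carrier_vec m" using A v by auto
  have "(A *\<^sub>v v) \<bullet> (A *\<^sub>v v) = (\<Sum>i<m. (\<Sum>j<n. A $$ (i, j) * v $ j)\<^sup>2)"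
    unfolding scalar_prod_sum[OF Av Av]
  proof (intro sum.cong refl)
    fix i assume "i \<in> {..<m}"
    then have "(A *\<^sub>v v) $ i = (\<Sum>j<n. A $$ (i, j) * v $ j)" using mult_mat_vec_nth_sum[OF A v] by simp
    then show "(A *\<^sub>v v) $ i * (A *\<^sub>v v) $ i = (\<Sum>j<n. A $$ (i, j) * v $ j)\<^sup>2" by (simp add: power2_eq_square)
  qed
  also have "\<dots> \<le> (\<Sum>i<m. (\<Sum>j<n. (A $$ (i, j))\<^sup>2) * (\<Sum>j<n. (v $ j)\<^sup>2))"
    by (intro sum_mono Cauchy_Schwarz_ineq_sum)
  also have "\<dots> = (\<Sum>i<m. \<Sum>j<n. (A $$ (i, j))\<^sup>2) * (v \<bullet> v)" by (simp add: vv sum_distrib_right)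
  finally have "sqrt ((A *\<^sub>v v) \<bullet> (A *\<^sub>v v)) \<le> sqrt ((\<Sum>i<m. \<Sum>j<n. (A $$ (i, j))\<^sup>2) * (v \<bullet> v))"
    by (rule real_sqrt_le_mono)
  then show ?thesis using A by (simp add: vec_norm2_def frobenius_norm_def real_sqrt_mult)
qed

lemma frobenius_norm_nonneg: "0 \<le> frobenius_norm A"
  by (simp add: frobenius_norm_def sum_nonneg)

lemma vec_norm2_mult_unit_ball:
  assumes "A \<in> carrier_mat m n" "v \<in> carrier_vec n" "vec_norm2 v \<le> 1"
  shows "vec_norm2 (A *\<^sub>v v) \<le> frobenius_norm A"
  using vec_norm2_mult_le_frobenius[OF assms(1,2)] mult_left_mono[OF assms(3) frobenius_norm_nonneg[of A]] by simp

lemma spectral_norm_upper: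
  assumes A: "A \<in> carrier_mat m n" and v: "v \<in> carrier_vec n" "vec_norm2 v \<le> 1"
  shows "vec_norm2 (A *\<^sub>v v) \<le> spectral_norm A"
  unfolding spectral_norm_def
proof (rule cSUP_upper)
  show "bdd_above ((\<lambda>v. vec_norm2 (A *\<^sub>v v)) ` {v \<in> carrier_vec (dim_col A). vec_norm2 v \<le> 1})"
    using A vec_norm2_mult_unit_ball[OF A] by (auto intro!: bdd_aboveI2[where M = "frobenius_norm A"])
qed (use A v in auto)

lemma spectral_norm_least:
  assumes A: "A \<in> carrier_mat m n"
    and le: "\<And>v. v \<in> carrier_vec n \<Longrightarrow> vec_norm2 v \<le> 1 \<Longrightarrow> vec_norm2 (A *\<^sub>v v) \<le> B"
  shows "spectral_norm A \<le> B"
  unfolding spectral_norm_def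
proof (rule cSUP_least)
  have "0\<^sub>v n \<in> {v \<in> carrier_vec (dim_col A). vec_norm2 v \<le> 1}" using A by (simp add: vec_norm2_def)
  then show "{v \<in> carrier_vec (dim_col A). vec_norm2 v \<le> 1} \<noteq> {}" by blast
qed (use A le in auto)

lemma spectral_norm_nonneg:
  assumes A: "A \<in> carrier_mat m n"
  shows "0 \<le> spectral_norm A"
proof -
  have "0 \<le> vec_norm2 (A *\<^sub>v 0\<^sub>v n)" by (simp add: vec_norm2_def real_scalar_prod_nonneg)
  also have "\<dots> \<le> spectral_norm A" by (rule spectral_norm_upper[OF A]) (auto simp: vec_norm2_def)
  finally show ?thesis .
qed

lemma spectral_norm_le_add_frobenius:
  assumes A: "A \<in> carrier_mat m n" and B: "B \<in> carrier_mat m n"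
  shows "spectral_norm A \<le> spectral_norm B + frobenius_norm (A - B)"
proof (rule spectral_norm_least[OF A])
  fix v :: "real vec" assume v: "v \<in> carrier_vec n" "vec_norm2 v \<le> 1"
  have AB: "A - B \<in> carrier_mat m n" using B by (rule minus_carrier_mat)
  have c: "B *\<^sub>v v \<in> carrier_vec m" "(A - B) *\<^sub>v v \<in> carrier_vec m" using A B AB v by auto
  have "(A - B) *\<^sub>v v = A *\<^sub>v v - B *\<^sub>v v" by (rule minus_mult_distrib_mat_vec[OF A B v(1)])
  then have "A *\<^sub>v v = B *\<^sub>v v + (A - B) *\<^sub>v v" using A B v by (intro eq_vecI) auto
  then have "vec_norm2 (A *\<^sub>v v) \<le> vec_norm2 (B *\<^sub>v v) + vec_norm2 ((A - B) *\<^sub>v v)"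
    using vec_norm2_triangle[OF c] by simp
  also have "\<dots> \<le> spectral_norm B + frobenius_norm (A - B)"
    by (rule add_mono[OF spectral_norm_upper[OF B v] vec_norm2_mult_unit_ball[OF AB v]])
  finally show "vec_norm2 (A *\<^sub>v v) \<le> spectral_norm B + frobenius_norm (A - B)" .
qed

text \<open>
This makes the spectral norm continuous with respect to entrywise convergence.
\<close>

lemma spectral_norm_diff_le:
  assumes A: "A \<in> carrier_mat m n" and B: "B \<in> carrier_mat m n"
  shows "\<bar>spectral_norm A - spectral_norm B\<bar> \<le> frobenius_norm (A - B)"
proof -
  have "frobenius_norm (B - A) = frobenius_norm (A - B)"
    using A B by (auto simp: frobenius_norm_def power2_commute intro!: arg_cong[where f = sqrt] sum.cong)
  then show ?thesis using spectral_norm_le_add_frobenius[OF A B] spectral_norm_le_add_frobenius[OF B A] by linarith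
qed

lemma spectral_norm_tendsto:
  assumes X: "\<And>k. X k \<in> carrier_mat m n" and L: "L \<in> carrier_mat m n" and lim: "mat_tendsto X L"
  shows "(\<lambda>k. spectral_norm (X k)) \<longlonglongrightarrow> spectral_norm L"
proof -
  have frob: "frobenius_norm (X k - L) = sqrt (\<Sum>i<m. \<Sum>j<n. (X k $$ (i, j) - L $$ (i, j))\<^sup>2)" for k
    using X[of k] L by (auto simp: frobenius_norm_def intro!: arg_cong[where f = sqrt] sum.cong)
  have "(\<lambda>k. frobenius_norm (X k - L)) \<longlonglongrightarrow> sqrt (\<Sum>i<m. \<Sum>j<n. (L $$ (i, j) - L $$ (i, j))\<^sup>2)"
    unfolding frob by (intro tendsto_intros mat_tendstoD[OF lim L]) auto
  then have F: "(\<lambda>k. frobenius_norm (X k - L)) \<longlonglongrightarrow> 0" by simp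
  have "(\<lambda>k. spectral_norm (X k) - spectral_norm L) \<longlonglongrightarrow> 0"
    by (rule Lim_null_comparison[OF _ F]) (use spectral_norm_diff_le[OF X L] in simp)
  then show ?thesis by (simp add: LIM_zero_iff)
qed

lemma mat_tendsto_diff:
  assumes X: "\<And>k. X k \<in> carrier_mat m n" and L: "L \<in> carrier_mat m n" and lim: "mat_tendsto X L"
    and Y: "\<And>k. Y k \<in> carrier_mat m n" and K: "K \<in> carrier_mat m n" and limY: "mat_tendsto Y K"
  shows "mat_tendsto (\<lambda>k. X k - Y k) (L - K)"
  unfolding mat_tendsto_def
proof (intro conjI allI impI)
  fix i j assume "i < dim_row (L - K)" "j < dim_col (L - K)"
  then have ij: "i < m" "j < n" using K by auto
  have "(X k - Y k) $$ (i, j) = X k $$ (i, j) - Y k $$ (i, j)" for k using X[of k] Y[of k] ij by simp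
  then show "(\<lambda>k. (X k - Y k) $$ (i, j)) \<longlonglongrightarrow> (L - K) $$ (i, j)"
    using L K ij tendsto_diff[OF mat_tendstoD[OF lim L ij] mat_tendstoD[OF limY K ij]] by simp
qed (use Y K in \<open>auto intro!: always_eventually minus_carrier_mat\<close>)

lemma mat_tendsto_const: "mat_tendsto (\<lambda>_. L) L"
  by (simp add: mat_tendsto_def)

lemma mat_tendsto_mult_left:
  assumes A: "A \<in> carrier_mat m n" and X: "\<And>k. X k \<in> carrier_mat n p" and L: "L \<in> carrier_mat n p"
    and lim: "mat_tendsto X L"
  shows "mat_tendsto (\<lambda>k. A * X k) (A * L)"
  unfolding mat_tendsto_def
proof (intro conjI allI impI)
  fix i j assume "i < dim_row (A * L)" "j < dim_col (A * L)"
  then have ij: "i < m" "j < p" using A L by auto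
  show "(\<lambda>k. (A * X k) $$ (i, j)) \<longlonglongrightarrow> (A * L) $$ (i, j)"
    unfolding mult_mat_nth_sum[OF A X ij] mult_mat_nth_sum[OF A L ij]
    by (intro tendsto_intros mat_tendstoD[OF lim L]) (use ij in auto)
qed (use A X L in \<open>auto intro!: always_eventually\<close>)

lemma col_in_mat_range:
  assumes A: "A \<in> carrier_mat m n" and j: "j < n"
  shows "col A j \<in> mat_range A"
  unfolding mat_range_eq[OF A]
  by (intro CollectI exI conjI, rule mult_unit_vec_eq_col[OF A j, symmetric], rule unit_vec_carrier)

lemma mat_range_mult:
  fixes A B :: "real mat"
  assumes A: "A \<in> carrier_mat m n" and B: "B \<in> carrier_mat n p"
  shows "mat_range (A * B) = (\<lambda>v. A *\<^sub>v v) ` mat_range B"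
proof -
  have AB: "A * B \<in> carrier_mat m p" using A B by simp
  have "(A * B) *\<^sub>v x = A *\<^sub>v (B *\<^sub>v x)" if "x \<in> carrier_vec p" for x using A B that by simp
  then have "(\<lambda>x. (A * B) *\<^sub>v x) ` carrier_vec p = (\<lambda>x. A *\<^sub>v (B *\<^sub>v x)) ` carrier_vec p"
    by (rule image_cong[OF refl])
  then show ?thesis unfolding mat_range_eq[OF AB] mat_range_eq[OF B] setcompr_eq_image
    by (simp add: image_image)
qed

lemma orthonormal_cols_mult:
  assumes P: "orthonormal_cols n q P" and V: "orthonormal_cols q p V"
  shows "orthonormal_cols n p (P * V)"
proof -
  note Pc = orthonormal_cols_carrier[OF P] and Vc = orthonormal_cols_carrier[OF V]
  have PtP: "P\<^sup>T * P = 1\<^sub>m q" and VtV: "V\<^sup>T * V = 1\<^sub>m p" using P V by (auto simp: orthonormal_cols_def)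
  have "(P * V)\<^sup>T * (P * V) = V\<^sup>T * P\<^sup>T * (P * V)" using transpose_mult[OF Pc Vc] by simp
  also have "\<dots> = V\<^sup>T * (P\<^sup>T * (P * V))" by (rule assoc_mult_mat[of _ p q _ n _ p]) (use Pc Vc in auto)
  also have "P\<^sup>T * (P * V) = (P\<^sup>T * P) * V" by (rule assoc_mult_mat[symmetric, of _ q n _ q _ p]) (use Pc Vc in auto)
  also have "V\<^sup>T * (P\<^sup>T * P * V) = 1\<^sub>m p" using PtP VtV Vc by simp
  finally show ?thesis using Pc Vc by (simp add: orthonormal_cols_def)
qed

text \<open>
Containment of ranges as an equation between matrices, a form that survives entrywise limits.
\<close>

lemma range_subset_iff_projection:
  assumes W: "orthonormal_cols n p W" and Z: "Z \<in> carrier_mat n s"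
  shows "mat_range Z \<subseteq> mat_range W \<longleftrightarrow> W * (W\<^sup>T * Z) = Z"
proof -
  note Wc = orthonormal_cols_carrier[OF W]
  have WtZ: "W\<^sup>T * Z \<in> carrier_mat p s" using Wc Z by simp
  show ?thesis
  proof
    assume sub: "mat_range Z \<subseteq> mat_range W"
    show "W * (W\<^sup>T * Z) = Z"
    proof (rule mat_col_eqI)
      fix j assume "j < dim_col Z"
      then have j: "j < s" using Z by simp
      have "col Z j \<in> mat_range Z" by (rule col_in_mat_range[OF Z j])
      then obtain a where a: "a \<in> carrier_vec p" "col Z j = W *\<^sub>v a" using sub mat_range_eq[OF Wc] by auto
      have "col (W * (W\<^sup>T * Z)) j = W *\<^sub>v col (W\<^sup>T * Z) j" by (rule col_mult2[OF Wc WtZ j])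
      also have "col (W\<^sup>T * Z) j = W\<^sup>T *\<^sub>v col Z j" by (rule col_mult2[OF _ Z j]) (use Wc in simp)
      also have "\<dots> = a" unfolding a(2) by (rule orthonormal_cols_transpose_mult_vec[OF W a(1)])
      finally show "col (W * (W\<^sup>T * Z)) j = col Z j" using a by simp
    qed (use Wc Z in auto)
  next
    assume eq: "W * (W\<^sup>T * Z) = Z"
    have "mat_range Z = (\<lambda>v. W *\<^sub>v v) ` mat_range (W\<^sup>T * Z)" using mat_range_mult[OF Wc WtZ] eq by simp
    then show "mat_range Z \<subseteq> mat_range W" using mat_range_eq[OF Wc] mat_range_eq[OF WtZ] WtZ by auto
  qed
qed

definition orthonormal_bases :: "nat \<Rightarrow> nat \<Rightarrow> real vec set \<Rightarrow> real mat set" where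
  "orthonormal_bases n p R = {Z. orthonormal_cols n p Z \<and> mat_range Z = R}"

lemma orthonormal_bases_limit:
  assumes W: "orthonormal_cols n p W" and X: "\<And>k. X k \<in> orthonormal_bases n p (mat_range W)"
    and L: "L \<in> carrier_mat n p" and lim: "mat_tendsto X L"
  shows "L \<in> orthonormal_bases n p (mat_range W)"
proof -
  note Wc = orthonormal_cols_carrier[OF W]
  have Xo: "orthonormal_cols n p (X k)" and Xr: "mat_range (X k) = mat_range W" for k
    using X[of k] by (auto simp: orthonormal_bases_def)
  note Xc = orthonormal_cols_carrier[OF Xo]
  have Lo: "orthonormal_cols n p L" by (rule orthonormal_cols_limit[OF Xo L lim])
  have eq: "W * (W\<^sup>T * X k) = X k" for k using range_subset_iff_projection[OF W Xc] Xr by simp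
  have "mat_tendsto (\<lambda>k. W * (W\<^sup>T * X k)) (W * (W\<^sup>T * L))"
    by (intro mat_tendsto_mult_left[OF Wc] mat_tendsto_mult_left[of _ p n]) (use Wc Xc L lim in auto)
  then have lim': "mat_tendsto X (W * (W\<^sup>T * L))" by (simp add: eq)
  have WL: "W * (W\<^sup>T * L) \<in> carrier_mat n p" using Wc L by simp
  have "W * (W\<^sup>T * L) = L"
  proof (rule eq_matI)
    fix i j assume "i < dim_row L" "j < dim_col L"
    then have ij: "i < n" "j < p" using L by auto
    show "(W * (W\<^sup>T * L)) $$ (i, j) = L $$ (i, j)"
      by (rule LIMSEQ_unique[OF mat_tendstoD[OF lim' WL ij] mat_tendstoD[OF lim L ij]])
  qed (simp_all only: carrier_matD[OF WL] carrier_matD[OF L])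
  then have "mat_range L \<subseteq> mat_range W" using range_subset_iff_projection[OF W L] by simp
  then have "mat_range L = mat_range W"
    by (intro range_eq_if_injective_subset[OF L W]) (use orthonormal_cols_inj[OF Lo] in auto)
  with Lo show ?thesis by (simp add: orthonormal_bases_def)
qed

lemma nearest_orthonormal_basis_exists:
  assumes W: "orthonormal_cols n p W" and Y: "Y \<in> carrier_mat n p"
  shows "\<exists>d. is_minimum ((\<lambda>Z. spectral_norm (Y - Z)) ` orthonormal_bases n p (mat_range W)) d"
proof -
  let ?S = "orthonormal_bases n p (mat_range W)"
  obtain Z where "Z \<in> ?S" "\<And>Z'. Z' \<in> ?S \<Longrightarrow> spectral_norm (Y - Z) \<le> spectral_norm (Y - Z')"
  proof (rule sequentially_compact_attains_min[of ?S n p 1 "\<lambda>Z. spectral_norm (Y - Z)"])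
    show "?S \<noteq> {}" using W by (auto simp: orthonormal_bases_def)
    show S_sub: "?S \<subseteq> carrier_mat n p" by (auto simp: orthonormal_bases_def orthonormal_cols_carrier)
    show "\<bar>X $$ (i, j)\<bar> \<le> 1" if "X \<in> ?S" "i < n" "j < p" for X i j
      using that by (auto simp: orthonormal_bases_def intro: orthonormal_cols_entry_le)
    show "L \<in> ?S" if "\<And>k. X k \<in> ?S" "L \<in> carrier_mat n p" "mat_tendsto X L" for X L
      by (rule orthonormal_bases_limit[OF W that])
    show "(\<lambda>k. spectral_norm (Y - X k)) \<longlonglongrightarrow> spectral_norm (Y - L)"
      if X: "\<And>k. X k \<in> ?S" "L \<in> ?S" "mat_tendsto X L" for X L
    proof (rule spectral_norm_tendsto)
      have Xc: "X k \<in> carrier_mat n p" for k using X(1)[of k] S_sub by blast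
      have Lc: "L \<in> carrier_mat n p" using X(2) S_sub by blast
      show "Y - X k \<in> carrier_mat n p" for k using Xc by (rule minus_carrier_mat)
      show "Y - L \<in> carrier_mat n p" using Lc by (rule minus_carrier_mat)
      show "mat_tendsto (\<lambda>k. Y - X k) (Y - L)"
        by (rule mat_tendsto_diff[OF Y Y mat_tendsto_const Xc Lc X(3)])
    qed
  qed blast
  then show ?thesis by (auto simp: is_minimum_def)
qed

text \<open>
Ky Fan's principle compares \<open>V k\<close> with the fixed family \<open>U\<close>, whose form tends to \<open>c p\<close> because \<open>T\<close>
vanishes on it. The form of the limit \<open>L\<close> is \<open>\<Sum>j. L\<^sub>j \<bullet> (T L\<^sub>j) + c p\<close>, so the nonnegative sum must be
\<open>0\<close>.
\<close>

lemma smallest_eigenvectors_limit: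
  fixes G V :: "nat \<Rightarrow> real mat" and T U L :: "real mat"
  assumes G: "\<And>k. G k \<in> carrier_mat q q" "\<And>k. (G k)\<^sup>T = G k" and s: "\<And>k. 0 \<le> s k"
    and T: "T \<in> carrier_mat q q" "T\<^sup>T = T" "\<And>y. y \<in> carrier_vec q \<Longrightarrow> 0 \<le> y \<bullet> (T *\<^sub>v y)"
    and lim: "mat_tendsto (\<lambda>k. s k \<cdot>\<^sub>m G k) (T + c \<cdot>\<^sub>m 1\<^sub>m q)"
    and V: "\<And>k. smallest_eigenvectors (G k) p (V k)"
    and U: "orthonormal_cols q p U" "mat_range U \<subseteq> mat_kernel T"
    and L: "L \<in> carrier_mat q p" "mat_tendsto V L"
  shows "orthonormal_cols q p L" and "mat_range L \<subseteq> mat_kernel T"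
proof -
  note Uc = orthonormal_cols_carrier[OF U(1)]
  have Vo: "orthonormal_cols q p (V k)" for k
    using V[of k] G(1)[of k] by (auto simp: smallest_eigenvectors_def orthonormal_cols_def)
  note Vc = orthonormal_cols_carrier[OF Vo]
  show Lo: "orthonormal_cols q p L" by (rule orthonormal_cols_limit[OF Vo L])
  define T' where "T' = T + c \<cdot>\<^sub>m 1\<^sub>m q"
  have T': "T' \<in> carrier_mat q q" using T by (simp add: T'_def)
  have sG: "s k \<cdot>\<^sub>m G k \<in> carrier_mat q q" for k using G by simp
  have quad_s: "v \<bullet> ((s k \<cdot>\<^sub>m G k) *\<^sub>v v) = s k * (v \<bullet> (G k *\<^sub>v v))" if v: "v \<in> carrier_vec q" for v k
  proof -
    have "G k *\<^sub>v v \<in> carrier_vec q" using G(1)[of k] v by auto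
    then show ?thesis using smult_mat_mult_vec[OF G(1) v] v by simp
  qed
  have quad_T': "v \<bullet> (T' *\<^sub>v v) = v \<bullet> (T *\<^sub>v v) + c * (v \<bullet> v)" if v: "v \<in> carrier_vec q" for v
  proof -
    have Tv: "T *\<^sub>v v \<in> carrier_vec q" using T v by auto
    have "T' *\<^sub>v v = T *\<^sub>v v + c \<cdot>\<^sub>v v"
      unfolding T'_def using T v smult_mat_mult_vec[of "1\<^sub>m q" q q v c]
      by (subst add_mult_distrib_mat_vec[of _ q q]) auto
    then show ?thesis using v Tv by (simp add: scalar_prod_add_distrib[of _ q])
  qed
  have cols: "col X j \<in> carrier_vec q" "col X j \<bullet> col X j = 1" if "orthonormal_cols q p X" "j < p" for X j
    using that orthonormal_cols_iff[OF orthonormal_cols_carrier[OF that(1)]] orthonormal_cols_carrier[OF that(1)] by auto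
  have "(\<lambda>k. \<Sum>j<p. col (V k) j \<bullet> ((s k \<cdot>\<^sub>m G k) *\<^sub>v col (V k) j)) \<longlonglongrightarrow> (\<Sum>j<p. col L j \<bullet> (T' *\<^sub>v col L j))"
    by (intro tendsto_sum quadratic_form_tendsto[OF sG T' _ Vc L])
       (use lim in \<open>auto simp: T'_def\<close>)
  moreover have "(\<lambda>k. \<Sum>j<p. col U j \<bullet> ((s k \<cdot>\<^sub>m G k) *\<^sub>v col U j)) \<longlonglongrightarrow> (\<Sum>j<p. col U j \<bullet> (T' *\<^sub>v col U j))"
    by (intro tendsto_sum quadratic_form_tendsto[OF sG T' _ Uc Uc mat_tendsto_const])
       (use lim in \<open>auto simp: T'_def\<close>)
  moreover have "(\<Sum>j<p. col (V k) j \<bullet> ((s k \<cdot>\<^sub>m G k) *\<^sub>v col (V k) j)) \<le> (\<Sum>j<p. col U j \<bullet> ((s k \<cdot>\<^sub>m G k) *\<^sub>v col U j))" for k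
  proof -
    have "s k * (\<Sum>j<p. col (V k) j \<bullet> (G k *\<^sub>v col (V k) j)) \<le> s k * (\<Sum>j<p. col U j \<bullet> (G k *\<^sub>v col U j))"
      by (intro mult_left_mono smallest_eigenvectors_minimize_trace[OF G V U(1)] s)
    then show ?thesis by (simp add: quad_s[OF cols(1)[OF Vo]] quad_s[OF cols(1)[OF U(1)]] sum_distrib_left)
  qed
  ultimately have le: "(\<Sum>j<p. col L j \<bullet> (T' *\<^sub>v col L j)) \<le> (\<Sum>j<p. col U j \<bullet> (T' *\<^sub>v col U j))"
    by (intro LIMSEQ_le) auto
  have "T *\<^sub>v col U j = 0\<^sub>v q" if "j < p" for j
  proof -
    have "col U j \<in> mat_range U" by (rule col_in_mat_range[OF Uc that])
    then show ?thesis using U(2) mat_kernelD[OF T(1)] by blast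
  qed
  then have "(\<Sum>j<p. col U j \<bullet> (T' *\<^sub>v col U j)) = c * real p"
    using cols[OF U(1)] by (simp add: quad_T')
  moreover have "(\<Sum>j<p. col L j \<bullet> (T' *\<^sub>v col L j)) = (\<Sum>j<p. col L j \<bullet> (T *\<^sub>v col L j)) + c * real p"
    using cols[OF Lo] by (simp add: quad_T' sum.distrib)
  ultimately have "(\<Sum>j<p. col L j \<bullet> (T *\<^sub>v col L j)) \<le> 0" using le by simp
  moreover have nn: "0 \<le> col L j \<bullet> (T *\<^sub>v col L j)" if "j < p" for j using T(3) cols(1)[OF Lo that] by simp
  ultimately have "(\<Sum>j<p. col L j \<bullet> (T *\<^sub>v col L j)) = 0"
    by (intro antisym sum_nonneg) auto
  then have 0: "col L j \<bullet> (T *\<^sub>v col L j) = 0" if "j < p" for j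
    using sum_nonneg_eq_0_iff[of "{..<p}" "\<lambda>j. col L j \<bullet> (T *\<^sub>v col L j)"] nn that by simp
  have "T *\<^sub>v col L j = 0\<^sub>v q" if "j < p" for j
    by (rule psd_null_vector[OF T cols(1)[OF Lo that] 0[OF that]])
  then have TL: "T * L = 0\<^sub>m q p" by (rule mult_eq_0_if_cols[OF T(1) L(1)])
  show "mat_range L \<subseteq> mat_kernel T"
  proof
    fix z assume "z \<in> mat_range L"
    then obtain x where x: "x \<in> carrier_vec p" "z = L *\<^sub>v x" using mat_range_eq[OF L(1)] by auto
    have "T *\<^sub>v z = (T * L) *\<^sub>v x" using T(1) L(1) x by simp
    also have "\<dots> = 0\<^sub>v q" unfolding TL using x by auto
    finally show "z \<in> mat_kernel T" using mat_kernelI[OF T(1)] x L(1) by auto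
  qed
qed

text \<open>
If the distances stayed above some \<open>e > 0\<close> infinitely often, a further subsequence of those \<open>V m\<close> would
converge. The limit is an orthonormal basis of the kernel of \<open>T\<close>, so its image under \<open>P\<close> is one of the
competitors in the minimum, and its distance to \<open>P * V m\<close> tends to \<open>0\<close>.
\<close>

theorem distance_to_kernel_bases_tendsto_0:
  fixes G V :: "nat \<Rightarrow> real mat" and P T U :: "real mat"
  assumes P: "orthonormal_cols n q P"
    and G: "\<And>m. G m \<in> carrier_mat q q" "\<And>m. (G m)\<^sup>T = G m"
    and T: "T \<in> carrier_mat q q" "T\<^sup>T = T" "\<And>y. y \<in> carrier_vec q \<Longrightarrow> 0 \<le> y \<bullet> (T *\<^sub>v y)"
    and lim: "mat_tendsto (\<lambda>m. inverse (real m) \<cdot>\<^sub>m G m) (T + c \<cdot>\<^sub>m 1\<^sub>m q)"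
    and V: "\<And>m. k < m \<Longrightarrow> smallest_eigenvectors (G m) p (V m)"
    and U: "orthonormal_cols q p U" "mat_range U = mat_kernel T"
  shows "\<exists>d. (\<forall>m>k. is_minimum
      ((\<lambda>Z. spectral_norm (P * V m - Z)) ` orthonormal_bases n p (mat_range (P * U))) (d m)) \<and> d \<longlonglongrightarrow> 0"
proof -
  let ?S = "orthonormal_bases n p (mat_range (P * U))"
  note Pc = orthonormal_cols_carrier[OF P] and Uc = orthonormal_cols_carrier[OF U(1)]
  \<comment> \<open>makes the set of competitors nonempty\<close>
  have W: "orthonormal_cols n p (P * U)" by (rule orthonormal_cols_mult[OF P U(1)])
  have Vo: "orthonormal_cols q p (V m)" if "k < m" for m
    using V[OF that] G(1)[of m] by (auto simp: smallest_eigenvectors_def orthonormal_cols_def)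
  note Vc = orthonormal_cols_carrier[OF Vo]
  have PVc: "P * V m \<in> carrier_mat n p" if "k < m" for m using Pc Vc[OF that] by simp
  have "\<forall>m. \<exists>d. k < m \<longrightarrow> is_minimum ((\<lambda>Z. spectral_norm (P * V m - Z)) ` ?S) d"
    using nearest_orthonormal_basis_exists[OF W PVc] by blast
  from choice[OF this] obtain d where
    d: "\<And>m. k < m \<Longrightarrow> is_minimum ((\<lambda>Z. spectral_norm (P * V m - Z)) ` ?S) (d m)" by blast
  have d_nonneg: "0 \<le> d m" if m: "k < m" for m
  proof -
    obtain Z where Z: "Z \<in> ?S" "d m = spectral_norm (P * V m - Z)" using d[OF m] by (auto simp: is_minimum_def)
    then have "P * V m - Z \<in> carrier_mat n p"
      by (intro minus_carrier_mat) (auto simp: orthonormal_bases_def orthonormal_cols_carrier)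
    then show ?thesis using spectral_norm_nonneg Z by simp
  qed
  have "d \<longlonglongrightarrow> 0"
  proof (rule ccontr)
    assume "\<not> d \<longlonglongrightarrow> 0"
    then obtain e where e: "0 < e" "\<not> (\<forall>\<^sub>F m in sequentially. dist (d m) 0 < e)"
      by (auto simp: tendsto_iff)
    \<comment> \<open>\<open>V m\<close> and \<open>d m\<close> are known only for \<open>m > k\<close>\<close>
    have "infinite {m. k < m \<and> e \<le> d m}"
    proof
      assume "finite {m. k < m \<and> e \<le> d m}"
      then obtain B where B: "\<forall>m\<in>{m. k < m \<and> e \<le> d m}. m \<le> B"
        unfolding finite_nat_set_iff_bounded_le by (elim exE)
      have "\<forall>\<^sub>F m in sequentially. dist (d m) 0 < e"
        using eventually_gt_at_top[of "max k B"]
      proof eventually_elim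
        case (elim m)
        then have "k < m" "\<not> m \<le> B" by auto
        then have "d m < e" using B by (auto simp: not_le[symmetric])
        then show ?case using d_nonneg[OF \<open>k < m\<close>] by simp
      qed
      with e show False by blast
    qed
    from infinite_enumerate[OF this] obtain r :: "nat \<Rightarrow> nat"
      where r: "strict_mono r" "\<And>i. k < r i" "\<And>i. e \<le> d (r i)" by auto
    have "(V \<circ> r) i \<in> carrier_mat q p" for i using Vc[OF r(2)] by simp
    moreover have "\<bar>(V \<circ> r) l $$ (i, j)\<bar> \<le> 1" if "i < q" "j < p" for l i j
      using orthonormal_cols_entry_le[OF Vo[OF r(2)] that] by simp
    ultimately obtain r' L where r': "strict_mono r'" "L \<in> carrier_mat q p" "mat_tendsto (V \<circ> r \<circ> r') L"
      using mat_bounded_convergent_subseq[of "V \<circ> r" q p 1] by blast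
    define \<rho> where "\<rho> = r \<circ> r'"
    have rho: "strict_mono \<rho>" "\<And>i. k < \<rho> i" "\<And>i. e \<le> d (\<rho> i)"
      using strict_mono_o[OF r(1) r'(1)] r(2,3) by (auto simp: \<rho>_def)
    have VL: "mat_tendsto (\<lambda>i. V (\<rho> i)) L" using r'(3) by (simp add: \<rho>_def comp_def)
    have lim\<rho>: "mat_tendsto (\<lambda>i. inverse (real (\<rho> i)) \<cdot>\<^sub>m G (\<rho> i)) (T + c \<cdot>\<^sub>m 1\<^sub>m q)"
      using mat_tendsto_subseq[OF lim rho(1)] by (simp add: comp_def)
    have U_sub: "mat_range U \<subseteq> mat_kernel T" using U(2) by simp
    have inv_nonneg: "0 \<le> inverse (real (\<rho> i))" for i by simp
    note L = smallest_eigenvectors_limit[OF G inv_nonneg T lim\<rho> V[OF rho(2)] U(1) U_sub r'(2) VL]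
    have "mat_range L \<subseteq> mat_range U" unfolding U(2) by (rule L(2))
    then have "mat_range L = mat_range U"
      by (rule range_eq_if_injective_subset[OF r'(2) U(1), rotated]) (rule orthonormal_cols_inj[OF L(1)])
    then have PL: "P * L \<in> ?S"
      using orthonormal_cols_mult[OF P L(1)] mat_range_mult[OF Pc r'(2)] mat_range_mult[OF Pc Uc]
      by (simp add: orthonormal_bases_def)
    have PLc: "P * L \<in> carrier_mat n p" using Pc r'(2) by simp
    have PV\<rho>: "P * V (\<rho> i) \<in> carrier_mat n p" for i by (rule PVc[OF rho(2)])
    have "mat_tendsto (\<lambda>i. P * V (\<rho> i)) (P * L)"
      by (rule mat_tendsto_mult_left[OF Pc _ r'(2) VL]) (rule Vc[OF rho(2)])
    then have "mat_tendsto (\<lambda>i. P * V (\<rho> i) - P * L) (P * L - P * L)"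
      by (rule mat_tendsto_diff[OF PV\<rho> PLc _ PLc PLc mat_tendsto_const])
    then have "(\<lambda>i. spectral_norm (P * V (\<rho> i) - P * L)) \<longlonglongrightarrow> spectral_norm (P * L - P * L)"
      by (rule spectral_norm_tendsto[OF minus_carrier_mat[OF PLc] minus_carrier_mat[OF PLc]])
    moreover have "e \<le> spectral_norm (P * V (\<rho> i) - P * L)" for i
    proof -
      have "spectral_norm (P * V (\<rho> i) - P * L) \<in> (\<lambda>Z. spectral_norm (P * V (\<rho> i) - Z)) ` ?S"
        using PL by (rule imageI)
      then have "d (\<rho> i) \<le> spectral_norm (P * V (\<rho> i) - P * L)"
        using d[OF rho(2)[of i]] unfolding is_minimum_def by blast
      with rho(3)[of i] show ?thesis by (rule order_trans)
    qed
    ultimately have "e \<le> spectral_norm (P * L - P * L)"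
      by (intro LIMSEQ_le_const) auto
    also have "\<dots> \<le> frobenius_norm (P * L - P * L)"
    proof -
      have D: "P * L - P * L \<in> carrier_mat n p" using PLc by (rule minus_carrier_mat)
      show ?thesis by (rule spectral_norm_least[OF D vec_norm2_mult_unit_ball[OF D]])
    qed
    also have "\<dots> = 0" by (simp add: frobenius_norm_def)
    finally show False using e by simp
  qed
  with d show ?thesis by blast
qed

section \<open>Projected Gram matrices\<close>

lemma projected_gram_carrier: "P \<in> carrier_mat n q \<Longrightarrow> projected_gram P C \<in> carrier_mat q q"
  by (rule carrier_matI) (simp_all add: projected_gram_def)

lemma projected_gram_eq:
  assumes P: "P \<in> carrier_mat n q" and C: "C \<in> carrier_mat m n"
  shows "projected_gram P C = (C * P)\<^sup>T * (C * P)"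
proof -
  have "(C * P)\<^sup>T * (C * P) = P\<^sup>T * C\<^sup>T * (C * P)" using transpose_mult[OF C P] by simp
  also have "\<dots> = P\<^sup>T * C\<^sup>T * C * P"
    by (rule assoc_mult_mat[symmetric, of _ q m _ n _ q]) (use P C in auto)
  finally show ?thesis by (simp add: projected_gram_def)
qed

lemma projected_gram_symmetric:
  assumes P: "P \<in> carrier_mat n q" and C: "C \<in> carrier_mat m n"
  shows "(projected_gram P C)\<^sup>T = projected_gram P C"
proof -
  have D: "C * P \<in> carrier_mat m q" using P C by simp
  show ?thesis unfolding projected_gram_eq[OF P C] using transpose_mult[of "(C * P)\<^sup>T" q m "C * P" q] D by simp
qed

lemma projected_gram_mult_vec:
  assumes P: "P \<in> carrier_mat n q" and C: "C \<in> carrier_mat m n" and y: "y \<in> carrier_vec q"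
  shows "projected_gram P C *\<^sub>v y = (C * P)\<^sup>T *\<^sub>v (C *\<^sub>v (P *\<^sub>v y))"
proof -
  have D: "C * P \<in> carrier_mat m q" using P C by simp
  show ?thesis unfolding projected_gram_eq[OF P C]
    using assoc_mult_mat_vec[of "(C * P)\<^sup>T" q m "C * P" q y] assoc_mult_mat_vec[OF C P y] D y by simp
qed

lemma projected_gram_psd:
  assumes P: "P \<in> carrier_mat n q" and C: "C \<in> carrier_mat m n" and y: "y \<in> carrier_vec q"
  shows "0 \<le> y \<bullet> (projected_gram P C *\<^sub>v y)"
proof -
  have D: "C * P \<in> carrier_mat m q" using P C by simp
  have Dy: "(C * P) *\<^sub>v y \<in> carrier_vec m" using D y by auto
  have eq: "projected_gram P C *\<^sub>v y = (C * P)\<^sup>T *\<^sub>v ((C * P) *\<^sub>v y)"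
    unfolding projected_gram_mult_vec[OF P C y] assoc_mult_mat_vec[OF C P y] ..
  have Gy: "projected_gram P C *\<^sub>v y \<in> carrier_vec q" using projected_gram_carrier[OF P, of C] y by auto
  have "y \<bullet> (projected_gram P C *\<^sub>v y) = ((C * P)\<^sup>T *\<^sub>v ((C * P) *\<^sub>v y)) \<bullet> y"
    using comm_scalar_prod[OF y Gy] eq by simp
  also have "\<dots> = ((C * P) *\<^sub>v y) \<bullet> ((C * P) *\<^sub>v y)" by (rule transpose_vec_mult_scalar[OF D y Dy])
  finally show ?thesis by (simp add: real_scalar_prod_nonneg)
qed

lemma projected_gram_entry:
  assumes P: "P \<in> carrier_mat n q" and C: "C \<in> carrier_mat m n" and st: "s < q" "t < q"
  shows "projected_gram P C $$ (s, t) =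
    (\<Sum>h<m. (\<Sum>u<n. C $$ (h, u) * P $$ (u, s)) * (\<Sum>u<n. C $$ (h, u) * P $$ (u, t)))"
proof -
  define D where "D = C * P"
  have D: "D \<in> carrier_mat m q" using P C by (simp add: D_def)
  have Dh: "D $$ (h, s) = (\<Sum>u<n. C $$ (h, u) * P $$ (u, s))" if "h < m" "s < q" for h s
    unfolding D_def by (rule mult_mat_nth_sum[OF C P that])
  have "projected_gram P C $$ (s, t) = col D s \<bullet> col D t"
    unfolding projected_gram_eq[OF P C] D_def[symmetric] using D st by simp
  also have "\<dots> = (\<Sum>h<m. D $$ (h, s) * D $$ (h, t))"
    using D st by (subst scalar_prod_sum[of _ m]) auto
  also have "\<dots> = (\<Sum>h<m. (\<Sum>u<n. C $$ (h, u) * P $$ (u, s)) * (\<Sum>u<n. C $$ (h, u) * P $$ (u, t)))"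
    using Dh st by (intro sum.cong refl) simp
  finally show ?thesis .
qed

lemma rows_upto_carrier: "rows_upto d k x m \<in> carrier_mat (m - k) d"
  by (auto simp: rows_upto_def mat_of_rows_def)

lemma rows_upto_entry:
  assumes "h < m - k" "u < d"
  shows "rows_upto d k x m $$ (h, u) = x (Suc (k + h)) $ u"
  using assms by (simp add: rows_upto_def mat_of_rows_def del: upt_Suc)

lemma C2_bar_carrier: "C2_bar n l k a b m \<in> carrier_mat (m - k) (n + l)"
  unfolding C2_bar_def by (rule append_cols_carrier[OF rows_upto_carrier rows_upto_carrier])

lemma C2_carrier: "C2 n l k a b e m \<omega> \<in> carrier_mat (m - k) (n + l)"
  unfolding C2_def using C2_bar_carrier rows_upto_carrier by auto

definition exact_row :: "nat \<Rightarrow> (nat \<Rightarrow> real vec) \<Rightarrow> (nat \<Rightarrow> real vec) \<Rightarrow> nat \<Rightarrow> nat \<Rightarrow> real" where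
  "exact_row n a b i u = (if u < n then a i $ u else b i $ (u - n))"

lemma C2_bar_entry:
  assumes "h < m - k" "u < n + l"
  shows "C2_bar n l k a b m $$ (h, u) = exact_row n a b (Suc (k + h)) u"
  using assms rows_upto_carrier[of n k a m] rows_upto_carrier[of l k b m]
  by (auto simp: C2_bar_def append_cols_def exact_row_def rows_upto_entry)

lemma C2_entry:
  assumes "h < m - k" "u < n + l"
  shows "C2 n l k a b e m \<omega> $$ (h, u) = exact_row n a b (Suc (k + h)) u + e (Suc (k + h)) \<omega> $ u"
  using assms rows_upto_carrier[of "n + l" k "\<lambda>i. e i \<omega>" m]
  by (simp add: C2_def C2_bar_entry rows_upto_entry)

lemma gram_limit_symmetric:
  assumes G: "\<And>m. G m \<in> carrier_mat q q" "\<And>m. (G m)\<^sup>T = G m" and T: "T \<in> carrier_mat q q"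
    and lim: "mat_tendsto (\<lambda>m. s m \<cdot>\<^sub>m G m) T"
  shows "T\<^sup>T = T"
proof (rule eq_matI)
  fix i j assume "i < dim_row T" "j < dim_col T"
  then have ij: "i < q" "j < q" using T by auto
  have "G m $$ (j, i) = G m $$ (i, j)" for m
    using arg_cong[OF G(2)[of m], of "\<lambda>A. A $$ (i, j)"] G(1)[of m] ij by simp
  then have "(s m \<cdot>\<^sub>m G m) $$ (j, i) = (s m \<cdot>\<^sub>m G m) $$ (i, j)" for m using G(1)[of m] ij by simp
  then have "T $$ (j, i) = T $$ (i, j)"
    using LIMSEQ_unique[OF mat_tendstoD[OF lim T ij(2,1)]] mat_tendstoD[OF lim T ij] by simp
  then show "T\<^sup>T $$ (i, j) = T $$ (i, j)" using T ij by simp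
qed (use T in auto)

lemma gram_limit_psd:
  assumes G: "\<And>m. G m \<in> carrier_mat q q" "\<And>m y. y \<in> carrier_vec q \<Longrightarrow> 0 \<le> y \<bullet> (G m *\<^sub>v y)"
    and T: "T \<in> carrier_mat q q" and s: "\<And>m. 0 \<le> s m"
    and lim: "mat_tendsto (\<lambda>m. s m \<cdot>\<^sub>m G m) T" and y: "y \<in> carrier_vec q"
  shows "0 \<le> y \<bullet> (T *\<^sub>v y)"
proof -
  let ?Y = "mat_of_cols q [y]"
  have Y: "?Y \<in> carrier_mat q 1" by auto
  have colY: "col ?Y 0 = y" using y by simp
  have sG: "s m \<cdot>\<^sub>m G m \<in> carrier_mat q q" for m using G by simp
  have "(\<lambda>m. y \<bullet> ((s m \<cdot>\<^sub>m G m) *\<^sub>v y)) \<longlonglongrightarrow> y \<bullet> (T *\<^sub>v y)"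
    using quadratic_form_tendsto[OF sG T lim Y Y mat_tendsto_const, of 0] colY by simp
  moreover have "0 \<le> y \<bullet> ((s m \<cdot>\<^sub>m G m) *\<^sub>v y)" for m
  proof -
    have "G m *\<^sub>v y \<in> carrier_vec q" using G(1)[of m] y by auto
    then show ?thesis using smult_mat_mult_vec[OF G(1) y] G(2)[OF y, of m] s[of m] y by simp
  qed
  ultimately show ?thesis by (intro LIMSEQ_le_const) auto
qed

lemma gram_limit_null_vector:
  assumes G: "\<And>m. G m \<in> carrier_mat q q" and T: "T \<in> carrier_mat q q"
    and lim: "mat_tendsto (\<lambda>m. s m \<cdot>\<^sub>m G m) T" and y: "y \<in> carrier_vec q"
    and null: "\<forall>\<^sub>F m in sequentially. G m *\<^sub>v y = 0\<^sub>v q"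
  shows "T *\<^sub>v y = 0\<^sub>v q"
proof (rule eq_vecI)
  fix i assume "i < dim_vec (0\<^sub>v q :: real vec)"
  then have i: "i < q" by simp
  have sG: "s m \<cdot>\<^sub>m G m \<in> carrier_mat q q" for m using G by simp
  have "(\<lambda>m. ((s m \<cdot>\<^sub>m G m) *\<^sub>v y) $ i) \<longlonglongrightarrow> (T *\<^sub>v y) $ i"
    unfolding mult_mat_vec_nth_sum[OF sG y i] mult_mat_vec_nth_sum[OF T y i]
    by (rule tendsto_sum, rule tendsto_mult[OF mat_tendstoD[OF lim T i] tendsto_const]) simp
  moreover have "\<forall>\<^sub>F m in sequentially. ((s m \<cdot>\<^sub>m G m) *\<^sub>v y) $ i = 0"
    by (rule eventually_mono[OF null]) (use i in \<open>simp add: smult_mat_mult_vec[OF G y]\<close>)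
  ultimately have "(T *\<^sub>v y) $ i = 0" by (rule LIMSEQ_unique[OF _ tendsto_eventually])
  then show "(T *\<^sub>v y) $ i = 0\<^sub>v q $ i" using i by simp
qed (use T in simp)

section \<open>The noisy Gram matrix\<close>

text \<open>
The first \<open>k\<close> rows are the exact constraints, so there are \<open>m - k\<close> noisy rows while the normalisation
is by \<open>m\<close>; the quotient of the two tends to \<open>1\<close>.
\<close>

lemma inverse_average_iff:
  fixes S :: "nat \<Rightarrow> real"
  shows "(\<lambda>m. inverse (real m) * S (m - k)) \<longlonglongrightarrow> L \<longleftrightarrow> (\<lambda>n. S n / real n) \<longlonglongrightarrow> L"
proof -
  have r1: "(\<lambda>n. real (n + k) / real n) \<longlonglongrightarrow> 1" and r2: "(\<lambda>n. real n / real (n + k)) \<longlonglongrightarrow> 1"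
    by real_asymp+
  have "(\<lambda>m. inverse (real m) * S (m - k)) \<longlonglongrightarrow> L \<longleftrightarrow> (\<lambda>n. inverse (real (n + k)) * S n) \<longlonglongrightarrow> L"
    using LIMSEQ_offset[of "\<lambda>m. inverse (real m) * S (m - k)" k L]
      LIMSEQ_ignore_initial_segment[of "\<lambda>m. inverse (real m) * S (m - k)" L k] by auto
  also have "\<dots> \<longleftrightarrow> (\<lambda>n. S n / real n) \<longlonglongrightarrow> L"
  proof
    assume "(\<lambda>n. inverse (real (n + k)) * S n) \<longlonglongrightarrow> L"
    from tendsto_mult[OF this r1] have "(\<lambda>n. inverse (real (n + k)) * S n * (real (n + k) / real n)) \<longlonglongrightarrow> L" by simp
    then show "(\<lambda>n. S n / real n) \<longlonglongrightarrow> L"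
    proof (rule Lim_transform_eventually)
      show "\<forall>\<^sub>F n in sequentially. inverse (real (n + k)) * S n * (real (n + k) / real n) = S n / real n"
        using eventually_gt_at_top[of 0]
      proof eventually_elim
        case (elim n)
        have "real (n + k) \<noteq> 0" "real n \<noteq> 0" using elim by auto
        then show ?case by (simp add: divide_simps del: of_nat_add)
      qed
    qed
  next
    assume "(\<lambda>n. S n / real n) \<longlonglongrightarrow> L"
    from tendsto_mult[OF this r2] have "(\<lambda>n. S n / real n * (real n / real (n + k))) \<longlonglongrightarrow> L" by simp
    then show "(\<lambda>n. inverse (real (n + k)) * S n) \<longlonglongrightarrow> L"
    proof (rule Lim_transform_eventually)
      show "\<forall>\<^sub>F n in sequentially. S n / real n * (real n / real (n + k)) = inverse (real (n + k)) * S n"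
        using eventually_gt_at_top[of 0] by eventually_elim (simp add: field_simps)
    qed
  qed
  finally show ?thesis .
qed

lemma vec_borel_component [measurable]:
  assumes "i < d"
  shows "(\<lambda>v. v $ i) \<in> borel_measurable (vec_borel d)"
proof -
  have "(\<lambda>v. \<lambda>i\<in>{..<d}. v $ i) \<in> measurable (vec_borel d) (\<Pi>\<^sub>M i\<in>{..<d}. (borel :: real measure))"
    unfolding vec_borel_def by (rule measurable_vimage_algebra1) (auto simp: space_PiM)
  from measurable_compose[OF this measurable_component_singleton[of i]] assms show ?thesis by simp
qed

context prob_space
begin

text \<open>
Grouping the variables into singletons reduces reindexing to restriction.
\<close>

lemma iid_vars_reindex:
  assumes iid: "iid_vars M N X I" and f: "inj_on f J" "f ` J \<subseteq> I"
  shows "iid_vars M N (\<lambda>j. X (f j)) J"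
proof -
  have ind: "indep_vars (\<lambda>_. N) X I"
    and eq: "\<And>i j. i \<in> I \<Longrightarrow> j \<in> I \<Longrightarrow> distr M N (X i) = distr M N (X j)"
    using iid unfolding iid_vars_def by blast+
  have "indep_vars (\<lambda>j. PiM {f j} (\<lambda>_. N)) (\<lambda>j \<omega>. restrict (\<lambda>i. X i \<omega>) {f j}) J"
    by (rule indep_vars_restrict[OF ind]) (use f in \<open>auto simp: disjoint_family_on_def inj_on_def\<close>)
  then have "indep_vars (\<lambda>_. N) (\<lambda>j \<omega>. (restrict (\<lambda>i. X i \<omega>) {f j}) (f j)) J"
    by (rule indep_vars_compose2) (rule measurable_component_singleton, simp)
  then have "indep_vars (\<lambda>_. N) (\<lambda>j. X (f j)) J" by simp
  moreover have "distr M N (X (f i)) = distr M N (X (f j))" if "i \<in> J" "j \<in> J" for i j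
    by (rule eq) (use that f in auto)
  ultimately show ?thesis unfolding iid_vars_def by blast
qed

text \<open>
Orthonormal columns turn a noise vector with covariance \<open>\<sigma>\<^sup>2 I\<close> into coordinates with covariance
\<open>\<sigma>\<^sup>2 I\<close>.
\<close>

lemma expectation_linear_forms:
  fixes X :: "'a \<Rightarrow> real vec" and P :: "real mat"
  assumes meas: "X \<in> measurable M (vec_borel d)"
    and sq: "square_integrable_vec M d X" and mean: "mean_vec M d X = 0\<^sub>v d"
    and cov: "cov_mat M d X = \<sigma>\<^sup>2 \<cdot>\<^sub>m 1\<^sub>m d"
    and P: "orthonormal_cols d q P" and st: "s < q" "t < q"
  defines "f \<equiv> \<lambda>s v. \<Sum>u<d. v $ u * P $$ (u, s)"
  shows "integrable M (\<lambda>\<omega>. (f s (X \<omega>))\<^sup>2)" and "expectation (\<lambda>\<omega>. f s (X \<omega>)) = 0"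
    and "expectation (\<lambda>\<omega>. f s (X \<omega>) * f t (X \<omega>)) = (if s = t then \<sigma>\<^sup>2 else 0)"
proof -
  have comp [measurable]: "(\<lambda>\<omega>. X \<omega> $ u) \<in> borel_measurable M" if "u < d" for u
    using measurable_compose[OF meas vec_borel_component[OF that]] .
  have sqi: "integrable M (\<lambda>\<omega>. (X \<omega> $ u)\<^sup>2)" if "u < d" for u
    using sq that by (simp add: square_integrable_vec_def)
  have int1: "integrable M (\<lambda>\<omega>. X \<omega> $ u)" if "u < d" for u
    by (rule square_integrable_imp_integrable[OF comp[OF that] sqi[OF that]])
  have int2: "integrable M (\<lambda>\<omega>. X \<omega> $ u * X \<omega> $ w)" if "u < d" "w < d" for u w
    by (rule integrable_mult_of_squares[OF comp comp sqi sqi]) (use that in auto)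
  have m0: "expectation (\<lambda>\<omega>. X \<omega> $ u) = 0" if "u < d" for u
    using arg_cong[OF mean, of "\<lambda>v. v $ u"] that by (simp add: mean_vec_def)
  have c: "expectation (\<lambda>\<omega>. X \<omega> $ u * X \<omega> $ w) = (if u = w then \<sigma>\<^sup>2 else 0)" if "u < d" "w < d" for u w
    using arg_cong[OF cov, of "\<lambda>A. A $$ (u, w)"] that by (simp add: cov_mat_def mean)
  show "expectation (\<lambda>\<omega>. f s (X \<omega>)) = 0"
    unfolding f_def using int1 m0 by (subst Bochner_Integration.integral_sum) auto
  have prod: "f s v * f t v = (\<Sum>u<d. \<Sum>w<d. P $$ (u, s) * P $$ (w, t) * (v $ u * v $ w))" for s t v
    unfolding f_def sum_product by (intro sum.cong refl) (simp add: mult_ac)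
  have "integrable M (\<lambda>\<omega>. f s (X \<omega>) * f s (X \<omega>))"
    unfolding prod by (intro Bochner_Integration.integrable_sum integrable_mult_right int2) auto
  then show "integrable M (\<lambda>\<omega>. (f s (X \<omega>))\<^sup>2)" by (simp add: power2_eq_square)
  have "expectation (\<lambda>\<omega>. f s (X \<omega>) * f t (X \<omega>)) =
      (\<Sum>u<d. \<Sum>w<d. P $$ (u, s) * P $$ (w, t) * expectation (\<lambda>\<omega>. X \<omega> $ u * X \<omega> $ w))"
    unfolding prod using int2
    by (subst Bochner_Integration.integral_sum, intro Bochner_Integration.integrable_sum integrable_mult_right int2)
      (auto intro!: sum.cong Bochner_Integration.integral_sum[THEN trans])
  also have "\<dots> = (\<Sum>u<d. \<Sum>w<d. if u = w then P $$ (u, s) * P $$ (w, t) * \<sigma>\<^sup>2 else 0)"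
    using c by (intro sum.cong refl) auto
  also have "\<dots> = (\<Sum>u<d. P $$ (u, s) * P $$ (u, t)) * \<sigma>\<^sup>2" by (simp add: sum_distrib_right)
  also have "(\<Sum>u<d. P $$ (u, s) * P $$ (u, t)) = col P s \<bullet> col P t"
    using orthonormal_cols_carrier[OF P] st by (subst scalar_prod_sum[of _ d]) auto
  also have "\<dots> = (if s = t then 1 else 0)"
    using P st orthonormal_cols_iff[OF orthonormal_cols_carrier[OF P]] by simp
  finally show "expectation (\<lambda>\<omega>. f s (X \<omega>) * f t (X \<omega>)) = (if s = t then \<sigma>\<^sup>2 else 0)" by simp
qed

text \<open>
Entry \<open>(s, t)\<close> of the noisy Gram matrix is a sum over the rows of products of exact linear forms
\<open>\<gamma> s h\<close> and \<open>\<gamma> t h\<close>, perturbed by the noise forms. The diagonal entries of the limit \<open>T\<close> supply the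
mean squares of the weights in the mixed terms.
\<close>

theorem noisy_projected_gram_limit:
  fixes e :: "nat \<Rightarrow> 'a \<Rightarrow> real vec" and P T :: "real mat"
  assumes P: "orthonormal_cols (n + l) q P"
    and iid: "iid_vars M (vec_borel (n + l)) e {k<..}"
    and sq: "square_integrable_vec M (n + l) (e (Suc k))"
    and mean: "mean_vec M (n + l) (e (Suc k)) = 0\<^sub>v (n + l)"
    and cov: "cov_mat M (n + l) (e (Suc k)) = \<sigma>\<^sup>2 \<cdot>\<^sub>m 1\<^sub>m (n + l)"
    and T: "T \<in> carrier_mat q q"
    and lim: "mat_tendsto (\<lambda>m. inverse (real m) \<cdot>\<^sub>m projected_gram P (C2_bar n l k a b m)) T"
  shows "AE \<omega> in M. mat_tendsto (\<lambda>m. inverse (real m) \<cdot>\<^sub>m projected_gram P (C2 n l k a b e m \<omega>))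
           (T + \<sigma>\<^sup>2 \<cdot>\<^sub>m 1\<^sub>m q)"
proof -
  note Pc = orthonormal_cols_carrier[OF P]
  define X where "X j = e (Suc (k + j))" for j
  have iidX: "iid_vars M (vec_borel (n + l)) X UNIV"
    unfolding X_def by (rule iid_vars_reindex[OF iid]) (auto simp: inj_on_def)
  have X0: "X 0 = e (Suc k)" by (simp add: X_def)
  have X0_meas: "X 0 \<in> measurable M (vec_borel (n + l))" by (rule iid_random_variable[OF iidX UNIV_I])
  define f where "f s v = (\<Sum>u<n + l. v $ u * P $$ (u, s))" for s and v :: "real vec"
  define \<gamma> where "\<gamma> s h = (\<Sum>u<n + l. exact_row n a b (Suc (k + h)) u * P $$ (u, s))" for s h
  have f_meas: "f s \<in> borel_measurable (vec_borel (n + l))" for s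
    unfolding f_def by (intro borel_measurable_sum borel_measurable_times vec_borel_component) auto
  have exact: "projected_gram P (C2_bar n l k a b m) $$ (s, t) = (\<Sum>h<m - k. \<gamma> s h * \<gamma> t h)"
    if "s < q" "t < q" for s t m
    unfolding projected_gram_entry[OF Pc C2_bar_carrier that] \<gamma>_def
    by (intro sum.cong refl) (simp add: C2_bar_entry)
  have noisy: "projected_gram P (C2 n l k a b e m \<omega>) $$ (s, t) =
      (\<Sum>h<m - k. (\<gamma> s h + f s (X h \<omega>)) * (\<gamma> t h + f t (X h \<omega>)))" if "s < q" "t < q" for s t m \<omega>
    unfolding projected_gram_entry[OF Pc C2_carrier that] \<gamma>_def f_def X_def
    by (intro sum.cong refl) (simp add: C2_entry distrib_right sum.distrib)
  have gc: "projected_gram P C \<in> carrier_mat q q" for C by (rule projected_gram_carrier[OF Pc])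
  have avg: "(\<lambda>N. (\<Sum>h<N. \<gamma> s h * \<gamma> t h) / real N) \<longlonglongrightarrow> T $$ (s, t)" if st: "s < q" "t < q" for s t
  proof -
    have "(inverse (real m) \<cdot>\<^sub>m projected_gram P (C2_bar n l k a b m)) $$ (s, t) =
        inverse (real m) * (\<Sum>h<m - k. \<gamma> s h * \<gamma> t h)" for m
      using gc[of "C2_bar n l k a b m"] st exact[OF st] by simp
    then show ?thesis
      using mat_tendstoD[OF lim T st] inverse_average_iff[of "\<lambda>N. \<Sum>h<N. \<gamma> s h * \<gamma> t h" k] by simp
  qed
  have "AE \<omega> in M. \<forall>s\<in>{..<q}. \<forall>t\<in>{..<q}.
      (\<lambda>N. (\<Sum>h<N. (\<gamma> s h + f s (X h \<omega>)) * (\<gamma> t h + f t (X h \<omega>))) / real N) \<longlonglongrightarrow> T $$ (s, t) + (if s = t then \<sigma>\<^sup>2 else 0)"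
  proof (intro AE_finite_allI finite_lessThan)
    fix s t assume "s \<in> {..<q}" "t \<in> {..<q}"
    then have st: "s < q" "t < q" by auto
    note ex = expectation_linear_forms[OF X0_meas sq[folded X0] mean[folded X0] cov[folded X0] P, folded f_def]
    have "AE \<omega> in M. (\<lambda>N. (\<Sum>h<N. (\<gamma> s h + f s (X h \<omega>)) * (\<gamma> t h + f t (X h \<omega>))) / real N)
        \<longlonglongrightarrow> T $$ (s, t) + expectation (\<lambda>\<omega>. f s (X 0 \<omega>) * f t (X 0 \<omega>))"
    proof (rule iid_noisy_product_average[OF iidX f_meas f_meas])
      show "(\<lambda>N. (\<Sum>h<N. (\<gamma> s h)\<^sup>2) / real N) \<longlonglongrightarrow> T $$ (s, s)"
        using avg[OF st(1) st(1)] by (simp add: power2_eq_square)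
      show "(\<lambda>N. (\<Sum>h<N. (\<gamma> t h)\<^sup>2) / real N) \<longlonglongrightarrow> T $$ (t, t)"
        using avg[OF st(2) st(2)] by (simp add: power2_eq_square)
    qed (rule ex(1)[OF st(1,1)] ex(1)[OF st(2,2)] ex(2)[OF st(1,1)] ex(2)[OF st(2,2)] avg[OF st])+
    then show "AE \<omega> in M. (\<lambda>N. (\<Sum>h<N. (\<gamma> s h + f s (X h \<omega>)) * (\<gamma> t h + f t (X h \<omega>))) / real N)
        \<longlonglongrightarrow> T $$ (s, t) + (if s = t then \<sigma>\<^sup>2 else 0)"
      unfolding ex(3)[OF st] .
  qed
  then show ?thesis
  proof eventually_elim
    case (elim \<omega>)
    let ?G = "\<lambda>m. inverse (real m) \<cdot>\<^sub>m projected_gram P (C2 n l k a b e m \<omega>)"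
    show ?case
      unfolding mat_tendsto_def
    proof (intro conjI allI impI)
      show "\<forall>\<^sub>F m in sequentially. ?G m \<in> carrier_mat (dim_row (T + \<sigma>\<^sup>2 \<cdot>\<^sub>m 1\<^sub>m q)) (dim_col (T + \<sigma>\<^sup>2 \<cdot>\<^sub>m 1\<^sub>m q))"
        using gc by (intro always_eventually allI) simp
      fix s t assume "s < dim_row (T + \<sigma>\<^sup>2 \<cdot>\<^sub>m 1\<^sub>m q)" "t < dim_col (T + \<sigma>\<^sup>2 \<cdot>\<^sub>m 1\<^sub>m q)"
      then have st: "s < q" "t < q" by auto
      have "?G m $$ (s, t) = inverse (real m) * (\<Sum>h<m - k. (\<gamma> s h + f s (X h \<omega>)) * (\<gamma> t h + f t (X h \<omega>)))" for m
        using gc[of "C2 n l k a b e m \<omega>"] st noisy[OF st] by simp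
      moreover have "(T + \<sigma>\<^sup>2 \<cdot>\<^sub>m 1\<^sub>m q) $$ (s, t) = T $$ (s, t) + (if s = t then \<sigma>\<^sup>2 else 0)"
        using st T by simp
      ultimately show "(\<lambda>m. ?G m $$ (s, t)) \<longlonglongrightarrow> (T + \<sigma>\<^sup>2 \<cdot>\<^sub>m 1\<^sub>m q) $$ (s, t)"
        using elim st inverse_average_iff[of "\<lambda>N. \<Sum>h<N. (\<gamma> s h + f s (X h \<omega>)) * (\<gamma> t h + f t (X h \<omega>))" k]
        by simp
    qed
  qed
qed

end

section \<open>The range of Y bar\<close>

lemma Y_bar_carrier:
  assumes "X \<in> carrier_mat n l" "W \<in> carrier_mat n (n - r)" "r \<le> n"
  shows "Y_bar n l r X W \<in> carrier_mat (n + l) (n + l - r)"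
proof -
  have "l + (n - r) = n + l - r" using assms by simp
  moreover have "Y_bar n l r X W \<in> carrier_mat (n + l) (l + (n - r))"
    unfolding Y_bar_def using assms by (intro four_block_carrier_mat) auto
  ultimately show ?thesis by simp
qed

lemma Y_bar_mult_vec:
  assumes X: "X \<in> carrier_mat n l" and W: "W \<in> carrier_mat n (n - r)"
    and u: "u \<in> carrier_vec l" and w: "w \<in> carrier_vec (n - r)"
  shows "Y_bar n l r X W *\<^sub>v (u @\<^sub>v w) = (W *\<^sub>v w - X *\<^sub>v u) @\<^sub>v u"
proof -
  have Xu: "X *\<^sub>v u \<in> carrier_vec n" and Ww: "W *\<^sub>v w \<in> carrier_vec n" using X W u w by auto
  have mX: "- X \<in> carrier_mat n l" using X by simp
  have "(- X) *\<^sub>v u = - (X *\<^sub>v u)" using X u by (intro eq_vecI) (auto simp: scalar_prod_def sum_negf)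
  moreover have "0\<^sub>m l (n - r) *\<^sub>v w = 0\<^sub>v l" using w by auto
  ultimately have "Y_bar n l r X W *\<^sub>v (u @\<^sub>v w) = (- (X *\<^sub>v u) + W *\<^sub>v w) @\<^sub>v (u + 0\<^sub>v l)"
    unfolding Y_bar_def using four_block_mat_mult_vec[OF mX W one_carrier_mat zero_carrier_mat u w] u by simp
  also have "- (X *\<^sub>v u) + W *\<^sub>v w = W *\<^sub>v w - X *\<^sub>v u"
    using comm_add_vec[of "- (X *\<^sub>v u)" n "W *\<^sub>v w"] minus_add_uminus_vec[OF Ww Xu] Xu Ww by simp
  also have "u + 0\<^sub>v l = u" using u by simp
  finally show ?thesis .
qed

text \<open>
A combination of the columns of \<open>Y_bar\<close> has the form \<open>(W w - X u, u)\<close>; \<open>A\<close> annihilates \<open>W w\<close> and maps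
\<open>X u\<close> to \<open>B u\<close>.
\<close>

lemma Y_bar_range_kernel:
  assumes X: "X \<in> carrier_mat n l" and W: "W \<in> carrier_mat n (n - r)" and rn: "r \<le> n"
    and A: "A \<in> carrier_mat m n" and B: "B \<in> carrier_mat m l" and AX: "A * X = B"
    and ran: "mat_range W = mat_kernel A"
    and z: "z \<in> mat_range (Y_bar n l r X W)"
  shows "z \<in> carrier_vec (n + l)" and "(A @\<^sub>c B) *\<^sub>v z = 0\<^sub>v m"
proof -
  have pl: "n + l - r = l + (n - r)" using rn by simp
  obtain g where g: "g \<in> carrier_vec (l + (n - r))" "z = Y_bar n l r X W *\<^sub>v g"
    using z mat_range_eq[OF Y_bar_carrier[OF X W rn]] pl by auto
  define u w where "u = vec_first g l" and "w = vec_last g (n - r)"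
  have u: "u \<in> carrier_vec l" and w: "w \<in> carrier_vec (n - r)" by (auto simp: u_def w_def)
  have guw: "g = u @\<^sub>v w" unfolding u_def w_def using vec_first_last_append[OF g(1)] by simp
  have Xu: "X *\<^sub>v u \<in> carrier_vec n" and Ww: "W *\<^sub>v w \<in> carrier_vec n" using X W u w by auto
  have zz: "z = (W *\<^sub>v w - X *\<^sub>v u) @\<^sub>v u" unfolding g(2) guw by (rule Y_bar_mult_vec[OF X W u w])
  have c: "W *\<^sub>v w - X *\<^sub>v u \<in> carrier_vec n" using Xu Ww by simp
  show "z \<in> carrier_vec (n + l)" unfolding zz using c u by (rule append_carrier_vec)
  have "W *\<^sub>v w \<in> mat_kernel A" unfolding ran[symmetric] mat_range_eq[OF W] using w by blast
  then have AW: "A *\<^sub>v (W *\<^sub>v w) = 0\<^sub>v m" using mat_kernelD[OF A] by blast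
  have AXu: "A *\<^sub>v (X *\<^sub>v u) = B *\<^sub>v u" unfolding AX[symmetric] by (rule assoc_mult_mat_vec[OF A X u, symmetric])
  have Bu: "B *\<^sub>v u \<in> carrier_vec m" using B u by auto
  have "(A @\<^sub>c B) *\<^sub>v z = A *\<^sub>v (W *\<^sub>v w - X *\<^sub>v u) + B *\<^sub>v u" unfolding zz by (rule append_cols_mult_vec[OF A B c u])
  also have "A *\<^sub>v (W *\<^sub>v w - X *\<^sub>v u) = 0\<^sub>v m - B *\<^sub>v u" unfolding mult_minus_distrib_mat_vec[OF A Ww Xu] AW AXu ..
  also have "0\<^sub>v m - B *\<^sub>v u + B *\<^sub>v u = 0\<^sub>v m" using Bu by (intro eq_vecI) auto
  finally show "(A @\<^sub>c B) *\<^sub>v z = 0\<^sub>v m" .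
qed

lemma zero_vec_append: "0\<^sub>v n @\<^sub>v 0\<^sub>v m = 0\<^sub>v (n + m)"
  by (intro eq_vecI) auto

lemma Y_bar_injective:
  assumes X: "X \<in> carrier_mat n l" and W: "W \<in> carrier_mat n (n - r)" and rn: "r \<le> n"
    and injW: "\<And>w. w \<in> carrier_vec (n - r) \<Longrightarrow> W *\<^sub>v w = 0\<^sub>v n \<Longrightarrow> w = 0\<^sub>v (n - r)"
    and g: "g \<in> carrier_vec (n + l - r)" "Y_bar n l r X W *\<^sub>v g = 0\<^sub>v (n + l)"
  shows "g = 0\<^sub>v (n + l - r)"
proof -
  have pl: "n + l - r = l + (n - r)" using rn by simp
  define u w where "u = vec_first g l" and "w = vec_last g (n - r)"
  have u: "u \<in> carrier_vec l" and w: "w \<in> carrier_vec (n - r)" by (auto simp: u_def w_def)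
  have guw: "g = u @\<^sub>v w" unfolding u_def w_def using vec_first_last_append g(1) pl by metis
  have Xu: "X *\<^sub>v u \<in> carrier_vec n" and Ww: "W *\<^sub>v w \<in> carrier_vec n" using X W u w by auto
  have c: "W *\<^sub>v w - X *\<^sub>v u \<in> carrier_vec n" using Xu Ww by simp
  have "(W *\<^sub>v w - X *\<^sub>v u) @\<^sub>v u = 0\<^sub>v n @\<^sub>v 0\<^sub>v l"
    using g(2) unfolding guw Y_bar_mult_vec[OF X W u w] zero_vec_append .
  then have eq: "W *\<^sub>v w - X *\<^sub>v u = 0\<^sub>v n" and u0: "u = 0\<^sub>v l"
    using append_vec_eq[OF c zero_carrier_vec] by auto
  have "X *\<^sub>v u = 0\<^sub>v n" unfolding u0 by (rule mult_mat_zero_vec[OF X])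
  then have "W *\<^sub>v w = 0\<^sub>v n" using eq Ww by simp
  then have "w = 0\<^sub>v (n - r)" by (rule injW[OF w])
  then show ?thesis unfolding guw u0 pl by (intro eq_vecI) auto
qed

lemma append_rows_cols_mult_vec_eq_0:
  fixes A1 A2 B1 B2 :: "real mat"
  assumes A1: "A1 \<in> carrier_mat k n" and A2: "A2 \<in> carrier_mat m n"
    and B1: "B1 \<in> carrier_mat k l" and B2: "B2 \<in> carrier_mat m l"
    and z: "z \<in> carrier_vec (n + l)" "((A1 @\<^sub>r A2) @\<^sub>c (B1 @\<^sub>r B2)) *\<^sub>v z = 0\<^sub>v (k + m)"
  shows "(A1 @\<^sub>c B1) *\<^sub>v z = 0\<^sub>v k" and "(A2 @\<^sub>c B2) *\<^sub>v z = 0\<^sub>v m"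
proof -
  define x u where "x = vec_first z n" and "u = vec_last z l"
  have x: "x \<in> carrier_vec n" and u: "u \<in> carrier_vec l" by (auto simp: x_def u_def)
  have zxu: "z = x @\<^sub>v u" unfolding x_def u_def using vec_first_last_append[OF z(1)] by simp
  have A: "A1 @\<^sub>r A2 \<in> carrier_mat (k + m) n" and B: "B1 @\<^sub>r B2 \<in> carrier_mat (k + m) l"
    using A1 A2 B1 B2 by auto
  have c: "A1 *\<^sub>v x \<in> carrier_vec k" "A2 *\<^sub>v x \<in> carrier_vec m" "B1 *\<^sub>v u \<in> carrier_vec k" "B2 *\<^sub>v u \<in> carrier_vec m"
    using A1 A2 B1 B2 x u by auto
  have "((A1 @\<^sub>r A2) @\<^sub>c (B1 @\<^sub>r B2)) *\<^sub>v z = (A1 *\<^sub>v x @\<^sub>v A2 *\<^sub>v x) + (B1 *\<^sub>v u @\<^sub>v B2 *\<^sub>v u)"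
    unfolding zxu append_cols_mult_vec[OF A B x u] mat_mult_append[OF A1 A2 x] mat_mult_append[OF B1 B2 u] ..
  also have "\<dots> = (A1 *\<^sub>v x + B1 *\<^sub>v u) @\<^sub>v (A2 *\<^sub>v x + B2 *\<^sub>v u)"
    using append_vec_add[OF c(1,3,2,4)] by simp
  finally have "(A1 *\<^sub>v x + B1 *\<^sub>v u) @\<^sub>v (A2 *\<^sub>v x + B2 *\<^sub>v u) = 0\<^sub>v k @\<^sub>v 0\<^sub>v m"
    using z(2) unfolding zero_vec_append by (rule trans[OF sym])
  then have "A1 *\<^sub>v x + B1 *\<^sub>v u = 0\<^sub>v k" "A2 *\<^sub>v x + B2 *\<^sub>v u = 0\<^sub>v m"
    using append_vec_eq[of "A1 *\<^sub>v x + B1 *\<^sub>v u" k "0\<^sub>v k"] c by auto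
  then show "(A1 @\<^sub>c B1) *\<^sub>v z = 0\<^sub>v k" "(A2 @\<^sub>c B2) *\<^sub>v z = 0\<^sub>v m"
    unfolding zxu append_cols_mult_vec[OF A1 B1 x u] append_cols_mult_vec[OF A2 B2 x u] by auto
qed

text \<open>
A vector \<open>z\<close> in the range of \<open>Y_bar\<close> solves the exact homogeneous system for all large \<open>m\<close>. By its first
\<open>k\<close> equations, \<open>z = P g\<close> for some \<open>g\<close>; by the others, the exact Gram matrices annihilate \<open>g\<close>, and
hence so does their limit \<open>T\<close>. This gives one inclusion. Equality follows because \<open>Y_bar\<close> is injective
and both ranges have dimension \<open>n + l - r\<close>.
\<close>

lemma Y_bar_range_limit_kernel:
  fixes A1 B1 P T X W U :: "real mat" and a b :: "nat \<Rightarrow> real vec"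
  assumes kr: "k \<le> r" "r \<le> n"
    and A1: "A1 \<in> carrier_mat k n" "mat_rank A1 = k" and B1: "B1 \<in> carrier_mat k l"
    and rank: "\<forall>\<^sub>F m in sequentially. mat_rank (A1 @\<^sub>r rows_upto n k a m) = r"
    and P: "orthonormal_cols (n + l) (n + l - k) P" "(A1 @\<^sub>c B1) * P = 0\<^sub>m k (n + l - k)"
    and X: "\<forall>\<^sub>F m in sequentially. min_frobenius_solution
          (A1 @\<^sub>r rows_upto n k a m) (B1 @\<^sub>r rows_upto l k b m) X"
    and W: "W \<in> carrier_mat n (n - r)"
          "\<forall>\<^sub>F m in sequentially. mat_range W = mat_kernel (A1 @\<^sub>r rows_upto n k a m)"
    and T: "T \<in> carrier_mat (n + l - k) (n + l - k)"
          "mat_tendsto (\<lambda>m. inverse (real m) \<cdot>\<^sub>m projected_gram P (C2_bar n l k a b m)) T"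
    and U: "orthonormal_cols (n + l - k) (n + l - r) U" "mat_range U = mat_kernel T"
  shows "mat_range (Y_bar n l r X W) = mat_range (P * U)"
proof -
  note Pc = orthonormal_cols_carrier[OF P(1)] and Uc = orthonormal_cols_carrier[OF U(1)]
  let ?A = "\<lambda>m. A1 @\<^sub>r rows_upto n k a m" and ?B = "\<lambda>m. B1 @\<^sub>r rows_upto l k b m"
  let ?Y = "Y_bar n l r X W" and ?C1 = "A1 @\<^sub>c B1"
  have A: "?A m \<in> carrier_mat (k + (m - k)) n" and B: "?B m \<in> carrier_mat (k + (m - k)) l" for m
    by (rule carrier_append_rows[OF A1(1) rows_upto_carrier], rule carrier_append_rows[OF B1 rows_upto_carrier])
  obtain m0 where m0: "\<And>m. m0 \<le> m \<Longrightarrow> mat_rank (?A m) = r \<and> min_frobenius_solution (?A m) (?B m) X \<and>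
      mat_range W = mat_kernel (?A m)"
    using eventually_conj[OF rank eventually_conj[OF X W(2)]] unfolding eventually_sequentially by blast
  have AX: "X \<in> carrier_mat n l \<and> ?A m * X = ?B m" if "m0 \<le> m" for m
    using m0[OF that] carrier_matD[OF A[of m]] carrier_matD[OF B[of m]] by (simp add: min_frobenius_solution_def)
  then have Xc: "X \<in> carrier_mat n l" by blast
  have Yc: "?Y \<in> carrier_mat (n + l) (n + l - r)" by (rule Y_bar_carrier[OF Xc W(1) kr(2)])
  obtain K where K: "orthonormal_cols n (n - r) K" "mat_range K = mat_kernel (?A m0)"
  proof -
    have rk: "mat_rank (?A m0) = r" using m0[of m0] by simp
    obtain K where "orthonormal_cols n (n - mat_rank (?A m0)) K" "mat_range K = mat_kernel (?A m0)"
      by (rule kernel_basis_of_rank[OF A[of m0]])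
    then show ?thesis unfolding rk by (rule that)
  qed
  have ranW: "mat_range W = mat_range K" using K(2) m0[of m0] by simp
  have injW: "w = 0\<^sub>v (n - r)" if "w \<in> carrier_vec (n - r)" "W *\<^sub>v w = 0\<^sub>v n" for w
    by (rule injective_if_range_eq_basis[OF W(1) K(1) ranW that])
  have injY: "g = 0\<^sub>v (n + l - r)" if "g \<in> carrier_vec (n + l - r)" "?Y *\<^sub>v g = 0\<^sub>v (n + l)" for g
    by (rule Y_bar_injective[OF Xc W(1) kr(2) injW that])
  have C1: "?C1 \<in> carrier_mat k (n + l)" by (rule append_cols_carrier[OF A1(1) B1])
  have surj: "\<exists>x\<in>carrier_vec (n + l). ?C1 *\<^sub>v x = y" if y: "y \<in> carrier_vec k" for y
  proof -
    obtain x where x: "x \<in> carrier_vec n" "A1 *\<^sub>v x = y" using full_row_rank_surjective[OF A1 y] by blast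
    have "?C1 *\<^sub>v (x @\<^sub>v 0\<^sub>v l) = y"
      unfolding append_cols_mult_vec[OF A1(1) B1 x(1) zero_carrier_vec] mult_mat_zero_vec[OF B1] x(2) using y by simp
    moreover have "x @\<^sub>v 0\<^sub>v l \<in> carrier_vec (n + l)" using x by (intro append_carrier_vec) auto
    ultimately show ?thesis by blast
  qed
  have "mat_range ?Y \<subseteq> mat_range (P * U)"
  proof
    fix z assume z: "z \<in> mat_range ?Y"
    have z0: "z \<in> carrier_vec (n + l) \<and> ?C1 *\<^sub>v z = 0\<^sub>v k \<and> C2_bar n l k a b m *\<^sub>v z = 0\<^sub>v (m - k)"
      if m: "m0 \<le> m" for m
    proof -
      have ran: "mat_range W = mat_kernel (?A m)" and eq: "?A m * X = ?B m" using m0[OF m] AX[OF m] by auto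
      note zk = Y_bar_range_kernel[OF Xc W(1) kr(2) A B eq ran z]
      from append_rows_cols_mult_vec_eq_0[OF A1(1) rows_upto_carrier B1 rows_upto_carrier zk] zk(1)
      show ?thesis unfolding C2_bar_def by blast
    qed
    have zc: "z \<in> carrier_vec (n + l)" and C1z: "?C1 *\<^sub>v z = 0\<^sub>v k" using z0[of m0] by auto
    define g where "g = P\<^sup>T *\<^sub>v z"
    have g: "g \<in> carrier_vec (n + l - k)" using Pc zc by (auto simp: g_def)
    have kn: "k \<le> n + l" using kr by simp
    have Pg: "P *\<^sub>v g = z" unfolding g_def by (rule kernel_of_surjective[OF C1 surj P kn zc C1z])
    have "T *\<^sub>v g = 0\<^sub>v (n + l - k)"
    proof (rule gram_limit_null_vector[OF projected_gram_carrier[OF Pc] T g])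
      show "\<forall>\<^sub>F m in sequentially. projected_gram P (C2_bar n l k a b m) *\<^sub>v g = 0\<^sub>v (n + l - k)"
        using eventually_ge_at_top[of m0]
      proof eventually_elim
        case (elim m)
        have D: "(C2_bar n l k a b m * P)\<^sup>T \<in> carrier_mat (n + l - k) (m - k)"
          using C2_bar_carrier[of n l k a b m] Pc by simp
        show ?case
          unfolding projected_gram_mult_vec[OF Pc C2_bar_carrier g] Pg using z0[OF elim] mult_mat_zero_vec[OF D] by simp
      qed
    qed
    then have "g \<in> mat_range U" unfolding U(2) by (intro mat_kernelI[OF T(1) g])
    then show "z \<in> mat_range (P * U)" unfolding mat_range_mult[OF Pc Uc] Pg[symmetric] by (rule imageI)
  qed
  then show ?thesis
    by (rule range_eq_if_injective_subset[OF Yc orthonormal_cols_mult[OF P(1) U(1)], rotated]) (rule injY)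
qed

section \<open>Consistency of the estimator\<close>

theorem theorem4:
  fixes M :: "'w measure" and n l k r :: nat and \<sigma> :: real
    and A1 B1 P T_bar X_min W :: "real mat"
    and a b :: "nat \<Rightarrow> real Matrix.vec" and e :: "nat \<Rightarrow> 'w \<Rightarrow> real Matrix.vec"
  assumes prob: "prob_space M"
    and dims: "1 \<le> n" "1 \<le> l" "k < r" "r \<le> n"
    and A1: "A1 \<in> carrier_mat k n" "mat_rank A1 = k"
    and B1: "B1 \<in> carrier_mat k l"
    and a: "\<And>i. k < i \<Longrightarrow> a i \<in> carrier_vec n"
    and b: "\<And>i. k < i \<Longrightarrow> b i \<in> carrier_vec l"
    and consistent: "\<exists>X \<in> carrier_mat n l. A1 * X = B1 \<and>
          (\<forall>m>k. rows_upto n k a m * X = rows_upto l k b m)"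
    and rank: "\<forall>\<^sub>F m in sequentially. mat_rank (A1 @\<^sub>r rows_upto n k a m) = r"
    and P: "P \<in> carrier_mat (n + l) (n + l - k)" "P\<^sup>T * P = 1\<^sub>m (n + l - k)"
          "(A1 @\<^sub>c B1) * P = 0\<^sub>m k (n + l - k)" "k = 0 \<Longrightarrow> P = 1\<^sub>m (n + l)"
    and X_min: "\<forall>\<^sub>F m in sequentially. min_frobenius_solution
          (A1 @\<^sub>r rows_upto n k a m) (B1 @\<^sub>r rows_upto l k b m) X_min"
    and W: "W \<in> carrier_mat n (n - r)"
          "\<forall>\<^sub>F m in sequentially. mat_range W = mat_kernel (A1 @\<^sub>r rows_upto n k a m)"
    and iid: "iid_vars M (vec_borel (n + l)) e {k<..}"
    and moments: "\<And>i. k < i \<Longrightarrow> square_integrable_vec M (n + l) (e i)"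
          "\<And>i. k < i \<Longrightarrow> mean_vec M (n + l) (e i) = 0\<^sub>v (n + l)"
          "\<And>i. k < i \<Longrightarrow> cov_mat M (n + l) (e i) = \<sigma>\<^sup>2 \<cdot>\<^sub>m 1\<^sub>m (n + l)"
    and T_bar: "T_bar \<in> carrier_mat (n + l - k) (n + l - k)"
          "mat_tendsto (\<lambda>m. inverse (real m) \<cdot>\<^sub>m projected_gram P (C2_bar n l k a b m)) T_bar"
          "mat_rank T_bar = r - k"
  shows "AE \<omega> in M. \<forall>V.
           (\<forall>m>k. smallest_eigenvectors (projected_gram P (C2 n l k a b e m \<omega>)) (n + l - r) (V m)) \<longrightarrow>
           (\<exists>d. (\<forall>m>k. is_minimum
                    ((\<lambda>Zb. spectral_norm (P * V m - Zb)) ` Z_bar_set n l r X_min W) (d m)) \<and>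
                d \<longlonglongrightarrow> 0)"
proof -
  interpret prob_space M by (rule prob)
  let ?q = "n + l - k" and ?p = "n + l - r"
  have Po: "orthonormal_cols (n + l) ?q P" using P(1,2) by (simp add: orthonormal_cols_def)
  have inv: "0 \<le> inverse (real m)" for m by simp
  note gram_c = projected_gram_carrier[OF P(1)]
  have T_sym: "T_bar\<^sup>T = T_bar"
    by (rule gram_limit_symmetric[OF gram_c projected_gram_symmetric[OF P(1) C2_bar_carrier] T_bar(1,2)])
  have T_psd: "0 \<le> y \<bullet> (T_bar *\<^sub>v y)" if "y \<in> carrier_vec ?q" for y
    by (rule gram_limit_psd[OF gram_c projected_gram_psd[OF P(1) C2_bar_carrier] T_bar(1) inv T_bar(2) that])
  obtain U where "orthonormal_cols ?q (?q - mat_rank T_bar) U" and ranU: "mat_range U = mat_kernel T_bar"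
    by (rule kernel_basis_of_rank[OF T_bar(1)])
  moreover have "?q - mat_rank T_bar = ?p" using T_bar(3) dims by simp
  ultimately have U: "orthonormal_cols ?q ?p U" by simp
  have ran: "mat_range (Y_bar n l r X_min W) = mat_range (P * U)"
    by (rule Y_bar_range_limit_kernel[OF less_imp_le[OF dims(3)] dims(4) A1 B1 rank Po P(3) X_min W T_bar(1,2) U ranU])
  have Z_eq: "Z_bar_set n l r X_min W = orthonormal_bases (n + l) ?p (mat_range (P * U))"
    unfolding Z_bar_set_def orthonormal_bases_def orthonormal_cols_def ran by auto
  have "AE \<omega> in M. mat_tendsto (\<lambda>m. inverse (real m) \<cdot>\<^sub>m projected_gram P (C2 n l k a b e m \<omega>))
           (T_bar + \<sigma>\<^sup>2 \<cdot>\<^sub>m 1\<^sub>m ?q)"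
    by (rule noisy_projected_gram_limit[OF Po iid moments(1,2,3)[OF lessI] T_bar(1,2)])
  then show ?thesis
  proof (rule eventually_mono, intro allI impI)
    fix \<omega> and V :: "nat \<Rightarrow> real mat"
    assume lim: "mat_tendsto (\<lambda>m. inverse (real m) \<cdot>\<^sub>m projected_gram P (C2 n l k a b e m \<omega>))
        (T_bar + \<sigma>\<^sup>2 \<cdot>\<^sub>m 1\<^sub>m ?q)"
      and V: "\<forall>m>k. smallest_eigenvectors (projected_gram P (C2 n l k a b e m \<omega>)) ?p (V m)"
    have V_m: "smallest_eigenvectors (projected_gram P (C2 n l k a b e m \<omega>)) ?p (V m)" if "k < m" for m
      using V that by blast
    show "\<exists>d. (\<forall>m>k. is_minimum ((\<lambda>Zb. spectral_norm (P * V m - Zb)) ` Z_bar_set n l r X_min W) (d m)) \<and>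
                d \<longlonglongrightarrow> 0"
      unfolding Z_eq
      by (rule distance_to_kernel_bases_tendsto_0[OF Po gram_c projected_gram_symmetric[OF P(1) C2_carrier]
            T_bar(1) T_sym T_psd lim V_m U ranU])
  qed
qed

end
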